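(* Consider the regression model $Y_i=f_0(X_i)+\xi_i$, $i=1,\ldots,n$, where $f_0\in\mathcal{F}$ and $X_1,\ldots,X_n$ are i.i.d. with law $P$ on $(\mathcal{X},\mathcal{A})$. Suppose that $\xi_1,\ldots,\xi_n$ are mean-zero errors, independent of $X_1,\ldots,X_n$, with the same marginal distributions, and $\|\xi_1\|_{p,1}<\infty$ for some $p\ge1$. Further suppose that $\mathcal{F}$ is a $P$-centered function class (if the $\xi_i$'s are i.i.d., $\mathcal{F}$ need not be $P$-centered) such that $\mathcal{F}-f_0\subset L_\infty(1)$ satisfies the entropy condition with exponent $\alpha$ for some $\alpha\in(0,2)$. Then any least squares estimator $\hat f_n\in\arg\min_{f\in\mathcal{F}}\frac1n\sum_{i=1}^n(Y_i-f(X_i))^2$ satisfies $$\|\hat f_n-f_0\|_{L_2(P)}=\mathcal{O}_{\mathbf{P}}\big(n^{-\frac{1}{2+\alpha}}\vee n^{-\frac12+\frac{1}{2p}}\big)\qquad(n\to\infty).$$ Furthermore, if the $\xi_i$'s are i.i.d. and $p\ge2$, then the bound holds in expectation: $$\mathbb{E}\|\hat f_n-f_0\|_{L_2(P)}=\mathcal{O}\big(n^{-\frac{1}{2+\alpha}}\vee n^{-\frac12+\frac{1}{2p}}\big).$$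
   Context: $\|\xi\|_{p,1}=\int_0^\infty\mathbb{P}(|\xi|>t)^{1/p}dt$. The vectors $(\xi_i)$ and $(X_i)$ are independent, but (except where i.i.d. is stated) the $\xi_i$ may be arbitrarily dependent on each other. $\mathcal{F}$ is $P$-centered if $Pf=0$ for all $f\in\mathcal{F}$. $\mathcal{F}-f_0=\{f-f_0:f\in\mathcal{F}\}$, and $L_\infty(1)$ is the set of measurable $f:\mathcal{X}\to\mathbb{R}$ with $\sup_x|f(x)|\le1$. All function classes are assumed countable. Entropy condition with exponent $\alpha\in(0,2)$ for a class $\mathcal{H}$ with envelope $H(x)=\sup_{h\in\mathcal{H}}|h(x)|$: there is a constant $C$ such that either (uniform entropy) for all $\epsilon>0$, $\sup_Q\log\mathcal{N}(\epsilon\|H\|_{L_2(Q)},\mathcal{H},L_2(Q))\le C\epsilon^{-\alpha}$, the supremum being over all finitely discrete probability measures $Q$ on $(\mathcal{X},\mathcal{A})$ (with $\|H\|_{L_2(Q)}>0$); or (bracketing entropy) for all $\epsilon>0$, $\log\mathcal{N}_{[\,]}(\epsilon,\mathcal{H},L_2(P))\le C\epsilon^{-\alpha}$. Here $\mathcal{N}$ and $\mathcal{N}_{[\,]}$ are the covering and bracketing numbers. $a\vee b=\max\{a,b\}$. *)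

theory Defs
  imports "HOL-Probability.Probability" "HOL-Library.Landau_Symbols"
begin

definition L2_space :: "'x measure \<Rightarrow> ('x \<Rightarrow> real) set" where
  "L2_space M = {f \<in> borel_measurable M. integrable M (\<lambda>x. (f x)\<^sup>2)}"

text \<open>Only meaningful for functions in \<open>L2_space M\<close>; the Bochner integral, and hence
  the value below, is 0 when the square is not integrable.\<close>

definition L2_norm :: "'x measure \<Rightarrow> ('x \<Rightarrow> real) \<Rightarrow> real" where
  "L2_norm M f = sqrt (\<integral>x. (f x)\<^sup>2 \<partial>M)"

definition Lp1_norm :: "'w measure \<Rightarrow> ('w \<Rightarrow> real) \<Rightarrow> real \<Rightarrow> ennreal" where
  "Lp1_norm M xi p =
     (\<integral>\<^sup>+t\<in>{0..}. ennreal (measure M {\<omega> \<in> space M. \<bar>xi \<omega>\<bar> > t} powr (1 / p)) \<partial>lborel)"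

definition Linf_unit :: "'x measure \<Rightarrow> ('x \<Rightarrow> real) set" where
  "Linf_unit A = {f \<in> borel_measurable A. \<forall>x\<in>space A. \<bar>f x\<bar> \<le> 1}"

definition centered_class :: "'x measure \<Rightarrow> ('x \<Rightarrow> real) set \<Rightarrow> bool" where
  "centered_class P F \<longleftrightarrow> (\<forall>f\<in>F. has_bochner_integral P f 0)"

definition envelope :: "('x \<Rightarrow> real) set \<Rightarrow> 'x \<Rightarrow> real" where
  "envelope H x = (SUP h\<in>H. \<bar>h x\<bar>)"

text \<open>Balls are open, and neither centers of balls nor end points of brackets need belong to
  the class, but they must have finite \<open>L\<^sub>2\<close> norm. Both numbers are \<open>\<infinity>\<close> if no
  finite cover exists.\<close>

definition covering_number :: "'x measure \<Rightarrow> ('x \<Rightarrow> real) set \<Rightarrow> real \<Rightarrow> enat" where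
  "covering_number Q H r =
     (INF G \<in> {G. finite G \<and> G \<subseteq> L2_space Q \<and>
                  (\<forall>h\<in>H. \<exists>g\<in>G. L2_norm Q (\<lambda>x. h x - g x) < r)}.
        enat (card G))"

definition bracketing_number :: "'x measure \<Rightarrow> ('x \<Rightarrow> real) set \<Rightarrow> real \<Rightarrow> enat" where
  "bracketing_number P H r =
     (INF B \<in> {B. finite B \<and>
                  (\<forall>(l, u)\<in>B. l \<in> L2_space P \<and> u \<in> L2_space P \<and>
                     L2_norm P (\<lambda>x. u x - l x) < r) \<and>
                  (\<forall>h\<in>H. \<exists>(l, u)\<in>B. \<forall>x\<in>space P. l x \<le> h x \<and> h x \<le> u x)}.
        enat (card B))"

definition ln_enat :: "enat \<Rightarrow> ereal" where
  "ln_enat N = (case N of enat k \<Rightarrow> ereal (ln (real k)) | \<infinity> \<Rightarrow> \<infinity>)"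

text \<open>The probability measures on the \<open>\<sigma>\<close>-algebra of \<open>A\<close> that are finite combinations of
  point masses (the measure carried by \<open>A\<close> itself plays no role).\<close>

definition finitely_discrete :: "'x measure \<Rightarrow> 'x measure set" where
  "finitely_discrete A =
     {Q. prob_space Q \<and> sets Q = sets A \<and>
         (\<exists>S w. finite S \<and> S \<subseteq> space A \<and> (\<forall>x\<in>S. 0 \<le> w x) \<and>
            (\<forall>B\<in>sets A. emeasure Q B = ennreal (\<Sum>x\<in>S. w x * indicator B x)))}"

definition uniform_entropy :: "'x measure \<Rightarrow> ('x \<Rightarrow> real) set \<Rightarrow> real \<Rightarrow> real \<Rightarrow> bool" where
  "uniform_entropy A H \<alpha> C \<longleftrightarrow>
     (\<forall>\<epsilon>>0. (SUP Q \<in> {Q \<in> finitely_discrete A. L2_norm Q (envelope H) > 0}.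
               ln_enat (covering_number Q H (\<epsilon> * L2_norm Q (envelope H))))
             \<le> ereal (C * \<epsilon> powr (- \<alpha>)))"

definition bracketing_entropy :: "'x measure \<Rightarrow> ('x \<Rightarrow> real) set \<Rightarrow> real \<Rightarrow> real \<Rightarrow> bool" where
  "bracketing_entropy P H \<alpha> C \<longleftrightarrow>
     (\<forall>\<epsilon>>0. ln_enat (bracketing_number P H \<epsilon>) \<le> ereal (C * \<epsilon> powr (- \<alpha>)))"

definition entropy_condition :: "'x measure \<Rightarrow> ('x \<Rightarrow> real) set \<Rightarrow> real \<Rightarrow> bool" where
  "entropy_condition P H \<alpha> \<longleftrightarrow>
     (\<exists>C. uniform_entropy P H \<alpha> C \<or> bracketing_entropy P H \<alpha> C)"

definition empirical_risk ::
  "nat \<Rightarrow> (nat \<Rightarrow> 'x) \<Rightarrow> (nat \<Rightarrow> real) \<Rightarrow> ('x \<Rightarrow> real) \<Rightarrow> real" where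
  "empirical_risk n x y f = 1 / real n * (\<Sum>i=1..n. (y i - f (x i))\<^sup>2)"

definition least_squares_estimate ::
  "nat \<Rightarrow> ('x \<Rightarrow> real) set \<Rightarrow> (nat \<Rightarrow> 'x) \<Rightarrow> (nat \<Rightarrow> real) \<Rightarrow> ('x \<Rightarrow> real) \<Rightarrow> bool" where
  "least_squares_estimate n F x y f \<longleftrightarrow> is_arg_min (empirical_risk n x y) (\<lambda>g. g \<in> F) f"

text \<open>\<open>prob_space.indep_var\<close> for variables whose target spaces have different types.\<close>

definition indep_rv ::
  "'w measure \<Rightarrow> 'a measure \<Rightarrow> ('w \<Rightarrow> 'a) \<Rightarrow> 'b measure \<Rightarrow> ('w \<Rightarrow> 'b) \<Rightarrow> bool" where
  "indep_rv M A U B V \<longleftrightarrow> U \<in> measurable M A \<and> V \<in> measurable M B \<and>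
     prob_space.indep_set M {U -` S \<inter> space M |S. S \<in> sets A} {V -` S \<inter> space M |S. S \<in> sets B}"

text \<open>\<open>Z\<^sub>n = O\<^sub>P(r\<^sub>n)\<close>, where \<open>Z\<^sub>n\<close> may live on a probability space depending on \<open>n\<close>.\<close>

definition bigo_in_prob ::
  "(nat \<Rightarrow> 'w measure) \<Rightarrow> (nat \<Rightarrow> 'w \<Rightarrow> real) \<Rightarrow> (nat \<Rightarrow> real) \<Rightarrow> bool" where
  "bigo_in_prob M Z r \<longleftrightarrow>
     (\<forall>\<epsilon>>0. \<exists>K>0. \<forall>\<^sub>F n in sequentially.
        measure (M n) {\<omega> \<in> space (M n). \<bar>Z n \<omega>\<bar> > K * r n} \<le> \<epsilon>)"

definition lse_rate :: "real \<Rightarrow> real \<Rightarrow> nat \<Rightarrow> real" where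
  "lse_rate \<alpha> p n =
     max (real n powr (- 1 / (2 + \<alpha>))) (real n powr (- 1 / 2 + 1 / (2 * p)))"

end

theory Submission
  imports Defs
begin

text \<open>
Write \<open>h = fhat - f0\<close>. Since the least squares estimate has no larger risk than \<open>f0\<close>, the squared
errors cancel and \<open>n * \<parallel>h\<parallel>\<^sup>2\<close> is at most twice the multiplier sum \<open>\<Sum> \<xi> i * h (X i)\<close> plus the
deviation of \<open>\<Sum> (h (X i))\<^sup>2\<close> from its mean (\<open>lse_basic_inequality\<close>). If the expected supremum of this
over all \<open>h\<close> of norm at most \<open>r\<close> is bounded by a constant times
\<open>sqrt n * r powr (1 - \<alpha> / 2) + n powr s\<close> with \<open>s = max (1 / p) (\<alpha> / (2 + \<alpha>))\<close>, then at the claimed rate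
\<open>\<delta>\<close> the bound is of order \<open>n * \<delta>\<^sup>2\<close>, and it grows more slowly than \<open>r\<close>. Summing over the shells
\<open>2 ^ j * \<delta> < \<parallel>h\<parallel> \<le> 2 ^ (j + 1) * \<delta>\<close> therefore bounds the expected error by a multiple of \<open>\<delta>\<close>
(\<open>peeling\<close>, \<open>lse_expected_rate\<close>), and Markov's inequality gives the bound in probability.

The core is the bound \<open>sqrt k * r powr (1 - \<alpha> / 2) + k powr (\<alpha> / (2 + \<alpha>))\<close> for the Rademacher complexity
of the local class on \<open>k\<close> observations (\<open>local_complexity_bound\<close>). Under uniform entropy, chaining on
a fixed sample gives \<open>sqrt k * \<sigma> powr (1 - \<alpha> / 2)\<close> with the empirical radius \<open>\<sigma>\<close>; the mean of \<open>\<sigma>\<^sup>2\<close> exceeds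
\<open>r\<^sup>2\<close> by the fluctuation of the empirical squared norms, which by symmetrization and contraction is
bounded by the complexity itself, and the resulting inequality is solved
(\<open>local_complexity_bound_uniform\<close>). Under bracketing entropy, chains of brackets are stopped where a
bracket gets too wide, which keeps the links small enough for exponential moments and the errors
small in the mean (\<open>rad_complexity_bracketing\<close>).

The errors enter through the layer-cake formula: the absolute value of \<open>\<xi> i\<close> is the integral over
\<open>t \<ge> 0\<close> of the indicator of \<open>\<bar>\<xi> i\<bar> > t\<close>. The process is
symmetrized in the sample if the functions are centred, and in the errors if these are independent
(\<open>multiplier_symmetrize\<close>). The symmetrized multiplier process is
dominated by an integral over \<open>t\<close> of unweighted Rademacher processes, each over the random set of
indices with \<open>\<bar>\<xi> i\<bar> > t\<close>. The complexity only depends on the size of this set, through powers below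
one, so that only its mean \<open>n * P(\<bar>\<xi>\<bar> > t)\<close> matters; the powers of the tail integrate to the norm
\<open>\<parallel>\<xi>\<parallel>\<close> of the moment condition (\<open>multiplier_bound\<close>).

All suprema are first taken over finite classes, where they are maxima and measurability is
immediate; constants do not depend on the finite class, so that countable classes follow by
monotone convergence.
\<close>

section \<open>Rademacher averages\<close>

lemma MAX_attained:
  fixes f :: "'t \<Rightarrow> 'b::linorder"
  assumes "finite T" "T \<noteq> {}"
  obtains t where "t \<in> T" "(MAX t\<in>T. f t) = f t"
  using Max_in[of "f ` T"] assms by (metis (no_types, lifting) finite_imageI image_iff image_is_empty)

definition signs :: "'i set \<Rightarrow> 'i \<Rightarrow> real" where
  "signs A i = (if i \<in> A then 1 else -1)"

text \<open>The expectation over independent uniform signs \<open>s i\<close>, \<open>i \<in> I\<close>, written as a finite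
  average so that it commutes with integrals without any measurability question.\<close>

definition rad_mean :: "'i set \<Rightarrow> (('i \<Rightarrow> real) \<Rightarrow> real) \<Rightarrow> real" where
  "rad_mean I f = (\<Sum>A\<in>Pow I. f (signs A)) / 2 ^ card I"

lemma abs_signs [simp]: "\<bar>signs A i\<bar> = 1"
  by (simp add: signs_def)

lemma rad_mean_empty [simp]: "rad_mean {} f = f (signs {})"
  by (simp add: rad_mean_def)

lemma rad_mean_insert:
  assumes "finite I" "i \<notin> I"
  shows "rad_mean (insert i I) f =
    (rad_mean I (\<lambda>s. f (s(i := 1))) + rad_mean I (\<lambda>s. f (s(i := -1)))) / 2"
proof -
  have [simp]: "(signs A)(i := 1) = signs (insert i A)" for A :: "'a set"
    by (auto simp: signs_def)
  have "(signs A)(i := -1) = signs A" if "A \<subseteq> I" for A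
    using that assms(2) by (auto simp: signs_def fun_eq_iff)
  then have low: "(\<Sum>A\<in>Pow I. f ((signs A)(i := -1))) = (\<Sum>A\<in>Pow I. f (signs A))"
    by (intro sum.cong) auto
  have inj: "inj_on (insert i) (Pow I)"
    using assms(2) by (auto simp: inj_on_def)
  have "(\<Sum>A\<in>Pow (insert i I). f (signs A)) =
      (\<Sum>A\<in>Pow I. f (signs A)) + (\<Sum>A\<in>insert i ` Pow I. f (signs A))"
    unfolding Pow_insert using assms by (intro sum.union_disjoint) auto
  also have "(\<Sum>A\<in>insert i ` Pow I. f (signs A)) = (\<Sum>A\<in>Pow I. f (signs (insert i A)))"
    using inj by (subst sum.reindex) auto
  finally show ?thesis
    using assms by (simp add: rad_mean_def low add_divide_distrib)
qed

lemma rad_mean_mono: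
  assumes "\<And>A. A \<subseteq> I \<Longrightarrow> f (signs A) \<le> g (signs A)"
  shows "rad_mean I f \<le> rad_mean I g"
  unfolding rad_mean_def using assms by (intro divide_right_mono sum_mono) auto

lemma rad_mean_nonneg:
  assumes "\<And>A. A \<subseteq> I \<Longrightarrow> 0 \<le> f (signs A)"
  shows "0 \<le> rad_mean I f"
  unfolding rad_mean_def using assms by (intro divide_nonneg_nonneg sum_nonneg) auto

lemma rad_mean_add: "rad_mean I (\<lambda>s. f s + g s) = rad_mean I f + rad_mean I g"
  by (simp add: rad_mean_def sum.distrib add_divide_distrib)

lemma rad_mean_cmult: "rad_mean I (\<lambda>s. c * f s) = c * rad_mean I f"
  by (simp add: rad_mean_def sum_distrib_left)

lemma rad_mean_sum: "rad_mean I (\<lambda>s. \<Sum>j\<in>J. f j s) = (\<Sum>j\<in>J. rad_mean I (f j))"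
  by (simp add: rad_mean_def sum.swap[of _ J] sum_divide_distrib)

lemma rad_mean_const [simp]: "finite I \<Longrightarrow> rad_mean I (\<lambda>s. c) = c"
  by (simp add: rad_mean_def card_Pow)

lemma rad_mean_integral:
  fixes f :: "('i \<Rightarrow> real) \<Rightarrow> 'a \<Rightarrow> real"
  assumes "\<And>A. A \<subseteq> I \<Longrightarrow> integrable N (f (signs A))"
  shows "rad_mean I (\<lambda>s. \<integral>x. f s x \<partial>N) = (\<integral>x. rad_mean I (\<lambda>s. f s x) \<partial>N)"
    and "integrable N (\<lambda>x. rad_mean I (\<lambda>s. f s x))"
  unfolding rad_mean_def using assms
  by (auto simp: Bochner_Integration.integral_sum
      intro!: integrable_divide Bochner_Integration.integrable_sum)

lemma rad_mean_restrict:
  assumes "finite I" "A \<subseteq> I" "\<And>s t. (\<And>i. i \<in> A \<Longrightarrow> s i = t i) \<Longrightarrow> f s = f t"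
  shows "rad_mean I f = rad_mean A f"
proof -
  have "rad_mean (A \<union> J) f = rad_mean A f" if "finite J" "J \<inter> A = {}" for J
    using that
  proof induction
    case (insert j J)
    have "f (s(j := c)) = f s" for s c
      using insert.prems by (intro assms(3)) auto
    with insert show ?case
      using finite_subset[OF assms(2,1)]
      by (simp add: rad_mean_insert)
  qed simp
  from this[of "I - A"] show ?thesis
    using assms(1,2) by (simp add: Un_absorb1 Diff_Int_distrib2)
qed

lemma rad_mean_exp:
  assumes "finite I"
  shows "rad_mean I (\<lambda>s. exp (\<Sum>i\<in>I. s i * c i)) = (\<Prod>i\<in>I. cosh (c i :: real))"
  using assms
proof induction
  case (insert i I)
  have eq: "exp (\<Sum>j\<in>insert i I. (s(i := b)) j * c j) = exp (b * c i) * exp (\<Sum>j\<in>I. s j * c j)"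
    for s b
  proof -
    have "(\<Sum>j\<in>I. (s(i := b)) j * c j) = (\<Sum>j\<in>I. s j * c j)"
      using insert(2) by (intro sum.cong) auto
    with insert(1,2) show ?thesis by (simp add: exp_add del: fun_upd_apply) simp
  qed
  show ?case
    unfolding rad_mean_insert[OF insert(1,2)] eq rad_mean_cmult insert(3)
    using insert(1,2) by (simp add: cosh_field_def algebra_simps add_divide_distrib)
qed simp

text \<open>The contraction principle of Ledoux and Talagrand. Only the increments of the coordinates
  enter: exposing one sign at a time, the two maximisers for \<open>s i = 1\<close> and \<open>s i = -1\<close> may be
  exchanged, so that only the absolute difference of their \<open>i\<close>-th coordinates matters.\<close>

lemma rad_mean_contraction:
  fixes a b :: "'t \<Rightarrow> 'i \<Rightarrow> real"
  assumes "finite I" and T: "finite T" "T \<noteq> {}"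
    and ab: "\<And>t t' i. t \<in> T \<Longrightarrow> t' \<in> T \<Longrightarrow> i \<in> I \<Longrightarrow> \<bar>b t i - b t' i\<bar> \<le> \<bar>a t i - a t' i\<bar>"
  shows "rad_mean I (\<lambda>s. MAX t\<in>T. u t + (\<Sum>i\<in>I. s i * b t i))
       \<le> rad_mean I (\<lambda>s. MAX t\<in>T. u t + (\<Sum>i\<in>I. s i * a t i))"
  using assms(1) ab
proof (induction arbitrary: u)
  case (insert i I)
  have eq: "(\<Sum>j\<in>I. (s(i := x)) j * c t j) = (\<Sum>j\<in>I. s j * c t j)"
    for s x t and c :: "'t \<Rightarrow> 'i \<Rightarrow> real"
    using insert(2) by (intro sum.cong) auto
  have split: "rad_mean (insert i I) (\<lambda>s. MAX t\<in>T. u t + (\<Sum>j\<in>insert i I. s j * c t j)) =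
     (rad_mean I (\<lambda>s. MAX t\<in>T. (u t + c t i) + (\<Sum>j\<in>I. s j * c t j)) +
      rad_mean I (\<lambda>s. MAX t\<in>T. (u t - c t i) + (\<Sum>j\<in>I. s j * c t j))) / 2"
    for c :: "'t \<Rightarrow> 'i \<Rightarrow> real"
  proof -
    have "u t + (\<Sum>j\<in>insert i I. (s(i := x)) j * c t j) = (u t + x * c t i) + (\<Sum>j\<in>I. s j * c t j)"
      for s x t
      using insert(1,2) by (simp add: eq del: fun_upd_apply) simp
    note step = this
    show ?thesis
      unfolding rad_mean_insert[OF insert(1,2)] step by simp
  qed
  have swap: "(MAX t\<in>T. w t + b t i) + (MAX t\<in>T. w t - b t i)
      \<le> (MAX t\<in>T. w t + a t i) + (MAX t\<in>T. w t - a t i)" for w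
  proof -
    obtain t where t: "t \<in> T" "(MAX t\<in>T. w t + b t i) = w t + b t i"
      using MAX_attained[OF T, of "\<lambda>t. w t + b t i"] by blast
    obtain t' where t': "t' \<in> T" "(MAX t\<in>T. w t - b t i) = w t' - b t' i"
      using MAX_attained[OF T, of "\<lambda>t. w t - b t i"] by blast
    have up: "w r + a r i \<le> (MAX t\<in>T. w t + a t i)" "w r - a r i \<le> (MAX t\<in>T. w t - a t i)"
      if "r \<in> T" for r
      using T that by (auto intro!: Max_ge)
    have "\<bar>b t i - b t' i\<bar> \<le> \<bar>a t i - a t' i\<bar>"
      using insert.prems t(1) t'(1) by blast
    with up[OF t(1)] up[OF t'(1)] show ?thesis
      unfolding t(2) t'(2) by linarith
  qed
  have IH: "rad_mean I (\<lambda>s. MAX t\<in>T. v t + (\<Sum>j\<in>I. s j * b t j))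
      \<le> rad_mean I (\<lambda>s. MAX t\<in>T. v t + (\<Sum>j\<in>I. s j * a t j))" for v
    using insert.IH insert.prems by blast
  have "rad_mean (insert i I) (\<lambda>s. MAX t\<in>T. u t + (\<Sum>j\<in>insert i I. s j * b t j)) \<le>
     (rad_mean I (\<lambda>s. MAX t\<in>T. (u t + b t i) + (\<Sum>j\<in>I. s j * a t j)) +
      rad_mean I (\<lambda>s. MAX t\<in>T. (u t - b t i) + (\<Sum>j\<in>I. s j * a t j))) / 2"
    unfolding split by (intro divide_right_mono add_mono IH) simp
  also have "\<dots> \<le> (rad_mean I (\<lambda>s. MAX t\<in>T. (u t + a t i) + (\<Sum>j\<in>I. s j * a t j)) +
      rad_mean I (\<lambda>s. MAX t\<in>T. (u t - a t i) + (\<Sum>j\<in>I. s j * a t j))) / 2"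
    unfolding rad_mean_add[symmetric]
  proof (intro divide_right_mono rad_mean_mono)
    fix A
    show "(MAX t\<in>T. u t + b t i + (\<Sum>j\<in>I. signs A j * a t j)) +
          (MAX t\<in>T. u t - b t i + (\<Sum>j\<in>I. signs A j * a t j))
        \<le> (MAX t\<in>T. u t + a t i + (\<Sum>j\<in>I. signs A j * a t j)) +
          (MAX t\<in>T. u t - a t i + (\<Sum>j\<in>I. signs A j * a t j))"
      using swap[of "\<lambda>t. u t + (\<Sum>j\<in>I. signs A j * a t j)"]
      by (simp add: algebra_simps)
  qed simp
  finally show ?case
    unfolding split .
qed simp

text \<open>Together with the negatives of all coordinate vectors, the absolute values become a one-sided
  maximum, to which the contraction principle applies.\<close>

lemma rad_mean_contraction_abs:
  fixes v :: "'t \<Rightarrow> 'i \<Rightarrow> real"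
  assumes "finite I" and T: "finite T" "T \<noteq> {}" and "\<And>i. i \<in> I \<Longrightarrow> \<bar>c i\<bar> \<le> \<bar>d i\<bar>"
  shows "rad_mean I (\<lambda>s. MAX t\<in>T. \<bar>\<Sum>i\<in>I. s i * (c i * v t i)\<bar>)
       \<le> rad_mean I (\<lambda>s. MAX t\<in>T. \<bar>\<Sum>i\<in>I. s i * (d i * v t i)\<bar>)"
proof -
  define T' where "T' = T \<times> {1, -1::real}"
  have T': "finite T'" "T' \<noteq> {}" using T by (auto simp: T'_def)
  have fold: "(MAX t\<in>T. \<bar>\<Sum>i\<in>I. s i * (e i * v t i)\<bar>) =
      (MAX t\<in>T'. 0 + (\<Sum>i\<in>I. s i * (e i * (snd t * v (fst t) i))))" for s e
  proof -
    have "(\<Sum>i\<in>I. s i * (e i * (snd t * v (fst t) i))) =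
        snd t * (\<Sum>i\<in>I. s i * (e i * v (fst t) i))" for t
      by (simp add: sum_distrib_left algebra_simps)
    then have *: "(MAX t\<in>T'. 0 + (\<Sum>i\<in>I. s i * (e i * (snd t * v (fst t) i)))) =
        (MAX t\<in>T'. snd t * (\<Sum>i\<in>I. s i * (e i * v (fst t) i)))" by simp
    show ?thesis unfolding *
    proof (rule antisym)
      show "(MAX t\<in>T. \<bar>\<Sum>i\<in>I. s i * (e i * v t i)\<bar>)
          \<le> (MAX t\<in>T'. snd t * (\<Sum>i\<in>I. s i * (e i * v (fst t) i)))"
      proof (intro Max.boundedI, use T in simp, use T in simp, clarify)
        fix t assume "t \<in> T"
        then show "\<bar>\<Sum>i\<in>I. s i * (e i * v t i)\<bar>
            \<le> (MAX t\<in>T'. snd t * (\<Sum>i\<in>I. s i * (e i * v (fst t) i)))"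
          using T'
          by (intro Max_ge)
            (auto simp: image_iff T'_def abs_if
              intro!: bexI[of _ "(t, sgn (\<Sum>i\<in>I. s i * (e i * v t i)))"] bexI[of _ "(t, 1)"]
                      bexI[of _ "(t, -1)"])
      qed
      show "(MAX t\<in>T'. snd t * (\<Sum>i\<in>I. s i * (e i * v (fst t) i)))
          \<le> (MAX t\<in>T. \<bar>\<Sum>i\<in>I. s i * (e i * v t i)\<bar>)"
      proof (rule Max.boundedI)
        fix y assume "y \<in> (\<lambda>t. snd t * (\<Sum>i\<in>I. s i * (e i * v (fst t) i))) ` T'"
        then obtain t b where t: "t \<in> T" "b \<in> {1, -1}" "y = b * (\<Sum>i\<in>I. s i * (e i * v t i))"
          by (fastforce simp: T'_def)
        have "\<bar>\<Sum>i\<in>I. s i * (e i * v t i)\<bar> \<le> (MAX t\<in>T. \<bar>\<Sum>i\<in>I. s i * (e i * v t i)\<bar>)"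
          using T t by (intro Max_ge) auto
        then show "y \<le> (MAX t\<in>T. \<bar>\<Sum>i\<in>I. s i * (e i * v t i)\<bar>)"
          using t by (auto simp: abs_le_iff)
      qed (use T' in auto)
    qed
  qed
  show ?thesis
    unfolding fold
  proof (rule rad_mean_contraction[OF assms(1) T'])
    fix t t' i assume "i \<in> I"
    then show "\<bar>c i * (snd t * v (fst t) i) - c i * (snd t' * v (fst t') i)\<bar>
        \<le> \<bar>d i * (snd t * v (fst t) i) - d i * (snd t' * v (fst t') i)\<bar>"
      unfolding right_diff_distrib[symmetric] abs_mult using assms(4)
      by (intro mult_right_mono) auto
  qed
qed

section \<open>Expected maxima of finitely many sums\<close>

lemma cosh_le_one_plus_square:
  fixes y :: real assumes "\<bar>y\<bar> \<le> 1" shows "cosh y \<le> 1 + y\<^sup>2"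
proof -
  have *: "cosh z \<le> 1 + z\<^sup>2" if z: "0 \<le> z" "z \<le> 1" for z :: real
  proof -
    have "1 \<le> (1 - z + z\<^sup>2) * (1 + z)"
      using z by (simp add: algebra_simps power2_eq_square)
    also have "\<dots> \<le> (1 - z + z\<^sup>2) * exp z"
      using z by (intro mult_left_mono) auto
    finally have "exp (-z) \<le> 1 - z + z\<^sup>2"
      by (simp add: exp_minus field_simps)
    with exp_bound[OF z] show ?thesis
      by (simp add: cosh_field_def field_simps)
  qed
  show ?thesis
    using *[of "\<bar>y\<bar>"] assms by (simp add: abs_if split: if_splits)
qed

lemma cosh_le_exp_square: "cosh y \<le> exp (y\<^sup>2)" for y :: real
proof (cases "\<bar>y\<bar> \<le> 1")
  case True
  then show ?thesis
    using cosh_le_one_plus_square[of y] exp_ge_add_one_self[of "y\<^sup>2"] by linarith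
next
  case False
  then have "\<bar>y\<bar> * 1 \<le> \<bar>y\<bar> * \<bar>y\<bar>"
    by (intro mult_left_mono) auto
  then have "\<bar>y\<bar> \<le> y\<^sup>2"
    by (simp add: power2_eq_square abs_mult[symmetric])
  then have "exp y \<le> exp (y\<^sup>2)" "exp (-y) \<le> exp (y\<^sup>2)"
    unfolding exp_le_cancel_iff by auto
  then have "exp y + exp (-y) \<le> 2 * exp (y\<^sup>2)" by linarith
  then show ?thesis
    by (simp add: cosh_field_def)
qed

lemma exp_le_one_plus_double:
  fixes y :: real assumes "0 \<le> y" "y \<le> 1" shows "exp y \<le> 1 + 2 * y"
proof -
  have "y * y \<le> y * 1" using assms by (intro mult_left_mono) auto
  then show ?thesis
    using exp_bound[OF assms] by (simp add: power2_eq_square)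
qed

text \<open>The maximum is bounded by a multiple of the sum of exponentials, linearised with the
  tangent of the logarithm at \<open>c\<close>. Being affine in that sum, this form of the usual
  Chernoff argument can be averaged over any source of randomness.\<close>

lemma Max_le_exp_sum:
  fixes Y :: "'w \<Rightarrow> real"
  assumes "finite W" "W \<noteq> {}" "0 < r" "0 < c"
  shows "(MAX w\<in>W. Y w) \<le> (ln c - 1 + (\<Sum>w\<in>W. exp (r * Y w)) / c) / r"
proof -
  obtain w where w: "w \<in> W" "(MAX w\<in>W. Y w) = Y w"
    using MAX_attained[OF assms(1,2), of Y] by blast
  let ?S = "\<Sum>w\<in>W. exp (r * Y w)"
  have le: "exp (r * Y w) \<le> ?S"
    using assms w by (intro member_le_sum) auto
  then have S: "0 < ?S" by (rule less_le_trans[OF exp_gt_zero])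
  have "r * Y w \<le> ln ?S"
    using le S by (simp add: ln_ge_iff)
  also have "ln ?S = ln c + ln (?S / c)"
    using S assms by (simp add: ln_div)
  also have "\<dots> \<le> ln c + (?S / c - 1)"
    using S assms by (intro add_left_mono ln_le_minus_one) auto
  finally show ?thesis
    using w assms by (simp add: field_simps)
qed

text \<open>The product of hyperbolic cosines is the exponential moment of a Rademacher sum; the factor 2
  accounts for the two signs of the absolute value.\<close>

lemma rad_mean_Max_abs_le_cosh:
  fixes w :: "'w \<Rightarrow> 'i \<Rightarrow> real"
  assumes "finite I" and W: "finite W" "W \<noteq> {}" and "0 < r" "0 < c"
  shows "rad_mean I (\<lambda>s. MAX t\<in>W. \<bar>\<Sum>i\<in>I. s i * w t i\<bar>)
    \<le> (ln c - 1 + 2 * (\<Sum>t\<in>W. \<Prod>i\<in>I. cosh (r * w t i)) / c) / r"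
proof -
  let ?d = "\<lambda>s t. \<Sum>i\<in>I. s i * w t i"
  have dist: "exp (r * ?d s t) = exp (\<Sum>i\<in>I. s i * (r * w t i))"
    "exp (- (r * ?d s t)) = exp (\<Sum>i\<in>I. s i * (- r * w t i))" for s t
    by (simp_all add: sum_distrib_left sum_negf[symmetric] algebra_simps del: sum_negf)
  have mgf: "rad_mean I (\<lambda>s. exp (r * ?d s t) + exp (- (r * ?d s t))) = 2 * (\<Prod>i\<in>I. cosh (r * w t i))"
    for t
    unfolding rad_mean_add dist rad_mean_exp[OF assms(1)] by simp
  have "rad_mean I (\<lambda>s. MAX t\<in>W. \<bar>?d s t\<bar>)
      \<le> rad_mean I (\<lambda>s. (ln c - 1) / r +
            (1 / (c * r)) * (\<Sum>t\<in>W. exp (r * ?d s t) + exp (- (r * ?d s t))))"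
  proof (rule rad_mean_mono)
    fix A
    have "(\<Sum>t\<in>W. exp (r * \<bar>?d (signs A) t\<bar>))
        \<le> (\<Sum>t\<in>W. exp (r * ?d (signs A) t) + exp (- (r * ?d (signs A) t)))"
      by (intro sum_mono) (auto simp: abs_if)
    then have "(ln c - 1 + (\<Sum>t\<in>W. exp (r * \<bar>?d (signs A) t\<bar>)) / c) / r
       \<le> (ln c - 1 + (\<Sum>t\<in>W. exp (r * ?d (signs A) t) + exp (- (r * ?d (signs A) t))) / c) / r"
      using assms by (intro divide_right_mono add_left_mono) auto
    with Max_le_exp_sum[OF W assms(4,5), of "\<lambda>t. \<bar>?d (signs A) t\<bar>"]
    show "(MAX t\<in>W. \<bar>?d (signs A) t\<bar>) \<le> (ln c - 1) / r +
        (1 / (c * r)) * (\<Sum>t\<in>W. exp (r * ?d (signs A) t) + exp (- (r * ?d (signs A) t)))"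
      by (simp add: add_divide_distrib)
  qed
  also have "\<dots> = (ln c - 1 + 2 * (\<Sum>t\<in>W. \<Prod>i\<in>I. cosh (r * w t i)) / c) / r"
    unfolding rad_mean_add rad_mean_cmult rad_mean_sum mgf[unfolded rad_mean_add] rad_mean_const[OF assms(1)]
    by (simp add: add_divide_distrib sum_distrib_left sum_divide_distrib)
  finally show ?thesis .
qed

lemma card_log_bound:
  assumes "finite W" "W \<noteq> {}" "real (card W) \<le> exp L"
  shows "ln (2 * real (card W) * exp m) \<le> L + 1 + m" and "0 < 2 * real (card W) * exp m"
proof -
  have c: "0 < card W" using assms by (simp add: card_gt_0_iff)
  then have "ln (real (card W)) \<le> L"
    using assms by (metis ln_exp ln_le_cancel_iff of_nat_0_less_iff exp_gt_zero)
  moreover have "ln (2::real) \<le> 1" using ln_2_less_1 by linarith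
  ultimately show "ln (2 * real (card W) * exp m) \<le> L + 1 + m"
    using c by (simp add: ln_mult)
qed (use assms in \<open>simp add: card_gt_0_iff\<close>)

text \<open>The maximal inequality for sub-Gaussian sums: only the Euclidean norms of the coordinate
  vectors matter.\<close>

lemma rad_mean_Max_abs_le:
  fixes w :: "'w \<Rightarrow> 'i \<Rightarrow> real"
  assumes "finite I" and W: "finite W" "W \<noteq> {}" "real (card W) \<le> exp L" and "0 < r"
    and B: "\<And>t. t \<in> W \<Longrightarrow> (\<Sum>i\<in>I. (w t i)\<^sup>2) \<le> B"
  shows "rad_mean I (\<lambda>s. MAX t\<in>W. \<bar>\<Sum>i\<in>I. s i * w t i\<bar>) \<le> (L + 1) / r + r * B"
proof -
  (* c bounds twice the sum of all exponential moments, so that the affine bound collapses to ln c / r. *)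
  define c where "c = 2 * real (card W) * exp (r\<^sup>2 * B)"
  have c: "0 < c" "ln c \<le> L + 1 + r\<^sup>2 * B"
    unfolding c_def by (rule card_log_bound[OF W])+
  have "(\<Prod>i\<in>I. cosh (r * w t i)) \<le> exp (r\<^sup>2 * B)" if t: "t \<in> W" for t
  proof -
    have "(\<Prod>i\<in>I. cosh (r * w t i)) \<le> (\<Prod>i\<in>I. exp ((r * w t i)\<^sup>2))"
      by (intro prod_mono) (auto intro: cosh_le_exp_square cosh_real_nonneg)
    also have "\<dots> = exp (r\<^sup>2 * (\<Sum>i\<in>I. (w t i)\<^sup>2))"
      using assms(1) by (simp add: exp_sum[symmetric] sum_distrib_left power_mult_distrib)
    also have "\<dots> \<le> exp (r\<^sup>2 * B)"
      using B[OF t] by (auto intro: mult_left_mono)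
    finally show ?thesis .
  qed
  then have "(\<Sum>t\<in>W. \<Prod>i\<in>I. cosh (r * w t i)) \<le> real (card W) * exp (r\<^sup>2 * B)"
    using sum_mono[of W "\<lambda>t. \<Prod>i\<in>I. cosh (r * w t i)" "\<lambda>_. exp (r\<^sup>2 * B)"] by simp
  then have le1: "2 * (\<Sum>t\<in>W. \<Prod>i\<in>I. cosh (r * w t i)) / c \<le> 1"
    using c(1) by (simp add: c_def divide_le_eq_1)
  have "rad_mean I (\<lambda>s. MAX t\<in>W. \<bar>\<Sum>i\<in>I. s i * w t i\<bar>)
     \<le> (ln c - 1 + 2 * (\<Sum>t\<in>W. \<Prod>i\<in>I. cosh (r * w t i)) / c) / r"
    by (rule rad_mean_Max_abs_le_cosh) (use assms c in auto)
  also have "\<dots> \<le> (L + 1 + r\<^sup>2 * B) / r"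
    using le1 c(2) \<open>0 < r\<close> by (intro divide_right_mono) linarith+
  also have "\<dots> = (L + 1) / r + r * B"
    using \<open>0 < r\<close> by (simp add: add_divide_distrib power2_eq_square)
  finally show ?thesis .
qed

abbreviation iid :: "'i set \<Rightarrow> 'x measure \<Rightarrow> ('i \<Rightarrow> 'x) measure" where
  "iid I P \<equiv> PiM I (\<lambda>_. P)"

abbreviation rad_sup :: "'i set \<Rightarrow> ('x \<Rightarrow> real) set \<Rightarrow> ('i \<Rightarrow> 'x) \<Rightarrow> real" where
  "rad_sup I G x \<equiv> rad_mean I (\<lambda>s. MAX h\<in>G. \<bar>\<Sum>i\<in>I. s i * h (x i)\<bar>)"

context prob_space
begin

lemma integrable_bounded:
  fixes f :: "'a \<Rightarrow> real"
  assumes "f \<in> borel_measurable M" "\<And>x. x \<in> space M \<Longrightarrow> \<bar>f x\<bar> \<le> b"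
  shows "integrable M f"
  using assms by (intro integrable_const_bound[where B=b]) auto

lemma expectation_le_const:
  fixes f :: "'a \<Rightarrow> real"
  assumes "f \<in> borel_measurable M" "\<And>x. x \<in> space M \<Longrightarrow> \<bar>f x\<bar> \<le> b" "\<And>x. x \<in> space M \<Longrightarrow> f x \<le> c"
  shows "(\<integral>x. f x \<partial>M) \<le> c"
  using integral_mono[of M f "\<lambda>_. c"] integrable_bounded[OF assms(1,2)] assms(3)
  by (simp add: prob_space)

lemma product_prob_space_const: "product_prob_space (\<lambda>_. M)"
  by (intro product_prob_spaceI prob_space_axioms)

lemma prob_space_power: "prob_space (iid I M)"
  by (intro prob_space_PiM prob_space_axioms)

lemma measurable_sum_Max_abs:
  fixes f :: "'w \<Rightarrow> 'a \<Rightarrow> real"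
  assumes "finite W" "\<And>w. w \<in> W \<Longrightarrow> f w \<in> borel_measurable M"
  shows "(\<lambda>x. MAX w\<in>W. \<bar>\<Sum>i\<in>I. c i * f w (x i)\<bar>) \<in> borel_measurable (iid I M)"
proof -
  have "(\<lambda>x. f w (x i)) \<in> borel_measurable (iid I M)" if "w \<in> W" "i \<in> I" for w i
    by (rule measurable_compose[OF measurable_component_singleton[OF that(2)] assms(2)[OF that(1)]])
  then have "(\<lambda>x. \<bar>\<Sum>i\<in>I. c i * f w (x i)\<bar>) \<in> borel_measurable (iid I M)" if "w \<in> W" for w
    using that by measurable
  then show ?thesis
    using assms(1) by (rule borel_measurable_Max[rotated])
qed

end

context prob_space
begin

text \<open>For independent sums the exponential moments are controlled by second moments as long
  as the exponent times the uniform bound \<open>b\<close> stays below one; the exponent is \<open>1 / b\<close>.\<close>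

lemma integral_rad_mean_Max_abs_le:
  assumes "finite I" and W: "finite W" "W \<noteq> {}" "real (card W) \<le> exp L" and "0 < b"
    and meas: "\<And>w. w \<in> W \<Longrightarrow> w \<in> borel_measurable M"
    and bound: "\<And>w x. w \<in> W \<Longrightarrow> x \<in> space M \<Longrightarrow> \<bar>w x\<bar> \<le> b"
    and var: "\<And>w. w \<in> W \<Longrightarrow> (\<integral>x. (w x)\<^sup>2 \<partial>M) \<le> v"
  shows "integrable (iid I M) (\<lambda>x. rad_sup I W x)"
    and "(\<integral>x. rad_sup I W x \<partial>iid I M)
      \<le> b * (L + 1) + real (card I) * v / b"
proof -
  interpret PI: prob_space "iid I M" by (rule prob_space_power)
  interpret prod: product_prob_space "\<lambda>_. M" by (rule product_prob_space_const)
  define r where "r = 1 / b"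
  define m where "m = real (card I) * v / b\<^sup>2"
  define c where "c = 2 * real (card W) * exp m"
  have r: "0 < r" using \<open>0 < b\<close> by (simp add: r_def)
  have c: "0 < c" "ln c \<le> L + 1 + m"
    unfolding c_def by (rule card_log_bound[OF W])+
  have small: "\<bar>r * w x\<bar> \<le> 1" if "w \<in> W" "x \<in> space M" for w x
    using bound[OF that] \<open>0 < b\<close> by (simp add: r_def abs_mult)
  have coshb: "cosh (r * w x) \<le> 1 + (w x)\<^sup>2 / b\<^sup>2" if "w \<in> W" "x \<in> space M" for w x
    using cosh_le_one_plus_square[OF small[OF that]] by (simp add: r_def power_divide)
  have int_sq: "integrable M (\<lambda>x. (w x)\<^sup>2)" if "w \<in> W" for w
    using bound[OF that] meas[OF that] \<open>0 < b\<close>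
    by (intro integrable_bounded[where b="b\<^sup>2"]) (auto simp: abs_le_square_iff[symmetric])
  have int_cosh: "integrable M (\<lambda>x. cosh (r * w x))" if "w \<in> W" for w
  proof (rule integrable_bounded[where b="2"])
    show "\<bar>cosh (r * w x)\<bar> \<le> 2" if "x \<in> space M" for x
      using cosh_le_one_plus_square[OF small[OF \<open>w \<in> W\<close> that]] small[OF \<open>w \<in> W\<close> that]
        abs_square_le_1[of "r * w x"] by (auto intro: order_trans simp: cosh_real_nonneg)
    show "(\<lambda>x. cosh (r * w x)) \<in> borel_measurable M"
      unfolding cosh_field_def using meas[OF \<open>w \<in> W\<close>] by measurable
  qed
  have mgf: "(\<integral>x. (\<Prod>i\<in>I. cosh (r * w (x i))) \<partial>iid I M) \<le> exp m" if w: "w \<in> W" for w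
  proof -
    have "(\<integral>x. cosh (r * w x) \<partial>M) \<le> (\<integral>x. 1 + (w x)\<^sup>2 / b\<^sup>2 \<partial>M)"
      using int_cosh[OF w] int_sq[OF w] coshb[OF w] by (intro integral_mono) auto
    also have "\<dots> = 1 + (\<integral>x. (w x)\<^sup>2 \<partial>M) / b\<^sup>2"
      using int_sq[OF w] by (simp add: prob_space)
    also have "\<dots> \<le> 1 + v / b\<^sup>2"
      using var[OF w] by (intro add_left_mono divide_right_mono) auto
    also have "\<dots> \<le> exp (v / b\<^sup>2)" by simp
    finally have one: "(\<integral>x. cosh (r * w x) \<partial>M) \<le> exp (v / b\<^sup>2)" .
    have "(\<integral>x. (\<Prod>i\<in>I. cosh (r * w (x i))) \<partial>iid I M) = (\<Prod>i\<in>I. \<integral>x. cosh (r * w x) \<partial>M)"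
      using \<open>finite I\<close> int_cosh[OF w] by (intro prod.product_integral_prod) auto
    also have "\<dots> \<le> (\<Prod>i\<in>I. exp (v / b\<^sup>2))"
      using one by (intro prod_mono) (auto intro!: integral_nonneg cosh_real_nonneg)
    also have "\<dots> = exp m" by (simp add: m_def exp_of_nat_mult[symmetric])
    finally show ?thesis .
  qed
  have int_prod: "integrable (iid I M) (\<lambda>x. \<Prod>i\<in>I. cosh (r * w (x i)))" if "w \<in> W" for w
    using \<open>finite I\<close> int_cosh[OF that] by (intro prod.product_integrable_prod) auto
  have meas_l: "integrable (iid I M) (\<lambda>x. MAX w\<in>W. \<bar>\<Sum>i\<in>I. s i * w (x i)\<bar>)" 
    if s: "\<And>i. \<bar>s i\<bar> = 1" for s :: "'b \<Rightarrow> real"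
  proof (rule prob_space.integrable_bounded[OF prob_space_power, where b="real (card I) * b"])
    show "(\<lambda>x. MAX w\<in>W. \<bar>\<Sum>i\<in>I. s i * w (x i)\<bar>) \<in> borel_measurable (iid I M)"
      using W meas by (intro measurable_sum_Max_abs) auto
    fix x assume x: "x \<in> space (iid I M)"
    have "\<bar>\<Sum>i\<in>I. s i * w (x i)\<bar> \<le> real (card I) * b" if w: "w \<in> W" for w
    proof -
      have "\<bar>\<Sum>i\<in>I. s i * w (x i)\<bar> \<le> (\<Sum>i\<in>I. \<bar>s i * w (x i)\<bar>)" by (rule sum_abs)
      also have "\<dots> \<le> (\<Sum>i\<in>I. b)"
        using x w s bound by (intro sum_mono) (auto simp: space_PiM abs_mult)
      finally show ?thesis by simp
    qed
    moreover have "0 \<le> (MAX w\<in>W. \<bar>\<Sum>i\<in>I. s i * w (x i)\<bar>)"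
      using W by (auto simp: Max_ge_iff ex_in_conv)
    ultimately show "\<bar>MAX w\<in>W. \<bar>\<Sum>i\<in>I. s i * w (x i)\<bar>\<bar> \<le> real (card I) * b"
      using W by simp
  qed
  show int: "integrable (iid I M) (\<lambda>x. rad_sup I W x)"
    by (rule rad_mean_integral) (rule meas_l, simp)
  have "(\<integral>x. rad_sup I W x \<partial>iid I M)
      \<le> (\<integral>x. (ln c - 1 + 2 * (\<Sum>w\<in>W. \<Prod>i\<in>I. cosh (r * w (x i))) / c) / r \<partial>iid I M)"
  proof (rule integral_mono[OF int])
    show "integrable (iid I M) (\<lambda>x. (ln c - 1 + 2 * (\<Sum>w\<in>W. \<Prod>i\<in>I. cosh (r * w (x i))) / c) / r)"
      using int_prod by auto
    show "rad_sup I W x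
      \<le> (ln c - 1 + 2 * (\<Sum>w\<in>W. \<Prod>i\<in>I. cosh (r * w (x i))) / c) / r" for x
      by (rule rad_mean_Max_abs_le_cosh) (use assms c r in auto)
  qed
  also have "\<dots> = (ln c - 1 + 2 * (\<Sum>w\<in>W. \<integral>x. (\<Prod>i\<in>I. cosh (r * w (x i))) \<partial>iid I M) / c) / r"
    using int_prod by (simp add: PI.prob_space)
  also have "\<dots> \<le> (ln c - 1 + 2 * (real (card W) * exp m) / c) / r"
    using c r sum_mono[OF mgf, of W "\<lambda>w. w"]
    by (intro divide_right_mono add_left_mono mult_left_mono) auto
  also have "2 * (real (card W) * exp m) = c" by (simp add: c_def)
  also have "(ln c - 1 + c / c) / r = ln c / r" using c(1) by simp
  also have "\<dots> \<le> (L + 1 + m) / r" using c r by (intro divide_right_mono) auto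
  also have "\<dots> = b * (L + 1) + real (card I) * v / b"
    using \<open>0 < b\<close> by (simp add: r_def m_def field_simps power2_eq_square)
  finally show "(\<integral>x. rad_sup I W x \<partial>iid I M)
      \<le> b * (L + 1) + real (card I) * v / b" .
qed

text \<open>The companion for sums of nonnegative functions, where first moments suffice.\<close>

lemma integral_Max_sum_le:
  assumes "finite I" and W: "finite W" "W \<noteq> {}" "real (card W) \<le> exp L" and "0 < b"
    and meas: "\<And>w. w \<in> W \<Longrightarrow> w \<in> borel_measurable M"
    and bound: "\<And>w x. w \<in> W \<Longrightarrow> x \<in> space M \<Longrightarrow> 0 \<le> w x \<and> w x \<le> b"
    and mean: "\<And>w. w \<in> W \<Longrightarrow> (\<integral>x. w x \<partial>M) \<le> v"
  shows "integrable (iid I M) (\<lambda>x. MAX w\<in>W. \<Sum>i\<in>I. w (x i))"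
    and "(\<integral>x. (MAX w\<in>W. \<Sum>i\<in>I. w (x i)) \<partial>iid I M) \<le> b * (L + 1) + 2 * real (card I) * v"
proof -
  interpret PI: prob_space "iid I M" by (rule prob_space_power)
  interpret prod: product_prob_space "\<lambda>_. M" by (rule product_prob_space_const)
  define r where "r = 1 / b"
  define m where "m = 2 * real (card I) * v / b"
  define c where "c = 2 * real (card W) * exp m"
  have r: "0 < r" using \<open>0 < b\<close> by (simp add: r_def)
  have c: "0 < c" "ln c \<le> L + 1 + m"
    unfolding c_def by (rule card_log_bound[OF W])+
  have small: "0 \<le> r * w x" "r * w x \<le> 1" if "w \<in> W" "x \<in> space M" for w x
    using bound[OF that] \<open>0 < b\<close> by (simp_all add: r_def)
  have int: "integrable M w" if "w \<in> W" for w
    using bound[OF that] meas[OF that]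
    by (intro integrable_bounded[where b=b]) auto
  have int_exp: "integrable M (\<lambda>x. exp (r * w x))" if "w \<in> W" for w
    using small[OF that] meas[OF that]
    by (intro integrable_bounded[where b="exp 1"]) auto
  have mgf: "(\<integral>x. (\<Prod>i\<in>I. exp (r * w (x i))) \<partial>iid I M) \<le> exp m" if w: "w \<in> W" for w
  proof -
    have "(\<integral>x. exp (r * w x) \<partial>M) \<le> (\<integral>x. 1 + 2 * (r * w x) \<partial>M)"
      using int_exp[OF w] int[OF w] small[OF w] exp_le_one_plus_double by (intro integral_mono) auto
    also have "\<dots> = 1 + 2 * (r * (\<integral>x. w x \<partial>M))"
      using int[OF w] by (simp add: prob_space)
    also have "\<dots> \<le> 1 + 2 * (r * v)"
      using mean[OF w] r by simp
    also have "\<dots> \<le> exp (2 * (r * v))" by (rule exp_ge_add_one_self)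
    finally have one: "(\<integral>x. exp (r * w x) \<partial>M) \<le> exp (2 * (r * v))" .
    have "(\<integral>x. (\<Prod>i\<in>I. exp (r * w (x i))) \<partial>iid I M) = (\<Prod>i\<in>I. \<integral>x. exp (r * w x) \<partial>M)"
      using \<open>finite I\<close> int_exp[OF w] by (intro prod.product_integral_prod) auto
    also have "\<dots> \<le> (\<Prod>i\<in>I. exp (2 * (r * v)))"
      using one by (intro prod_mono) (auto intro!: integral_nonneg)
    also have "\<dots> = exp m" by (simp add: m_def r_def exp_of_nat_mult[symmetric] algebra_simps)
    finally show ?thesis .
  qed
  have int_prod: "integrable (iid I M) (\<lambda>x. \<Prod>i\<in>I. exp (r * w (x i)))" if "w \<in> W" for w
    using \<open>finite I\<close> int_exp[OF that] by (intro prod.product_integrable_prod) auto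
  show int_Max: "integrable (iid I M) (\<lambda>x. MAX w\<in>W. \<Sum>i\<in>I. w (x i))"
  proof (rule prob_space.integrable_bounded[OF prob_space_power, where b="real (card I) * b"])
    show "(\<lambda>x. MAX w\<in>W. \<Sum>i\<in>I. w (x i)) \<in> borel_measurable (iid I M)"
    proof (intro borel_measurable_Max borel_measurable_sum)
      show "(\<lambda>x. w (x i)) \<in> borel_measurable (iid I M)" if "w \<in> W" "i \<in> I" for w i
        by (rule measurable_compose[OF measurable_component_singleton[OF that(2)] meas[OF that(1)]])
    qed (use W in auto)
    fix x assume x: "x \<in> space (iid I M)"
    have *: "0 \<le> (\<Sum>i\<in>I. w (x i))" "(\<Sum>i\<in>I. w (x i)) \<le> real (card I) * b" if w: "w \<in> W" for w
      using x w bound by (auto intro!: sum_nonneg sum_bounded_above simp: space_PiM)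
    moreover have "0 \<le> (MAX w\<in>W. \<Sum>i\<in>I. w (x i))"
      using W *(1) by (auto simp: Max_ge_iff ex_in_conv)
    ultimately show "\<bar>MAX w\<in>W. \<Sum>i\<in>I. w (x i)\<bar> \<le> real (card I) * b"
      using W by simp
  qed
  have "(\<integral>x. (MAX w\<in>W. \<Sum>i\<in>I. w (x i)) \<partial>iid I M)
      \<le> (\<integral>x. (ln c - 1 + (\<Sum>w\<in>W. \<Prod>i\<in>I. exp (r * w (x i))) / c) / r \<partial>iid I M)"
  proof (rule integral_mono[OF int_Max])
    show "integrable (iid I M) (\<lambda>x. (ln c - 1 + (\<Sum>w\<in>W. \<Prod>i\<in>I. exp (r * w (x i))) / c) / r)"
      using int_prod by auto
    show "(MAX w\<in>W. \<Sum>i\<in>I. w (x i))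
      \<le> (ln c - 1 + (\<Sum>w\<in>W. \<Prod>i\<in>I. exp (r * w (x i))) / c) / r" for x
      using Max_le_exp_sum[OF W(1,2) r c(1), of "\<lambda>w. \<Sum>i\<in>I. w (x i)"] \<open>finite I\<close>
      by (simp add: exp_sum[symmetric] sum_distrib_left)
  qed
  also have "\<dots> = (ln c - 1 + (\<Sum>w\<in>W. \<integral>x. (\<Prod>i\<in>I. exp (r * w (x i))) \<partial>iid I M) / c) / r"
    using int_prod by (simp add: PI.prob_space)
  also have "\<dots> \<le> (ln c - 1 + (real (card W) * exp m) / c) / r"
    using c r sum_mono[OF mgf, of W "\<lambda>w. w"]
    by (intro divide_right_mono add_left_mono) auto
  also have "\<dots> \<le> ln c / r" using c(1) r by (intro divide_right_mono) (simp_all add: c_def)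
  also have "\<dots> \<le> (L + 1 + m) / r" using c r by (intro divide_right_mono) auto
  also have "\<dots> = b * (L + 1) + 2 * real (card I) * v"
    using \<open>0 < b\<close> by (simp add: r_def m_def field_simps)
  finally show "(\<integral>x. (MAX w\<in>W. \<Sum>i\<in>I. w (x i)) \<partial>iid I M) \<le> b * (L + 1) + 2 * real (card I) * v" .
qed

end

section \<open>Symmetrization\<close>

lemma MAX_mono:
  fixes f :: "'t \<Rightarrow> 'b::linorder"
  assumes "finite T" "T \<noteq> {}" "\<And>t. t \<in> T \<Longrightarrow> f t \<le> g t"
  shows "(MAX t\<in>T. f t) \<le> (MAX t\<in>T. g t)"
proof -
  obtain t where "t \<in> T" "(MAX t\<in>T. f t) = f t"
    using MAX_attained[OF assms(1,2)] .
  then show ?thesis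
    using assms by (auto intro: order_trans[OF assms(3)] Max_ge)
qed

lemma MAX_ge:
  fixes f :: "'t \<Rightarrow> 'b::linorder"
  assumes "finite T" "t \<in> T" shows "f t \<le> (MAX t\<in>T. f t)"
  using assms by (intro Max_ge) auto

lemma MAX_le:
  fixes f :: "'t \<Rightarrow> 'b::linorder"
  assumes "finite T" "T \<noteq> {}" "\<And>t. t \<in> T \<Longrightarrow> f t \<le> c"
  shows "(MAX t\<in>T. f t) \<le> c"
  using assms by simp

lemma MAX_abs_nonneg:
  fixes f :: "'t \<Rightarrow> real"
  assumes "finite T" "T \<noteq> {}" shows "0 \<le> (MAX t\<in>T. \<bar>f t\<bar>)"
  using assms by (auto simp: Max_ge_iff ex_in_conv)

lemma MAX_abs_add:
  fixes f g :: "'t \<Rightarrow> real"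
  assumes "finite T" "T \<noteq> {}"
  shows "(MAX t\<in>T. \<bar>f t + g t\<bar>) \<le> (MAX t\<in>T. \<bar>f t\<bar>) + (MAX t\<in>T. \<bar>g t\<bar>)"
proof (rule MAX_le[OF assms])
  fix t assume "t \<in> T"
  then show "\<bar>f t + g t\<bar> \<le> (MAX t\<in>T. \<bar>f t\<bar>) + (MAX t\<in>T. \<bar>g t\<bar>)"
    using MAX_ge[OF assms(1), of t "\<lambda>t. \<bar>f t\<bar>"] MAX_ge[OF assms(1), of t "\<lambda>t. \<bar>g t\<bar>"] by linarith
qed

lemma MAX_cmult:
  fixes f :: "'t \<Rightarrow> real"
  assumes "finite T" "T \<noteq> {}" "0 \<le> c"
  shows "(MAX t\<in>T. c * f t) = c * (MAX t\<in>T. f t)"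
proof -
  have "mono (\<lambda>y. c * y)" using assms(3) by (auto intro!: monoI mult_left_mono)
  from mono_Max_commute[OF this, of "f ` T"] assms show ?thesis
    by (simp add: image_image)
qed

context prob_space
begin

lemma component_integral:
  fixes f :: "'a \<Rightarrow> real"
  assumes "integrable M f" "i \<in> I"
  shows "integrable (iid I M) (\<lambda>x. f (x i))"
    and "(\<integral>x. f (x i) \<partial>iid I M) = (\<integral>x. f x \<partial>M)"
proof -
  have d: "distr (iid I M) M (\<lambda>x. x i) = M"
    using distr_PiM_component[of I "\<lambda>_. M" i] prob_space_axioms assms(2) by auto
  have m: "(\<lambda>x. x i) \<in> measurable (iid I M) M"
    using assms(2) by simp
  show "integrable (iid I M) (\<lambda>x. f (x i))"
    using assms(1) by (subst (asm) d[symmetric]) (auto intro: integrable_distr[OF m])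
  show "(\<integral>x. f (x i) \<partial>iid I M) = (\<integral>x. f x \<partial>M)"
    using assms(1) by (subst (2) d[symmetric]) (simp add: integral_distr[OF m] borel_measurable_integrable)
qed

text \<open>An independent centred term, added or subtracted, can only increase the expected maximum, by
  Jensen's inequality in its coordinates.\<close>

lemma nn_integral_Max_abs_add_centered:
  fixes v :: "'i \<Rightarrow> 'g \<Rightarrow> 'a \<Rightarrow> real"
  assumes AB: "finite A" "finite B" "A \<inter> B = {}" and G: "finite G" "G \<noteq> {}"
    and int: "\<And>i h. i \<in> A \<union> B \<Longrightarrow> h \<in> G \<Longrightarrow> integrable M (v i h)"
    and zero: "\<And>i h. i \<in> A \<union> B \<Longrightarrow> h \<in> G \<Longrightarrow> (\<integral>x. v i h x \<partial>M) = 0"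
  shows "(\<integral>\<^sup>+z. ennreal (MAX h\<in>G. \<bar>\<Sum>i\<in>A. v i h (z i)\<bar>) \<partial>PiM (A \<union> B) (\<lambda>_. M)) \<le>
    (\<integral>\<^sup>+z. ennreal (MAX h\<in>G. \<bar>(\<Sum>i\<in>A. v i h (z i)) - (\<Sum>i\<in>B. v i h (z i))\<bar>) \<partial>PiM (A \<union> B) (\<lambda>_. M))"
proof -
  interpret PB: prob_space "PiM B (\<lambda>_. M)" by (rule prob_space_power)
  interpret prod: product_prob_space "\<lambda>_. M" by (rule product_prob_space_const)
  have m1: "(\<lambda>x. v i h (x i)) \<in> borel_measurable (PiM (A \<union> B) (\<lambda>_. M))" if "i \<in> A \<union> B" "h \<in> G" for i h
    using int[OF that] by (intro measurable_compose[OF measurable_component_singleton[OF that(1)]]) auto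
  have sums [measurable]: "(\<lambda>z. \<Sum>i\<in>A. v i h (z i)) \<in> borel_measurable (PiM (A \<union> B) (\<lambda>_. M))"
    "(\<lambda>z. \<Sum>i\<in>B. v i h (z i)) \<in> borel_measurable (PiM (A \<union> B) (\<lambda>_. M))" if "h \<in> G" for h
    using m1 that by (auto intro!: borel_measurable_sum)
  have mf: "(\<lambda>z. ennreal (MAX h\<in>G. \<bar>\<Sum>i\<in>A. v i h (z i)\<bar>)) \<in> borel_measurable (PiM (A \<union> B) (\<lambda>_. M))"
    by (intro measurable_compose[OF _ measurable_ennreal] borel_measurable_Max[OF G(1)]) measurable
  have mg: "(\<lambda>z. ennreal (MAX h\<in>G. \<bar>(\<Sum>i\<in>A. v i h (z i)) - (\<Sum>i\<in>B. v i h (z i))\<bar>))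
      \<in> borel_measurable (PiM (A \<union> B) (\<lambda>_. M))"
    by (intro measurable_compose[OF _ measurable_ennreal] borel_measurable_Max[OF G(1)]) measurable
  have sA: "(\<Sum>i\<in>A. v i h (merge A B (x, y) i)) = (\<Sum>i\<in>A. v i h (x i))" for h x y
    by (intro sum.cong) (auto simp: merge_def)
  have sB: "(\<Sum>i\<in>B. v i h (merge A B (x, y) i)) = (\<Sum>i\<in>B. v i h (y i))" for h x y
    using AB(3) by (intro sum.cong) (auto simp: merge_def)
  have key: "ennreal (MAX h\<in>G. \<bar>u h\<bar>) \<le>
      (\<integral>\<^sup>+y. ennreal (MAX h\<in>G. \<bar>u h - (\<Sum>i\<in>B. v i h (y i))\<bar>) \<partial>PiM B (\<lambda>_. M))" for u
  proof -
    obtain h where h: "h \<in> G" "(MAX h\<in>G. \<bar>u h\<bar>) = \<bar>u h\<bar>"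
      using MAX_attained[OF G] .
    have intB: "integrable (PiM B (\<lambda>_. M)) (\<lambda>y. \<Sum>i\<in>B. v i h (y i))"
      using int h by (auto intro!: component_integral)
    have "(\<integral>y. (\<Sum>i\<in>B. v i h (y i)) \<partial>PiM B (\<lambda>_. M)) = (\<Sum>i\<in>B. \<integral>x. v i h x \<partial>M)"
      using int h by (subst Bochner_Integration.integral_sum) (auto intro!: component_integral sum.cong)
    also have "\<dots> = 0" using zero h by simp
    finally have "u h = (\<integral>y. u h - (\<Sum>i\<in>B. v i h (y i)) \<partial>PiM B (\<lambda>_. M))"
      using intB by (simp add: PB.prob_space)
    then have "ennreal \<bar>u h\<bar> = ennreal \<bar>\<integral>y. u h - (\<Sum>i\<in>B. v i h (y i)) \<partial>PiM B (\<lambda>_. M)\<bar>"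
      by simp
    also have "\<dots> \<le> (\<integral>\<^sup>+y. ennreal \<bar>u h - (\<Sum>i\<in>B. v i h (y i))\<bar> \<partial>PiM B (\<lambda>_. M))"
      using integral_norm_bound_ennreal[of "PiM B (\<lambda>_. M)" "\<lambda>y. u h - (\<Sum>i\<in>B. v i h (y i))"] intB
      by simp
    also have "\<dots> \<le> (\<integral>\<^sup>+y. ennreal (MAX h\<in>G. \<bar>u h - (\<Sum>i\<in>B. v i h (y i))\<bar>) \<partial>PiM B (\<lambda>_. M))"
      using h(1) G by (intro nn_integral_mono ennreal_leI MAX_ge[of G h]) auto
    finally show ?thesis using h(2) by simp
  qed
  show ?thesis
    unfolding prod.product_nn_integral_fold[OF AB(3,1,2) mf] prod.product_nn_integral_fold[OF AB(3,1,2) mg]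
      sA sB
  proof (rule nn_integral_mono)
    fix x
    show "(\<integral>\<^sup>+y. ennreal (MAX h\<in>G. \<bar>\<Sum>i\<in>A. v i h (x i)\<bar>) \<partial>PiM B (\<lambda>_. M)) \<le>
      (\<integral>\<^sup>+y. ennreal (MAX h\<in>G. \<bar>(\<Sum>i\<in>A. v i h (x i)) - (\<Sum>i\<in>B. v i h (y i))\<bar>) \<partial>PiM B (\<lambda>_. M))"
      using key[of "\<lambda>h. \<Sum>i\<in>A. v i h (x i)"] by (simp add: PB.emeasure_space_1)
  qed
qed

text \<open>Symmetrization without a ghost sample: for each fixed choice of signs, the plain sum is the
  sum over the positive signs plus the sum over the negative ones, and each of these is dominated
  by the signed sum because the other part is centred and independent.\<close>

lemma nn_integral_symmetrize:
  fixes v :: "'i \<Rightarrow> 'g \<Rightarrow> 'a \<Rightarrow> real"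
  assumes I: "finite I" and G: "finite G" "G \<noteq> {}"
    and int: "\<And>i h. i \<in> I \<Longrightarrow> h \<in> G \<Longrightarrow> integrable M (v i h)"
    and zero: "\<And>i h. i \<in> I \<Longrightarrow> h \<in> G \<Longrightarrow> (\<integral>x. v i h x \<partial>M) = 0"
    and A: "A \<subseteq> I"
  shows "(\<integral>\<^sup>+z. ennreal (MAX h\<in>G. \<bar>\<Sum>i\<in>I. v i h (z i)\<bar>) \<partial>iid I M) \<le>
    2 * (\<integral>\<^sup>+z. ennreal (MAX h\<in>G. \<bar>\<Sum>i\<in>I. signs A i * v i h (z i)\<bar>) \<partial>iid I M)"
    (is "?L \<le> 2 * ?R")
proof -
  define B where "B = I - A"
  have AB: "finite A" "finite B" "A \<inter> B = {}" "A \<union> B = I"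
    using I A by (auto simp: B_def intro: finite_subset)
  have BA: "B \<inter> A = {}" "B \<union> A = I" using AB by auto
  have split: "(\<Sum>i\<in>I. f i) = (\<Sum>i\<in>A. f i) + (\<Sum>i\<in>B. f i)" for f :: "'i \<Rightarrow> real"
    unfolding AB(4)[symmetric] using AB by (intro sum.union_disjoint) auto
  have "(\<Sum>i\<in>A. signs A i * f i) = (\<Sum>i\<in>A. f i)" "(\<Sum>i\<in>B. signs A i * f i) = - (\<Sum>i\<in>B. f i)" for f
    unfolding sum_negf[symmetric] by (intro sum.cong; auto simp: signs_def B_def)+
  then have signed: "(\<Sum>i\<in>I. signs A i * f i) = (\<Sum>i\<in>A. f i) - (\<Sum>i\<in>B. f i)" for f
    unfolding split by simp
  have m1: "(\<lambda>x. v i h (x i)) \<in> borel_measurable (iid I M)" if "i \<in> I" "h \<in> G" for i h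
    using int[OF that] by (intro measurable_compose[OF measurable_component_singleton[OF that(1)]]) auto
  have mJ: "(\<lambda>z. ennreal (MAX h\<in>G. \<bar>\<Sum>i\<in>J. v i h (z i)\<bar>)) \<in> borel_measurable (iid I M)"
    if "J \<subseteq> I" for J
  proof -
    have [measurable]: "(\<lambda>z. \<Sum>i\<in>J. v i h (z i)) \<in> borel_measurable (iid I M)" if "h \<in> G" for h
      using m1 that \<open>J \<subseteq> I\<close> by (intro borel_measurable_sum) auto
    show ?thesis
      by (intro measurable_compose[OF _ measurable_ennreal] borel_measurable_Max[OF G(1)]) measurable
  qed
  have "?L \<le> (\<integral>\<^sup>+z. ennreal (MAX h\<in>G. \<bar>\<Sum>i\<in>A. v i h (z i)\<bar>)
                   + ennreal (MAX h\<in>G. \<bar>\<Sum>i\<in>B. v i h (z i)\<bar>) \<partial>iid I M)"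
    unfolding split ennreal_plus[symmetric, OF MAX_abs_nonneg[OF G] MAX_abs_nonneg[OF G]]
    by (intro nn_integral_mono ennreal_leI MAX_abs_add[OF G])
  also have "\<dots> = (\<integral>\<^sup>+z. ennreal (MAX h\<in>G. \<bar>\<Sum>i\<in>A. v i h (z i)\<bar>) \<partial>iid I M)
       + (\<integral>\<^sup>+z. ennreal (MAX h\<in>G. \<bar>\<Sum>i\<in>B. v i h (z i)\<bar>) \<partial>iid I M)"
    using AB by (intro nn_integral_add mJ) auto
  also have "\<dots> \<le> ?R + ?R"
  proof (rule add_mono)
    show "(\<integral>\<^sup>+z. ennreal (MAX h\<in>G. \<bar>\<Sum>i\<in>A. v i h (z i)\<bar>) \<partial>iid I M) \<le> ?R"
      unfolding signed using nn_integral_Max_abs_add_centered[OF AB(1-3) G, of v] int zero AB(4) by simp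
    show "(\<integral>\<^sup>+z. ennreal (MAX h\<in>G. \<bar>\<Sum>i\<in>B. v i h (z i)\<bar>) \<partial>iid I M) \<le> ?R"
      unfolding signed using nn_integral_Max_abs_add_centered[OF AB(2,1) BA(1) G, of v] int zero BA(2)
      by (simp add: abs_minus_commute)
  qed
  finally show ?thesis by (simp add: mult_2)
qed

end

section \<open>Rademacher complexity\<close>

definition rad_complexity :: "'x measure \<Rightarrow> 'i set \<Rightarrow> ('x \<Rightarrow> real) set \<Rightarrow> real" where
  "rad_complexity P I G =
     (\<integral>x. rad_sup I G x \<partial>PiM I (\<lambda>_. P))"

lemma rad_mean_abs_sum_signs:
  assumes "finite I" shows "rad_mean I (\<lambda>s. \<bar>\<Sum>i\<in>I. s i\<bar>) \<le> 2 * sqrt (real (card I))"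
proof (cases "I = {}")
  case False
  then have c: "0 < sqrt (real (card I))" using assms by (simp add: card_gt_0_iff)
  show ?thesis
    using rad_mean_Max_abs_le[of I "{()}" 0 "1 / sqrt (real (card I))" "\<lambda>_ _. 1" "real (card I)"] assms c
    by (simp add: real_div_sqrt)
qed simp

text \<open>The square is 2-Lipschitz on the unit interval. The factor 2 doubles once more because the
  contraction principle is one-sided; the zero vector makes both one-sided maxima nonnegative.\<close>

lemma rad_mean_squares_le:
  fixes w :: "'t \<Rightarrow> 'i \<Rightarrow> real"
  assumes "finite I" and T: "finite T" "t0 \<in> T" "\<And>i. w t0 i = 0"
    and unit: "\<And>t i. t \<in> T \<Longrightarrow> i \<in> I \<Longrightarrow> \<bar>w t i\<bar> \<le> 1"
  shows "rad_mean I (\<lambda>s. MAX t\<in>T. \<bar>\<Sum>i\<in>I. s i * (w t i)\<^sup>2\<bar>)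
       \<le> 4 * rad_mean I (\<lambda>s. MAX t\<in>T. \<bar>\<Sum>i\<in>I. s i * w t i\<bar>)"
proof -
  have ne: "T \<noteq> {}" using T by auto
  have lip: "\<bar>(w t i)\<^sup>2 - (w t' i)\<^sup>2\<bar> \<le> \<bar>2 * w t i - 2 * w t' i\<bar>" if "t \<in> T" "t' \<in> T" "i \<in> I" for t t' i
  proof -
    have "\<bar>(w t i)\<^sup>2 - (w t' i)\<^sup>2\<bar> = \<bar>w t i + w t' i\<bar> * \<bar>w t i - w t' i\<bar>"
      by (simp add: abs_mult[symmetric] power2_eq_square algebra_simps)
    also have "\<dots> \<le> 2 * \<bar>w t i - w t' i\<bar>"
      using unit[of t i] unit[of t' i] that by (intro mult_right_mono) auto
    also have "\<dots> = \<bar>2 * w t i - 2 * w t' i\<bar>"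
      by (simp only: right_diff_distrib[symmetric] abs_mult abs_numeral)
    finally show ?thesis .
  qed
  have one_sided: "rad_mean I (\<lambda>s. MAX t\<in>T. 0 + (\<Sum>i\<in>I. s i * b t i))
       \<le> 2 * rad_mean I (\<lambda>s. MAX t\<in>T. \<bar>\<Sum>i\<in>I. s i * w t i\<bar>)"
    if "\<And>t t' i. t \<in> T \<Longrightarrow> t' \<in> T \<Longrightarrow> i \<in> I \<Longrightarrow> \<bar>b t i - b t' i\<bar> \<le> \<bar>2 * w t i - 2 * w t' i\<bar>" for b
  proof -
    have "rad_mean I (\<lambda>s. MAX t\<in>T. 0 + (\<Sum>i\<in>I. s i * b t i))
       \<le> rad_mean I (\<lambda>s. MAX t\<in>T. 0 + (\<Sum>i\<in>I. s i * (2 * w t i)))"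
      by (rule rad_mean_contraction[OF assms(1) T(1) ne]) (use that in auto)
    also have "\<dots> \<le> rad_mean I (\<lambda>s. 2 * (MAX t\<in>T. \<bar>\<Sum>i\<in>I. s i * w t i\<bar>))"
    proof (rule rad_mean_mono)
      fix A
      have "0 + (\<Sum>i\<in>I. signs A i * (2 * w t i)) \<le> 2 * \<bar>\<Sum>i\<in>I. signs A i * w t i\<bar>" for t
        by (simp add: sum_distrib_left[symmetric] mult.left_commute)
      then show "(MAX t\<in>T. 0 + (\<Sum>i\<in>I. signs A i * (2 * w t i)))
          \<le> 2 * (MAX t\<in>T. \<bar>\<Sum>i\<in>I. signs A i * w t i\<bar>)"
        unfolding MAX_cmult[OF T(1) ne, of 2, simplified, symmetric]
        by (intro MAX_mono T ne)
    qed
    finally show ?thesis by (simp add: rad_mean_cmult)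
  qed
  have "rad_mean I (\<lambda>s. MAX t\<in>T. \<bar>\<Sum>i\<in>I. s i * (w t i)\<^sup>2\<bar>) \<le>
      rad_mean I (\<lambda>s. (MAX t\<in>T. 0 + (\<Sum>i\<in>I. s i * (w t i)\<^sup>2)) + (MAX t\<in>T. 0 + (\<Sum>i\<in>I. s i * - (w t i)\<^sup>2)))"
  proof (intro rad_mean_mono MAX_le[OF T(1) ne])
    fix A t assume t: "t \<in> T"
    let ?y = "\<lambda>t. 0 + (\<Sum>i\<in>I. signs A i * (w t i)\<^sup>2)" and ?z = "\<lambda>t. 0 + (\<Sum>i\<in>I. signs A i * - (w t i)\<^sup>2)"
    have "?y t \<le> (MAX t\<in>T. ?y t)" "?z t \<le> (MAX t\<in>T. ?z t)" "?y t0 \<le> (MAX t\<in>T. ?y t)" "?z t0 \<le> (MAX t\<in>T. ?z t)"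
      using T t by (intro MAX_ge; simp)+
    moreover have "?z t = - ?y t" "?y t0 = 0" "?z t0 = 0"
      using T(3) by (simp_all add: sum_negf)
    ultimately show "\<bar>\<Sum>i\<in>I. signs A i * (w t i)\<^sup>2\<bar> \<le> (MAX t\<in>T. ?y t) + (MAX t\<in>T. ?z t)"
      by linarith
  qed
  also have "\<dots> \<le> 2 * rad_mean I (\<lambda>s. MAX t\<in>T. \<bar>\<Sum>i\<in>I. s i * w t i\<bar>)
      + 2 * rad_mean I (\<lambda>s. MAX t\<in>T. \<bar>\<Sum>i\<in>I. s i * w t i\<bar>)"
    unfolding rad_mean_add using lip by (intro add_mono one_sided) (auto simp: abs_minus_commute)
  finally show ?thesis by simp
qed

lemma abs_signed_sum_le:
  assumes "\<And>i. i \<in> I \<Longrightarrow> \<bar>w i\<bar> \<le> 1"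
  shows "\<bar>\<Sum>i\<in>I. signs A i * w i\<bar> \<le> real (card I)"
proof -
  have "\<bar>\<Sum>i\<in>I. signs A i * w i\<bar> \<le> (\<Sum>i\<in>I. \<bar>signs A i * w i\<bar>)" by (rule sum_abs)
  also have "\<dots> \<le> (\<Sum>i\<in>I. 1)" using assms by (intro sum_mono) (auto simp: abs_mult)
  finally show ?thesis by simp
qed

lemma Linf_unitD:
  assumes "h \<in> Linf_unit P"
  shows "h \<in> borel_measurable P" "\<And>x. x \<in> space P \<Longrightarrow> \<bar>h x\<bar> \<le> 1"
  using assms by (auto simp: Linf_unit_def)

context prob_space
begin

lemma integrable_Linf_unit:
  assumes "h \<in> Linf_unit M"
  shows "integrable M h" "integrable M (\<lambda>x. (h x)\<^sup>2)"
  using Linf_unitD[OF assms]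
  by (auto intro!: integrable_bounded[where b=1] simp: abs_square_le_1)

lemma integrable_signed_Max:
  assumes "finite G" "G \<noteq> {}" "G \<subseteq> Linf_unit M"
  shows "integrable (iid I M) (\<lambda>x. MAX h\<in>G. \<bar>\<Sum>i\<in>I. signs A i * h (x i)\<bar>)"
proof (rule prob_space.integrable_bounded[OF prob_space_power, where b="real (card I)"])
  show "(\<lambda>x. MAX h\<in>G. \<bar>\<Sum>i\<in>I. signs A i * h (x i)\<bar>) \<in> borel_measurable (iid I M)"
    using assms by (intro measurable_sum_Max_abs) (auto simp: Linf_unit_def)
  fix x assume "x \<in> space (iid I M)"
  then have "\<bar>\<Sum>i\<in>I. signs A i * h (x i)\<bar> \<le> real (card I)" if "h \<in> G" for h
    using assms(3) that by (intro abs_signed_sum_le) (auto simp: space_PiM Linf_unit_def)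
  then have "(MAX h\<in>G. \<bar>\<Sum>i\<in>I. signs A i * h (x i)\<bar>) \<le> real (card I)"
    by (intro MAX_le assms)
  then show "\<bar>MAX h\<in>G. \<bar>\<Sum>i\<in>I. signs A i * h (x i)\<bar>\<bar> \<le> real (card I)"
    using MAX_abs_nonneg[OF assms(1,2)] by simp
qed

lemma rad_complexity_eq:
  assumes "finite G" "G \<noteq> {}" "G \<subseteq> Linf_unit M"
  shows "rad_complexity M I G =
    rad_mean I (\<lambda>s. \<integral>x. (MAX h\<in>G. \<bar>\<Sum>i\<in>I. s i * h (x i)\<bar>) \<partial>iid I M)"
    and "integrable (iid I M) (\<lambda>x. rad_sup I G x)"
  unfolding rad_complexity_def
  by (rule rad_mean_integral(1)[symmetric] rad_mean_integral(2), rule integrable_signed_Max[OF assms])+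

lemma rad_complexity_nonneg:
  assumes "finite G" "G \<noteq> {}"
  shows "0 \<le> rad_complexity M I G"
  unfolding rad_complexity_def
  by (intro Bochner_Integration.integral_nonneg rad_mean_nonneg MAX_abs_nonneg assms)

text \<open>The fluctuation of the empirical second moments around the true ones.\<close>

lemma expected_Max_square_deviation:
  assumes I: "finite I" and G: "finite G" "G \<subseteq> Linf_unit M" "(\<lambda>_. 0) \<in> G"
    and r: "\<And>h. h \<in> G \<Longrightarrow> (\<integral>x. (h x)\<^sup>2 \<partial>M) \<le> r\<^sup>2"
  shows "(\<integral>\<^sup>+x. ennreal (MAX h\<in>G. \<bar>\<Sum>i\<in>I. (h (x i))\<^sup>2 - (\<integral>y. (h y)\<^sup>2 \<partial>M)\<bar>) \<partial>iid I M)
     \<le> ennreal (8 * rad_complexity M I G + 4 * r\<^sup>2 * sqrt (real (card I)))"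
proof -
  have ne: "G \<noteq> {}" using G(3) by auto
  interpret PI: prob_space "iid I M" by (rule prob_space_power)
  let ?c = "\<lambda>h. \<integral>y. (h y)\<^sup>2 \<partial>M"
  let ?L = "\<integral>\<^sup>+x. ennreal (MAX h\<in>G. \<bar>\<Sum>i\<in>I. (h (x i))\<^sup>2 - ?c h\<bar>) \<partial>iid I M"
  let ?R = "\<lambda>s x. MAX h\<in>G. \<bar>\<Sum>i\<in>I. s i * ((h (x i))\<^sup>2 - ?c h)\<bar>"
  have int: "integrable M (\<lambda>x. (h x)\<^sup>2 - ?c h)" if "h \<in> G" for h
    using integrable_Linf_unit[of h] that G by auto
  have zero: "(\<integral>x. (h x)\<^sup>2 - ?c h \<partial>M) = 0" if "h \<in> G" for h
    using integrable_Linf_unit[of h] that G by (auto simp: prob_space)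
  have c01: "0 \<le> ?c h" "?c h \<le> 1" if "h \<in> G" for h
  proof -
    show "0 \<le> ?c h" by simp
    show "?c h \<le> 1"
      using that G Linf_unitD[of h M]
      by (intro expectation_le_const[where b=1]) (auto simp: abs_square_le_1)
  qed
  have intR: "integrable (iid I M) (?R (signs A))" for A
  proof (rule PI.integrable_bounded[where b="real (card I)"])
    show "?R (signs A) \<in> borel_measurable (iid I M)"
      using measurable_sum_Max_abs[OF G(1), of "\<lambda>h x. (h x)\<^sup>2 - ?c h" "signs A" I] int by auto
    fix x assume x: "x \<in> space (iid I M)"
    have "\<bar>\<Sum>i\<in>I. signs A i * ((h (x i))\<^sup>2 - ?c h)\<bar> \<le> real (card I)" if h: "h \<in> G" for h
    proof (rule abs_signed_sum_le)
      fix i assume "i \<in> I"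
      then have "(h (x i))\<^sup>2 \<le> 1"
        using x h G Linf_unitD(2)[of h M "x i"] by (auto simp: space_PiM abs_square_le_1)
      then show "\<bar>(h (x i))\<^sup>2 - ?c h\<bar> \<le> 1"
        using c01[OF h] zero_le_power2[of "h (x i)"] by linarith
    qed
    then have "?R (signs A) x \<le> real (card I)"
      by (intro MAX_le G ne)
    then show "\<bar>?R (signs A) x\<bar> \<le> real (card I)"
      using MAX_abs_nonneg[OF G(1) ne] by simp
  qed
  have Rnn: "0 \<le> ?R s x" for s x by (rule MAX_abs_nonneg[OF G(1) ne])
  have sym: "?L \<le> ennreal (2 * (\<integral>x. ?R (signs A) x \<partial>iid I M))" if "A \<subseteq> I" for A
  proof -
    have "?L \<le> 2 * (\<integral>\<^sup>+x. ennreal (?R (signs A) x) \<partial>iid I M)"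
      using that by (intro nn_integral_symmetrize[OF I G(1) ne] int zero)
    also have "(\<integral>\<^sup>+x. ennreal (?R (signs A) x) \<partial>iid I M)
        = ennreal (\<integral>x. ?R (signs A) x \<partial>iid I M)"
      using intR Rnn by (intro nn_integral_eq_integral) auto
    finally show ?thesis
      using Rnn by (simp add: ennreal_mult' ennreal_numeral[symmetric] del: ennreal_numeral)
  qed
  have fin: "?L < \<infinity>"
    by (intro le_less_trans[OF sym[OF empty_subsetI]]) simp
  define l where "l = enn2real ?L"
  have l: "?L = ennreal l" "0 \<le> l" using fin by (auto simp: l_def less_top)
  have "l = rad_mean I (\<lambda>_. l)" using I by simp
  also have "\<dots> \<le> rad_mean I (\<lambda>s. 2 * (\<integral>x. ?R s x \<partial>iid I M))"
    using sym Rnn unfolding l(1)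
    by (intro rad_mean_mono) (auto simp: ennreal_le_iff)
  also have "\<dots> = 2 * (\<integral>x. rad_mean I (\<lambda>s. ?R s x) \<partial>iid I M)"
    unfolding rad_mean_cmult using intR by (subst rad_mean_integral) auto
  also have "\<dots> \<le> 2 * (\<integral>x. 4 * rad_sup I G x
      + r\<^sup>2 * (2 * sqrt (real (card I))) \<partial>iid I M)"
  proof (intro mult_left_mono integral_mono)
    show "integrable (iid I M) (\<lambda>x. rad_mean I (\<lambda>s. ?R s x))"
      using intR by (rule rad_mean_integral)
    show "integrable (iid I M) (\<lambda>x. 4 * rad_sup I G x
      + r\<^sup>2 * (2 * sqrt (real (card I))))"
      by (intro Bochner_Integration.integrable_add integrable_mult_right PI.integrable_const
          rad_complexity_eq(2)[OF G(1) ne G(2)])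
    fix x assume x: "x \<in> space (iid I M)"
    have "rad_mean I (\<lambda>s. ?R s x) \<le> rad_mean I (\<lambda>s. (MAX h\<in>G. \<bar>\<Sum>i\<in>I. s i * (h (x i))\<^sup>2\<bar>)
        + r\<^sup>2 * \<bar>\<Sum>i\<in>I. s i\<bar>)"
    proof (intro rad_mean_mono MAX_le[OF G(1) ne])
      fix A h assume h: "h \<in> G"
      have "\<bar>\<Sum>i\<in>I. signs A i * ((h (x i))\<^sup>2 - ?c h)\<bar>
          = \<bar>(\<Sum>i\<in>I. signs A i * (h (x i))\<^sup>2) - ?c h * (\<Sum>i\<in>I. signs A i)\<bar>"
        by (simp add: right_diff_distrib sum_subtractf sum_distrib_right[symmetric] mult.commute)
      also have "\<dots> \<le> \<bar>\<Sum>i\<in>I. signs A i * (h (x i))\<^sup>2\<bar> + \<bar>?c h * (\<Sum>i\<in>I. signs A i)\<bar>"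
        by (rule abs_triangle_ineq4)
      also have "\<bar>?c h * (\<Sum>i\<in>I. signs A i)\<bar> \<le> r\<^sup>2 * \<bar>\<Sum>i\<in>I. signs A i\<bar>"
        using c01(1)[OF h] r[OF h] by (auto simp: abs_mult intro: mult_right_mono)
      finally show "\<bar>\<Sum>i\<in>I. signs A i * ((h (x i))\<^sup>2 - ?c h)\<bar>
         \<le> (MAX h\<in>G. \<bar>\<Sum>i\<in>I. signs A i * (h (x i))\<^sup>2\<bar>) + r\<^sup>2 * \<bar>\<Sum>i\<in>I. signs A i\<bar>"
        using MAX_ge[OF G(1) h, of "\<lambda>h. \<bar>\<Sum>i\<in>I. signs A i * (h (x i))\<^sup>2\<bar>"] by linarith
    qed
    also have "\<dots> \<le> 4 * rad_sup I G x
      + r\<^sup>2 * (2 * sqrt (real (card I)))"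
      unfolding rad_mean_add rad_mean_cmult
    proof (intro add_mono mult_left_mono rad_mean_abs_sum_signs I)
      show "rad_mean I (\<lambda>s. MAX h\<in>G. \<bar>\<Sum>i\<in>I. s i * (h (x i))\<^sup>2\<bar>)
         \<le> 4 * rad_sup I G x"
        using x G(2) by (intro rad_mean_squares_le[OF I G(1,3)]) (auto simp: space_PiM Linf_unit_def)
    qed simp
    finally show "rad_mean I (\<lambda>s. ?R s x) \<le> \<dots>" .
  qed simp
  also have "\<dots> = 8 * rad_complexity M I G + 4 * r\<^sup>2 * sqrt (real (card I))"
    using rad_complexity_eq(2)[OF G(1) ne G(2), of I]
    by (simp add: rad_complexity_def PI.prob_space)
  finally show ?thesis unfolding l(1) by (rule ennreal_leI)
qed

end

section \<open>Chaining under uniform entropy\<close>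

lemma sum_geometric_le:
  fixes q :: real assumes "0 \<le> q" "q < 1"
  shows "(\<Sum>j<J. q ^ j) \<le> 1 / (1 - q)"
proof -
  have "(\<Sum>j<J. q ^ j) = (1 - q ^ J) / (1 - q)"
    using assms by (subst sum_gp_strict) auto
  also have "\<dots> \<le> 1 / (1 - q)" using assms by (intro divide_right_mono) auto
  finally show ?thesis .
qed

lemma powr_half_pow:
  fixes r :: real assumes "0 < r"
  shows "(r / 2 ^ j) powr b = r powr b * (2 powr (- b)) ^ j"
proof -
  have "((2::real) ^ j) powr b = 2 powr (real j * b)"
    by (simp add: powr_powr flip: powr_realpow)
  moreover have "(2 powr (- b)) ^ j = (2::real) powr (- (real j * b))"
    by (simp add: powr_power)
  ultimately show ?thesis
    using assms by (simp add: powr_divide powr_minus_divide)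
qed

lemma half_pow_tendsto:
  fixes e :: real assumes "0 < e" shows "\<exists>J. r / 2 ^ J \<le> e"
proof -
  have "(\<lambda>J. r * (1/2) ^ J) \<longlonglongrightarrow> r * 0"
    by (intro tendsto_mult tendsto_const LIMSEQ_power_zero) auto
  then have "\<forall>\<^sub>F J in sequentially. r * (1/2) ^ J < e"
    using assms by (intro order_tendstoD(2)) auto
  then obtain J where "r * (1/2) ^ J < e"
    by (auto simp: eventually_sequentially)
  then show ?thesis
    by (intro exI[of _ J]) (simp add: power_divide)
qed

lemma abs_signed_sum_le_sqrt:
  assumes "(\<Sum>i\<in>I. (v i)\<^sup>2) \<le> real (card I) * a\<^sup>2" "0 \<le> a"
  shows "\<bar>\<Sum>i\<in>I. signs A i * v i\<bar> \<le> real (card I) * a"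
proof -
  have "(signs A i)\<^sup>2 = 1" for i by (simp add: signs_def)
  then have "(\<Sum>i\<in>I. (signs A i)\<^sup>2) = real (card I)" by simp
  then have "(\<Sum>i\<in>I. signs A i * v i)\<^sup>2 \<le> real (card I) * (\<Sum>i\<in>I. (v i)\<^sup>2)"
    using Cauchy_Schwarz_ineq_sum[of "signs A" v I] by simp
  also have "\<dots> \<le> real (card I) * (real (card I) * a\<^sup>2)"
    using assms by (intro mult_left_mono) auto
  also have "\<dots> = (real (card I) * a)\<^sup>2" by (simp add: power2_eq_square)
  finally show ?thesis
    using assms(2) by (simp add: abs_le_square_iff[symmetric])
qed

lemma sum_power2_add_le:
  fixes f g :: "'i \<Rightarrow> real"
  assumes "(\<Sum>i\<in>I. (f i)\<^sup>2) \<le> c" "(\<Sum>i\<in>I. (g i)\<^sup>2) \<le> d"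
  shows "(\<Sum>i\<in>I. (f i + g i)\<^sup>2) \<le> 2 * c + 2 * d"
proof -
  have "(f i + g i)\<^sup>2 \<le> 2 * (f i)\<^sup>2 + 2 * (g i)\<^sup>2" for i
    using zero_le_power2[of "f i - g i"] by (simp add: power2_eq_square algebra_simps)
  then have "(\<Sum>i\<in>I. (f i + g i)\<^sup>2) \<le> (\<Sum>i\<in>I. 2 * (f i)\<^sup>2 + 2 * (g i)\<^sup>2)"
    by (intro sum_mono) auto
  also have "\<dots> \<le> 2 * c + 2 * d"
    using assms by (simp add: sum.distrib sum_distrib_left[symmetric])
  finally show ?thesis .
qed

text \<open>Dudley's chaining bound for a finite set of vectors whose \<open>\<epsilon>\<close>-entropy in the
  normalised Euclidean distance is at most \<open>C \<epsilon> powr -\<alpha>\<close>. At the scale \<open>a = \<sigma> / 2 ^ j\<close> the links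
  number \<open>exp (2 * C * a powr -\<alpha>)\<close> and have length of order \<open>a\<close>, so they contribute
  \<open>sqrt k * a powr (1 - \<alpha> / 2)\<close>; as \<open>\<alpha> < 2\<close> this is a geometric series.\<close>

lemma rad_mean_dudley:
  fixes T :: "('i \<Rightarrow> real) set"
  assumes I: "finite I" "I \<noteq> {}" and T: "finite T" "T \<noteq> {}"
    and \<alpha>: "0 < \<alpha>" "\<alpha> < 2" and C: "0 \<le> C" and \<sigma>: "0 < \<sigma>" "\<sigma> \<le> 1"
    and cover: "\<And>\<epsilon>. 0 < \<epsilon> \<Longrightarrow> \<exists>N. finite N \<and> real (card N) \<le> exp (C * \<epsilon> powr (-\<alpha>)) \<and>
        (\<forall>t\<in>T. \<exists>u\<in>N. (\<Sum>i\<in>I. (t i - u i)\<^sup>2) \<le> real (card I) * \<epsilon>\<^sup>2)"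
    and radius: "\<And>t. t \<in> T \<Longrightarrow> (\<Sum>i\<in>I. (t i)\<^sup>2) \<le> real (card I) * \<sigma>\<^sup>2"
  shows "rad_mean I (\<lambda>s. MAX t\<in>T. \<bar>\<Sum>i\<in>I. s i * t i\<bar>)
    \<le> ((2 * C + 11) / (1 - 2 powr (- (1 - \<alpha> / 2))) + 1) * sqrt (real (card I)) * \<sigma> powr (1 - \<alpha> / 2)"
proof -
  define k where "k = real (card I)"
  define b where "b = 1 - \<alpha> / 2"
  define a where "a j = \<sigma> / 2 ^ j" for j :: nat
  have k: "1 \<le> k" using I by (simp add: k_def Suc_leI card_gt_0_iff)
  have kdiv: "k * (y / sqrt k) = sqrt k * y" for y
  proof -
    have "k * (y / sqrt k) = (k / sqrt k) * y" by simp
    then show ?thesis using k by (simp add: real_div_sqrt)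
  qed
  have b: "0 < b" using \<alpha> by (simp add: b_def)
  have a: "0 < a j" "a j \<le> 1" for j
    using \<sigma> by (auto simp: a_def divide_le_eq intro: order_trans[OF _ one_le_power])
  have "\<exists>N. finite N \<and> real (card N) \<le> exp (C * a j powr (-\<alpha>)) \<and>
        (\<forall>t\<in>T. \<exists>u\<in>N. (\<Sum>i\<in>I. (t i - u i)\<^sup>2) \<le> k * (a j)\<^sup>2)" for j
    unfolding k_def by (rule cover[OF a(1)])
  then have "\<exists>N. \<forall>j. finite (N j) \<and> real (card (N j)) \<le> exp (C * a j powr (-\<alpha>)) \<and>
        (\<forall>t\<in>T. \<exists>u\<in>N j. (\<Sum>i\<in>I. (t i - u i)\<^sup>2) \<le> k * (a j)\<^sup>2)"
    by (intro choice allI)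
  then obtain N where NN: "\<forall>j. finite (N j) \<and> real (card (N j)) \<le> exp (C * a j powr (-\<alpha>)) \<and>
        (\<forall>t\<in>T. \<exists>u\<in>N j. (\<Sum>i\<in>I. (t i - u i)\<^sup>2) \<le> k * (a j)\<^sup>2)"
    by (rule exE)
  have N: "finite (N j)" "real (card (N j)) \<le> exp (C * a j powr (-\<alpha>))" for j
    using spec[OF NN, of j] by simp_all
  have N3: "\<exists>v\<in>N j. (\<Sum>i\<in>I. (t i - v i)\<^sup>2) \<le> k * (a j)\<^sup>2" if "t \<in> T" for j t
    by (rule bspec[OF conjunct2[OF conjunct2[OF spec[OF NN, of j]]] that])
  define u where "u j t = (SOME v. v \<in> N j \<and> (\<Sum>i\<in>I. (t i - v i)\<^sup>2) \<le> k * (a j)\<^sup>2)" for j t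
  have uj: "u j t \<in> N j \<and> (\<Sum>i\<in>I. (t i - u j t i)\<^sup>2) \<le> k * (a j)\<^sup>2" if "t \<in> T" for j t
    using someI_ex[OF N3[OF that, of j, unfolded Bex_def]] unfolding u_def .
  have u: "u j t \<in> N j" "(\<Sum>i\<in>I. (t i - u j t i)\<^sup>2) \<le> k * (a j)\<^sup>2" if "t \<in> T" for j t
    using uj[OF that] by (rule conjunct1, rule conjunct2)
  define N' where "N' j = (if j = 0 then {\<lambda>_. 0} else N j)" for j
  define w where "w j t = (if j = 0 then (\<lambda>_. 0) else u j t)" for j t
  have N': "finite (N' j)" "real (card (N' j)) \<le> exp (C * a j powr (-\<alpha>))" for j
    using N C by (auto simp: N'_def)
  have w: "w j t \<in> N' j" "(\<Sum>i\<in>I. (t i - w j t i)\<^sup>2) \<le> k * (a j)\<^sup>2" if "t \<in> T" for j t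
    using u[OF that] radius[OF that] by (auto simp: w_def N'_def k_def a_def)
  define d where "d j t = (\<lambda>i. w (Suc j) t i - w j t i)" for j t
  (* At this depth the error of the last approximation is negligible even by the triangle inequality. *)
  obtain J where "\<sigma> / 2 ^ J \<le> \<sigma> powr b / sqrt k"
    using half_pow_tendsto[of "\<sigma> powr b / sqrt k" \<sigma>] \<sigma> k by auto
  then have J: "k * a J \<le> sqrt k * \<sigma> powr b"
    unfolding a_def kdiv[symmetric] using k by (intro mult_left_mono) auto
  have link: "rad_mean I (\<lambda>s. MAX t\<in>T. \<bar>\<Sum>i\<in>I. s i * d j t i\<bar>) \<le> (2 * C + 11) * sqrt k * a (Suc j) powr b" for j
  proof -
    let ?a = "a (Suc j)"
    have sub: "d j ` T \<subseteq> (\<lambda>(v, v'). (\<lambda>i. v i - v' i)) ` (N' (Suc j) \<times> N' j)"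
      using w(1) by (auto simp: d_def image_iff intro!: bexI[of _ "w (Suc j) _"] bexI[of _ "w j _"])
    have "a j powr (-\<alpha>) \<le> ?a powr (-\<alpha>)"
      using a \<alpha> \<sigma> by (intro powr_mono2') (auto simp: a_def field_simps)
    then have Cj: "C * a j powr (-\<alpha>) \<le> C * ?a powr (-\<alpha>)" using C by (rule mult_left_mono)
    have "card (d j ` T) \<le> card (N' (Suc j) \<times> N' j)"
      using N'(1) by (intro order_trans[OF card_mono[OF _ sub]] card_image_le) auto
    then have "real (card (d j ` T)) \<le> real (card (N' (Suc j))) * real (card (N' j))"
      by (simp add: card_cartesian_product flip: of_nat_mult)
    also have "\<dots> \<le> exp (C * ?a powr (-\<alpha>)) * exp (C * ?a powr (-\<alpha>))"
      using Cj by (intro mult_mono order_trans[OF N'(2)]) auto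
    finally have card: "real (card (d j ` T)) \<le> exp (2 * C * ?a powr (-\<alpha>))"
      by (simp add: exp_add[symmetric] mult.assoc)
    have sq: "(\<Sum>i\<in>I. (v i)\<^sup>2) \<le> 10 * k * ?a\<^sup>2" if "v \<in> d j ` T" for v
    proof -
      from that obtain t where t: "t \<in> T" "v = d j t" by auto
      have 1: "(\<Sum>i\<in>I. (w (Suc j) t i - t i)\<^sup>2) \<le> k * ?a\<^sup>2"
        using w(2)[OF t(1)] by (simp add: power2_commute)
      have "(\<Sum>i\<in>I. ((w (Suc j) t i - t i) + (t i - w j t i))\<^sup>2) \<le> 2 * (k * ?a\<^sup>2) + 2 * (k * (a j)\<^sup>2)"
        by (rule sum_power2_add_le[OF 1 w(2)[OF t(1)]])
      then show ?thesis by (simp add: t(2) d_def a_def power_divide)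
    qed
    (* Up to a constant, this r balances the two terms of the maximal inequality. *)
    define r where "r = ?a powr (- (1 + \<alpha> / 2)) / sqrt k"
    have r: "0 < r" using a(1)[of "Suc j"] k by (simp add: r_def)
    have "rad_mean I (\<lambda>s. MAX t\<in>T. \<bar>\<Sum>i\<in>I. s i * d j t i\<bar>)
        = rad_mean I (\<lambda>s. MAX v\<in>d j ` T. \<bar>\<Sum>i\<in>I. s i * v i\<bar>)"
      by (simp add: image_image)
    also have "\<dots> \<le> (2 * C * ?a powr (-\<alpha>) + 1) / r + r * (10 * k * ?a\<^sup>2)"
      by (rule rad_mean_Max_abs_le) (use I T card sq r in auto)
    also have "r * (10 * k * ?a\<^sup>2) = 10 * sqrt k * ?a powr b"
    proof -
      have "?a powr (- (1 + \<alpha> / 2)) * ?a\<^sup>2 = ?a powr b"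
      proof -
        have "?a\<^sup>2 = ?a powr 2" "- (1 + \<alpha> / 2) + 2 = b"
          using a(1)[of "Suc j"] by (simp_all add: b_def)
        then show ?thesis by (simp only: powr_add[symmetric])
      qed
      moreover have "r * (10 * k * ?a\<^sup>2) = 10 * (k * (?a powr (- (1 + \<alpha> / 2)) * ?a\<^sup>2 / sqrt k))"
        by (simp add: r_def)
      ultimately show ?thesis by (simp only: kdiv mult.assoc)
    qed
    also have "(2 * C * ?a powr (-\<alpha>) + 1) / r = sqrt k * (2 * C * ?a powr b + ?a powr (1 + \<alpha> / 2))"
    proof -
      have "1 / r = sqrt k * ?a powr (1 + \<alpha> / 2)"
        unfolding r_def powr_minus_divide by simp
      moreover have "?a powr (-\<alpha>) * ?a powr (1 + \<alpha> / 2) = ?a powr b"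
        unfolding powr_add[symmetric] b_def by simp
      moreover have "(2 * C * ?a powr (-\<alpha>) + 1) / r = (2 * C * ?a powr (-\<alpha>) + 1) * (1 / r)" by simp
      moreover have "(2 * C * y + 1) * (s * z) = s * (2 * C * (y * z) + z)" for y z s :: real
        by (simp add: algebra_simps)
      ultimately show ?thesis by (simp only:)
    qed
    also have "\<dots> \<le> sqrt k * (2 * C * ?a powr b + ?a powr b)"
      using a[of "Suc j"] k \<alpha> by (intro mult_left_mono add_left_mono powr_mono') (auto simp: b_def)
    finally show ?thesis by (simp add: algebra_simps)
  qed
  have tele: "(\<Sum>i\<in>I. signs A i * t i) =
      (\<Sum>j<J. \<Sum>i\<in>I. signs A i * d j t i) + (\<Sum>i\<in>I. signs A i * (t i - w J t i))" for A t
  proof -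
    have "(\<Sum>j<J. d j t i) = w J t i" for i
      using sum_lessThan_telescope[of "\<lambda>j. w j t i" J] by (simp add: d_def w_def)
    then have "(\<Sum>j<J. \<Sum>i\<in>I. signs A i * d j t i) = (\<Sum>i\<in>I. signs A i * w J t i)"
      by (subst sum.swap) (simp add: sum_distrib_left[symmetric])
    then show ?thesis by (simp add: sum.distrib[symmetric] algebra_simps)
  qed
  have "rad_mean I (\<lambda>s. MAX t\<in>T. \<bar>\<Sum>i\<in>I. s i * t i\<bar>)
     \<le> rad_mean I (\<lambda>s. (\<Sum>j<J. MAX t\<in>T. \<bar>\<Sum>i\<in>I. s i * d j t i\<bar>) + k * a J)"
  proof (intro rad_mean_mono MAX_le[OF T])
    fix A t assume t: "t \<in> T"
    have "\<bar>\<Sum>i\<in>I. signs A i * t i\<bar> \<le> \<bar>\<Sum>j<J. \<Sum>i\<in>I. signs A i * d j t i\<bar>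
        + \<bar>\<Sum>i\<in>I. signs A i * (t i - w J t i)\<bar>"
      unfolding tele[of A t] by (rule abs_triangle_ineq)
    also have "\<dots> \<le> (\<Sum>j<J. \<bar>\<Sum>i\<in>I. signs A i * d j t i\<bar>) + k * a J"
      using w(2)[OF t, of J] a(1)[of J]
      by (intro add_mono sum_abs abs_signed_sum_le_sqrt[where I=I and a="a J", folded k_def]) auto
    also have "\<dots> \<le> (\<Sum>j<J. MAX t\<in>T. \<bar>\<Sum>i\<in>I. signs A i * d j t i\<bar>) + k * a J"
      using MAX_ge[OF T(1) t] by (intro add_right_mono sum_mono) 
    finally show "\<bar>\<Sum>i\<in>I. signs A i * t i\<bar> \<le> (\<Sum>j<J. MAX t\<in>T. \<bar>\<Sum>i\<in>I. signs A i * d j t i\<bar>) + k * a J" .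
  qed
  also have "\<dots> \<le> (\<Sum>j<J. (2 * C + 11) * sqrt k * a (Suc j) powr b) + sqrt k * \<sigma> powr b"
    unfolding rad_mean_add rad_mean_sum using J I by (intro add_mono sum_mono link) simp
  also have "(\<Sum>j<J. (2 * C + 11) * sqrt k * a (Suc j) powr b)
      \<le> (2 * C + 11) * sqrt k * (\<sigma> powr b * (1 / (1 - 2 powr (-b))))"
  proof -
    have q: "0 \<le> 2 powr (-b)" "2 powr (-b) < 1" using b by (auto simp: powr_less_one)
    have "a (Suc j) powr b \<le> \<sigma> powr b * (2 powr (-b)) ^ j" for j
    proof -
      have "a (Suc j) powr b \<le> a j powr b"
        using a b \<sigma> by (intro powr_mono2) (auto simp: a_def field_simps less_imp_le)
      then show ?thesis using powr_half_pow[OF \<sigma>(1)] by (simp add: a_def)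
    qed
    then have "(\<Sum>j<J. a (Suc j) powr b) \<le> \<sigma> powr b * (\<Sum>j<J. (2 powr (-b)) ^ j)"
      unfolding sum_distrib_left by (rule sum_mono)
    also have "\<dots> \<le> \<sigma> powr b * (1 / (1 - 2 powr (-b)))"
      using q by (intro mult_left_mono sum_geometric_le) auto
    finally show ?thesis
      unfolding sum_distrib_left[symmetric] using C k by (intro mult_left_mono) auto
  qed
  finally show ?thesis
    by (simp add: k_def b_def algebra_simps)
qed

lemma ln_enat_INF_le:
  assumes "ln_enat (INF B\<in>S. enat (card B)) \<le> ereal c"
  shows "\<exists>B\<in>S. real (card B) \<le> exp c"
proof -
  have "S \<noteq> {}"
    using assms by (auto simp: ln_enat_def top_enat_def)
  then have "(INF B\<in>S. enat (card B)) \<in> (\<lambda>B. enat (card B)) ` S"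
    unfolding Inf_enat_def using LeastI_ex[of "\<lambda>x. x \<in> (\<lambda>B. enat (card B)) ` S"] by auto
  then obtain B where B: "B \<in> S" "(INF B\<in>S. enat (card B)) = enat (card B)" by auto
  then have "ln (real (card B)) \<le> c"
    using assms by (simp add: ln_enat_def)
  then have "real (card B) \<le> exp c"
  proof (cases "card B = 0")
    case False
    then have "real (card B) = exp (ln (real (card B)))" by simp
    also have "\<dots> \<le> exp c" using \<open>ln (real (card B)) \<le> c\<close> by simp
    finally show ?thesis .
  qed simp
  with B(1) show ?thesis by blast
qed

definition empirical_measure :: "'x measure \<Rightarrow> 'i set \<Rightarrow> ('i \<Rightarrow> 'x) \<Rightarrow> 'x measure" where
  "empirical_measure P I x = distr (uniform_count_measure I) P x"

lemma measurable_uniform_count: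
  assumes "\<And>i. i \<in> I \<Longrightarrow> x i \<in> space P"
  shows "x \<in> measurable (uniform_count_measure I) P"
  using assms by (auto intro!: measurableI simp: space_uniform_count_measure sets_uniform_count_measure)

lemma L2_norm_empirical:
  assumes "finite I" "\<And>i. i \<in> I \<Longrightarrow> x i \<in> space P" "f \<in> borel_measurable P"
  shows "L2_norm (empirical_measure P I x) f = sqrt ((\<Sum>i\<in>I. (f (x i))\<^sup>2) / real (card I))"
proof -
  have "(\<integral>y. (f y)\<^sup>2 \<partial>empirical_measure P I x) = (\<integral>i. (f (x i))\<^sup>2 \<partial>uniform_count_measure I)"
    unfolding empirical_measure_def using assms
    by (intro integral_distr measurable_uniform_count) auto
  then show ?thesis
    using assms(1) by (simp add: L2_norm_def integral_uniform_count_measure)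
qed

lemma empirical_measure_finitely_discrete:
  assumes I: "finite I" "I \<noteq> {}" and x: "\<And>i. i \<in> I \<Longrightarrow> x i \<in> space P"
  shows "empirical_measure P I x \<in> finitely_discrete P"
proof -
  note m = measurable_uniform_count[OF x]
  define w where "w y = real (card {i\<in>I. x i = y}) / real (card I)" for y
  have "emeasure (empirical_measure P I x) B = ennreal (\<Sum>y\<in>x ` I. w y * indicator B y)"
    if B: "B \<in> sets P" for B
  proof -
    have "emeasure (empirical_measure P I x) B
        = emeasure (uniform_count_measure I) (x -` B \<inter> space (uniform_count_measure I))"
      unfolding empirical_measure_def using m B by (intro emeasure_distr) auto
    also have "\<dots> = ennreal (real (card {i\<in>I. x i \<in> B}) / real (card I))"
      using I(1) by (simp add: emeasure_uniform_count_measure space_uniform_count_measure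
          vimage_def Int_def conj_commute)
    also have "real (card {i\<in>I. x i \<in> B}) = (\<Sum>i\<in>I. indicator B (x i))"
      using I(1) by (simp add: indicator_def sum.If_cases Int_def)
    also have "\<dots> = (\<Sum>y\<in>x ` I. \<Sum>i\<in>{i\<in>I. x i = y}. indicator B (x i))"
      using I(1) by (subst sum.image_gen[of I _ x]) auto
    also have "\<dots> = (\<Sum>y\<in>x ` I. real (card {i\<in>I. x i = y}) * indicator B y)"
      by (intro sum.cong) auto
    also have "\<dots> / real (card I) = (\<Sum>y\<in>x ` I. w y * indicator B y)"
      by (simp add: w_def sum_divide_distrib)
    finally show ?thesis .
  qed
  moreover have "prob_space (empirical_measure P I x)"
    unfolding empirical_measure_def using I m
    by (intro prob_space.prob_space_distr prob_space_uniform_count_measure)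
  moreover have "sets (empirical_measure P I x) = sets P" by (simp add: empirical_measure_def)
  ultimately show ?thesis
    unfolding finitely_discrete_def using I x
    by (auto simp: w_def intro!: exI[of _ "x ` I"] exI[of _ w])
qed

lemma envelope_unit:
  assumes "H \<subseteq> Linf_unit P" "H \<noteq> {}" "x \<in> space P"
  shows "0 \<le> envelope H x" "envelope H x \<le> 1" "\<And>h. h \<in> H \<Longrightarrow> \<bar>h x\<bar> \<le> envelope H x"
proof -
  have bdd: "bdd_above ((\<lambda>h. \<bar>h x\<bar>) ` H)"
    using assms by (auto intro!: bdd_aboveI[of _ 1] simp: Linf_unit_def)
  show le: "\<bar>h x\<bar> \<le> envelope H x" if "h \<in> H" for h
    unfolding envelope_def using that bdd by (intro cSUP_upper)
  show "envelope H x \<le> 1"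
    unfolding envelope_def using assms by (intro cSUP_least) (auto simp: Linf_unit_def)
  obtain h where "h \<in> H" using assms(2) by auto
  from le[OF this] show "0 \<le> envelope H x" by linarith
qed

text \<open>On a sample, the uniform entropy condition gives covers in the empirical distance. The
  envelope is bounded by one, so that normalising the radius by it only helps; if it vanishes on the
  sample, so do all functions of the class, and a single center suffices.\<close>

lemma uniform_entropy_cover:
  assumes ent: "uniform_entropy P H \<alpha> C" and "0 < \<alpha>" "0 \<le> C"
    and H: "countable H" "H \<noteq> {}" "H \<subseteq> Linf_unit P"
    and I: "finite I" "I \<noteq> {}" and x: "\<And>i. i \<in> I \<Longrightarrow> x i \<in> space P" and "0 < \<epsilon>"
  shows "\<exists>N. finite N \<and> real (card N) \<le> exp (C * \<epsilon> powr (-\<alpha>)) \<and>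
    (\<forall>h\<in>H. \<exists>g\<in>N. (\<Sum>i\<in>I. (h (x i) - g (x i))\<^sup>2) \<le> real (card I) * \<epsilon>\<^sup>2)"
proof -
  define Q where "Q = empirical_measure P I x"
  define e where "e = L2_norm Q (envelope H)"
  have k: "0 < real (card I)" using I by (simp add: card_gt_0_iff)
  have menv: "envelope H \<in> borel_measurable P"
    unfolding envelope_def[abs_def] using H
    by (intro borel_measurable_cSUP) (auto simp: Linf_unit_def intro!: bdd_aboveI[of _ 1])
  have e: "e = sqrt ((\<Sum>i\<in>I. (envelope H (x i))\<^sup>2) / real (card I))"
    unfolding e_def Q_def by (rule L2_norm_empirical[OF I(1) x menv])
  have env: "0 \<le> (envelope H (x i))\<^sup>2" "(envelope H (x i))\<^sup>2 \<le> 1" if "i \<in> I" for i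
    using envelope_unit[OF H(3,2) x[OF that]] by (auto simp: abs_square_le_1)
  have "(\<Sum>i\<in>I. (envelope H (x i))\<^sup>2) \<le> (\<Sum>i\<in>I. 1)"
    using env by (intro sum_mono) auto
  then have e1: "e \<le> 1" using k by (simp add: e divide_le_eq)
  have e0: "0 \<le> e" unfolding e by (intro real_sqrt_ge_zero divide_nonneg_nonneg sum_nonneg) auto
  show ?thesis
  proof (cases "e = 0")
    case True
    then have "(\<Sum>i\<in>I. (envelope H (x i))\<^sup>2) = 0" using k by (simp add: e)
    then have "envelope H (x i) = 0" if "i \<in> I" for i
      using that I by (simp add: sum_nonneg_eq_0_iff)
    then have "h (x i) = 0" if "i \<in> I" "h \<in> H" for h i
      using envelope_unit(3)[OF H(3,2) x[OF that(1)] that(2)] that(1) by simp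
    then have "(\<Sum>i\<in>I. (h (x i) - 0)\<^sup>2) \<le> real (card I) * \<epsilon>\<^sup>2" if "h \<in> H" for h
    proof -
      have "(\<Sum>i\<in>I. (h (x i) - 0)\<^sup>2) = 0"
        using \<open>\<And>i h. i \<in> I \<Longrightarrow> h \<in> H \<Longrightarrow> h (x i) = 0\<close> that by (intro sum.neutral) auto
      then show ?thesis by simp
    qed
    then show ?thesis
      using \<open>0 \<le> C\<close> by (intro exI[of _ "{\<lambda>_. 0}"]) auto
  next
    case False
    then have e': "0 < e" using e0 by simp
    have Q: "Q \<in> finitely_discrete P"
      unfolding Q_def by (rule empirical_measure_finitely_discrete[OF I x])
    have "ln_enat (covering_number Q H (\<epsilon> / e * L2_norm Q (envelope H)))
        \<le> (SUP Q \<in> {Q \<in> finitely_discrete P. L2_norm Q (envelope H) > 0}.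
               ln_enat (covering_number Q H (\<epsilon> / e * L2_norm Q (envelope H))))"
      using Q e' by (intro SUP_upper) (auto simp: e_def)
    also have "\<dots> \<le> ereal (C * (\<epsilon> / e) powr (-\<alpha>))"
      using e' \<open>0 < \<epsilon>\<close> by (intro ent[unfolded uniform_entropy_def, rule_format]) simp
    also have "\<dots> \<le> ereal (C * \<epsilon> powr (-\<alpha>))"
    proof -
      have "\<epsilon> \<le> \<epsilon> / e" using e1 e' \<open>0 < \<epsilon>\<close> by (simp add: le_divide_eq)
      then have "(\<epsilon> / e) powr (-\<alpha>) \<le> \<epsilon> powr (-\<alpha>)"
        using \<open>0 < \<epsilon>\<close> \<open>0 < \<alpha>\<close> by (intro powr_mono2') auto
      then show ?thesis using \<open>0 \<le> C\<close> by (auto intro: mult_left_mono)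
    qed
    finally have "ln_enat (covering_number Q H \<epsilon>) \<le> ereal (C * \<epsilon> powr (-\<alpha>))"
      using e' by (simp add: e_def)
    from ln_enat_INF_le[OF this[unfolded covering_number_def]] obtain N where
      N: "finite N" "N \<subseteq> L2_space Q" "\<And>h. h \<in> H \<Longrightarrow> \<exists>g\<in>N. L2_norm Q (\<lambda>x. h x - g x) < \<epsilon>"
        "real (card N) \<le> exp (C * \<epsilon> powr (-\<alpha>))" by auto
    have "\<exists>g\<in>N. (\<Sum>i\<in>I. (h (x i) - g (x i))\<^sup>2) \<le> real (card I) * \<epsilon>\<^sup>2" if h: "h \<in> H" for h
    proof -
      obtain g where g: "g \<in> N" "L2_norm Q (\<lambda>x. h x - g x) < \<epsilon>" using N(3)[OF h] by auto
      have "g \<in> borel_measurable P"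
        using g(1) N(2) by (auto simp: L2_space_def Q_def empirical_measure_def)
      then have "(\<lambda>x. h x - g x) \<in> borel_measurable P"
        using h H(3) by (auto simp: Linf_unit_def)
      from L2_norm_empirical[OF I(1) x this]
      have "sqrt ((\<Sum>i\<in>I. (h (x i) - g (x i))\<^sup>2) / real (card I)) < \<epsilon>"
        using g(2) by (simp add: Q_def)
      then have "(\<Sum>i\<in>I. (h (x i) - g (x i))\<^sup>2) / real (card I) < \<epsilon>\<^sup>2"
        using \<open>0 < \<epsilon>\<close> real_less_lsqrt sqrt_le_D not_le by (metis less_le real_le_rsqrt)
      then show ?thesis using g(1) k by (auto simp: divide_less_eq mult.commute intro!: bexI[of _ g])
    qed
    with N show ?thesis by blast
  qed
qed

section \<open>The local maximal inequality\<close>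

text \<open>At sample size \<open>k\<close> the second term is the value of the first one at the critical radius
  \<open>r = k powr (- 1 / (2 + \<alpha>))\<close>.\<close>

definition local_complexity_bound :: "'x measure \<Rightarrow> ('x \<Rightarrow> real) set \<Rightarrow> real \<Rightarrow> real \<Rightarrow> bool" where
  "local_complexity_bound P H \<alpha> K \<longleftrightarrow>
    (\<forall>(I::nat set) G r. finite I \<longrightarrow> I \<noteq> {} \<longrightarrow> finite G \<longrightarrow> G \<subseteq> H \<longrightarrow> (\<lambda>_. 0) \<in> G \<longrightarrow> 0 < r \<longrightarrow> r \<le> 1 \<longrightarrow>
      (\<forall>h\<in>G. (\<integral>x. (h x)\<^sup>2 \<partial>P) \<le> r\<^sup>2) \<longrightarrow>
      rad_complexity P I G \<le>
        K * (sqrt (real (card I)) * r powr (1 - \<alpha> / 2) + real (card I) powr (\<alpha> / (2 + \<alpha>))))"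

text \<open>A substitute for Jensen's inequality for powers below one: with \<open>b\<close> the mean of \<open>y\<close>, the right-hand
  side has mean \<open>2 * b powr \<theta>\<close>.\<close>

lemma powr_le_affine:
  fixes y b \<theta> :: real
  assumes "0 \<le> y" "0 < b" "0 < \<theta>" "\<theta> \<le> 1"
  shows "y powr \<theta> \<le> b powr \<theta> * (1 + y / b)"
proof -
  have "(y / b) powr \<theta> \<le> (1 + y / b) powr \<theta>"
    using assms by (intro powr_mono2) auto
  also have "\<dots> \<le> (1 + y / b) powr 1"
    using assms by (intro powr_mono) auto
  finally have "(y / b) powr \<theta> \<le> 1 + y / b" using assms by simp
  then have "b powr \<theta> * (y / b) powr \<theta> \<le> b powr \<theta> * (1 + y / b)"
    by (intro mult_left_mono) auto
  also have "b powr \<theta> * (y / b) powr \<theta> = y powr \<theta>"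
    using assms by (simp add: powr_mult[symmetric])
  finally show ?thesis .
qed

text \<open>Solving the self-bounding inequality \<open>\<psi> \<le> A * sqrt k * (5 r^2 + 8 \<psi> / k) powr \<theta>\<close>: either the
  radius or the empirical fluctuation dominates inside the power.\<close>

lemma self_bounding_solve:
  fixes \<psi> r k A \<alpha> :: real
  assumes \<psi>: "0 \<le> \<psi>" and r: "0 < r" and k: "1 \<le> k" and A: "1 \<le> A" and \<alpha>: "0 < \<alpha>" "\<alpha> < 2"
    and le: "\<psi> \<le> A * sqrt k * (5 * r\<^sup>2 + 8 * \<psi> / k) powr ((2 - \<alpha>) / 4)"
  shows "\<psi> \<le> (48 * A)\<^sup>2 * (sqrt k * r powr (1 - \<alpha> / 2) + k powr (\<alpha> / (2 + \<alpha>)))"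
proof -
  define \<theta> where "\<theta> = (2 - \<alpha>) / 4"
  have \<theta>: "0 < \<theta>" "\<theta> < 1" using \<alpha> by (auto simp: \<theta>_def)
  have base: "48 * A \<le> (48 * A)\<^sup>2"
    using A by (simp add: power2_eq_square)
  have powr_le: "c powr \<theta> \<le> c" if "1 \<le> c" for c
    using that \<theta> powr_mono[of \<theta> 1 c] by simp
  show ?thesis
  proof (cases "8 * \<psi> / k \<le> r\<^sup>2")
    case True
    have "\<psi> \<le> A * sqrt k * (6 * r\<^sup>2) powr \<theta>"
      using True A k \<psi> \<theta> by (intro order_trans[OF le[folded \<theta>_def]] mult_left_mono powr_mono2) auto
    also have "(6 * r\<^sup>2) powr \<theta> = 6 powr \<theta> * r powr (1 - \<alpha> / 2)"
    proof -
      have "r\<^sup>2 = r powr 2" "2 * \<theta> = 1 - \<alpha> / 2" using r by (simp_all add: \<theta>_def)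
      then show ?thesis using r by (simp only: powr_mult powr_powr)
    qed
    also have "A * sqrt k * (6 powr \<theta> * r powr (1 - \<alpha> / 2)) \<le> A * sqrt k * (48 * r powr (1 - \<alpha> / 2))"
      using A k powr_le[of 6] by (intro mult_left_mono mult_right_mono) auto
    also have "\<dots> = 48 * A * (sqrt k * r powr (1 - \<alpha> / 2))" by simp
    also have "\<dots> \<le> (48 * A)\<^sup>2 * (sqrt k * r powr (1 - \<alpha> / 2) + k powr (\<alpha> / (2 + \<alpha>)))"
      using base A k by (intro mult_mono) auto
    finally show ?thesis .
  next
    case False
    then have pos: "0 < \<psi>" using \<psi> r k by (cases "\<psi> = 0") auto
    have "\<psi> \<le> A * sqrt k * (48 * (\<psi> / k)) powr \<theta>"
      using False A k \<psi> \<theta> r by (intro order_trans[OF le[folded \<theta>_def]] mult_left_mono powr_mono2) auto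
    also have "(48 * (\<psi> / k)) powr \<theta> = 48 powr \<theta> * (\<psi> powr \<theta> / k powr \<theta>)"
      using pos k by (simp only: powr_mult powr_divide)
    also have "A * sqrt k * (48 powr \<theta> * (\<psi> powr \<theta> / k powr \<theta>))
        \<le> A * sqrt k * (48 * (\<psi> powr \<theta> / k powr \<theta>))"
      using A k powr_le[of 48] by (intro mult_left_mono mult_right_mono) auto
    finally have "\<psi> / \<psi> powr \<theta> \<le> 48 * A * (sqrt k / k powr \<theta>)"
      using pos by (simp add: divide_le_eq mult_ac)
    also have "\<psi> / \<psi> powr \<theta> = \<psi> powr (1 - \<theta>)"
      using pos by (simp add: powr_diff)
    also have "sqrt k / k powr \<theta> = k powr (1 / 2 - \<theta>)"
      using k by (simp add: powr_diff powr_half_sqrt)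
    finally have main: "\<psi> powr (1 - \<theta>) \<le> 48 * A * k powr (1 / 2 - \<theta>)" .
    define \<rho> where "\<rho> = 4 / (2 + \<alpha>)"
    have \<rho>: "0 < \<rho>" "\<rho> \<le> 2" "(1 - \<theta>) * \<rho> = 1" "(1 / 2 - \<theta>) * \<rho> = \<alpha> / (2 + \<alpha>)"
      using \<alpha> by (auto simp: \<rho>_def \<theta>_def field_simps)
    have "\<psi> = (\<psi> powr (1 - \<theta>)) powr \<rho>"
      using pos \<rho>(3) by (simp add: powr_powr)
    also have "\<dots> \<le> (48 * A * k powr (1 / 2 - \<theta>)) powr \<rho>"
      using main \<rho>(1) by (intro powr_mono2) auto
    also have "\<dots> = (48 * A) powr \<rho> * k powr (\<alpha> / (2 + \<alpha>))"
      using A \<rho>(4) by (simp add: powr_mult powr_powr)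
    also have "\<dots> \<le> (48 * A) powr 2 * k powr (\<alpha> / (2 + \<alpha>))"
      using A \<rho>(2) by (intro mult_right_mono powr_mono) auto
    also have "\<dots> = (48 * A)\<^sup>2 * k powr (\<alpha> / (2 + \<alpha>))" using A by simp
    also have "\<dots> \<le> (48 * A)\<^sup>2 * (sqrt k * r powr (1 - \<alpha> / 2) + k powr (\<alpha> / (2 + \<alpha>)))"
      using k by (intro mult_left_mono) auto
    finally show ?thesis .
  qed
qed

context prob_space
begin

text \<open>Under uniform entropy the relevant chaining radius is the random empirical one. Its expected square
  is the squared radius plus the fluctuation of the empirical second moments, which symmetrization
  and contraction bound by the very complexity under consideration.\<close>

lemma local_complexity_bound_uniform_aux:
  fixes I :: "nat set"
  assumes ent: "uniform_entropy M H \<alpha> C" and \<alpha>: "0 < \<alpha>" "\<alpha> < 2" and C: "0 \<le> C"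
    and H: "countable H" "H \<subseteq> Linf_unit M"
    and I: "finite I" "I \<noteq> {}" and G: "finite G" "G \<subseteq> H" "(\<lambda>_. 0) \<in> G"
    and r: "0 < r" "r \<le> 1" and rad: "\<And>h. h \<in> G \<Longrightarrow> (\<integral>x. (h x)\<^sup>2 \<partial>M) \<le> r\<^sup>2"
  defines "K \<equiv> (2 * C + 11) / (1 - 2 powr (- (1 - \<alpha> / 2))) + 1"
  shows "rad_complexity M I G \<le>
    2 * K * sqrt (real (card I)) * (5 * r\<^sup>2 + 8 * rad_complexity M I G / real (card I)) powr ((2 - \<alpha>) / 4)"
proof -
  interpret PI: prob_space "iid I M" by (rule prob_space_power)
  have ne: "G \<noteq> {}" "H \<noteq> {}" using G by auto
  have GL: "G \<subseteq> Linf_unit M" using G H by auto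
  define k where "k = real (card I)"
  have k: "1 \<le> k" using I by (simp add: k_def Suc_leI card_gt_0_iff)
  define \<theta> where "\<theta> = (2 - \<alpha>) / 4"
  have \<theta>: "0 < \<theta>" "\<theta> < 1" using \<alpha> by (auto simp: \<theta>_def)
  have "2 powr (- (1 - \<alpha> / 2)) < (1::real)" using \<alpha> by (simp add: powr_less_one)
  then have K: "0 \<le> K" using C by (simp add: K_def)
  define \<psi> where "\<psi> = rad_complexity M I G"
  have \<psi>: "0 \<le> \<psi>" unfolding \<psi>_def by (rule rad_complexity_nonneg[OF G(1) ne(1)])
  let ?c = "\<lambda>h. \<integral>y. (h y)\<^sup>2 \<partial>M"
  define D where "D x = (MAX h\<in>G. \<bar>\<Sum>i\<in>I. (h (x i))\<^sup>2 - ?c h\<bar>)" for x :: "nat \<Rightarrow> 'a"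
  define b where "b = 5 * r\<^sup>2 + 8 * \<psi> / k"
  have b: "0 < b" using r \<psi> k by (auto simp: b_def intro!: add_pos_nonneg)
  have sq1: "0 \<le> (h (x i))\<^sup>2" "(h (x i))\<^sup>2 \<le> 1"
    if "h \<in> G" "x \<in> space (iid I M)" "i \<in> I" for h x i
    using Linf_unitD(2)[of h M "x i"] that GL by (auto simp: space_PiM abs_square_le_1)
  have c01: "0 \<le> ?c h" "?c h \<le> 1" if "h \<in> G" for h
    using rad[OF that] r power_le_one[of r 2] by auto
  have D0: "0 \<le> D x" for x unfolding D_def by (rule MAX_abs_nonneg[OF G(1) ne(1)])
  have intD: "integrable (iid I M) D"
  proof (rule PI.integrable_bounded[where b=k])
    show "D \<in> borel_measurable (iid I M)"
    proof -
      have "(\<lambda>x. (h x)\<^sup>2 - ?c h) \<in> borel_measurable M" if "h \<in> G" for h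
        using that GL by (auto simp: Linf_unit_def)
      from measurable_sum_Max_abs[OF G(1) this, where c="\<lambda>_. 1" and I=I] show ?thesis
        unfolding D_def[abs_def] by simp
    qed
    fix x assume x: "x \<in> space (iid I M)"
    have "\<bar>\<Sum>i\<in>I. (h (x i))\<^sup>2 - ?c h\<bar> \<le> k" if h: "h \<in> G" for h
    proof -
      have "\<bar>\<Sum>i\<in>I. (h (x i))\<^sup>2 - ?c h\<bar> \<le> (\<Sum>i\<in>I. \<bar>(h (x i))\<^sup>2 - ?c h\<bar>)" by (rule sum_abs)
      also have "\<dots> \<le> (\<Sum>i\<in>I. 1)"
        using sq1[OF h x] c01[OF h] by (intro sum_mono) (smt (verit))
      finally show ?thesis by (simp add: k_def)
    qed
    then have "D x \<le> k" unfolding D_def by (intro MAX_le G ne)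
    then show "\<bar>D x\<bar> \<le> k" using D0 by simp
  qed
  have "ennreal (\<integral>x. D x \<partial>iid I M) = (\<integral>\<^sup>+x. ennreal (D x) \<partial>iid I M)"
    using intD D0 by (intro nn_integral_eq_integral[symmetric]) auto
  also have "\<dots> \<le> ennreal (8 * \<psi> + 4 * r\<^sup>2 * sqrt k)"
    unfolding D_def \<psi>_def k_def by (rule expected_Max_square_deviation[OF I(1) G(1) GL G(3) rad])
  finally have ED: "(\<integral>x. D x \<partial>iid I M) \<le> 8 * \<psi> + 4 * r\<^sup>2 * k"
  proof -
    assume "ennreal (\<integral>x. D x \<partial>iid I M) \<le> ennreal (8 * \<psi> + 4 * r\<^sup>2 * sqrt k)"
    then have "(\<integral>x. D x \<partial>iid I M) \<le> 8 * \<psi> + 4 * r\<^sup>2 * sqrt k"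
      using \<psi> k by (subst (asm) ennreal_le_iff) auto
    moreover have "sqrt k \<le> k"
      using k real_sqrt_le_mono[of k "k\<^sup>2"] by (simp add: power2_eq_square)
    then have "4 * r\<^sup>2 * sqrt k \<le> 4 * r\<^sup>2 * k"
      by (intro mult_left_mono) auto
    ultimately show ?thesis by linarith
  qed
  define v where "v x = r\<^sup>2 + D x / k" for x
  have pointwise: "rad_sup I G x
      \<le> K * sqrt k * (b powr \<theta> * (1 + v x / b))" if x: "x \<in> space (iid I M)" for x
  proof -
    have xI: "x i \<in> space M" if "i \<in> I" for i using x that by (auto simp: space_PiM)
    (* The empirical radius of G on the sample x is at most sqrt (v x); all functions being bounded
       by one, it is also at most one. *)
    define \<sigma> where "\<sigma> = min 1 (sqrt (v x))"
    have v: "r\<^sup>2 \<le> v x" using D0[of x] k by (simp add: v_def)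
    then have v0: "0 < v x" using r zero_less_power[of r 2] by linarith
    have \<sigma>: "0 < \<sigma>" "\<sigma> \<le> 1" using v0 by (auto simp: \<sigma>_def)
    have "rad_sup I G x
      = rad_mean I (\<lambda>s. MAX t\<in>(\<lambda>h i. h (x i)) ` G. \<bar>\<Sum>i\<in>I. s i * t i\<bar>)"
      by (simp add: image_image)
    also have "\<dots> \<le> K * sqrt (real (card I)) * \<sigma> powr (1 - \<alpha> / 2)"
      unfolding K_def
    proof (rule rad_mean_dudley[OF I _ _ \<alpha> C \<sigma>])
      fix \<epsilon> :: real assume "0 < \<epsilon>"
      then have "\<exists>N. finite N \<and> real (card N) \<le> exp (C * \<epsilon> powr (-\<alpha>)) \<and>
          (\<forall>h\<in>H. \<exists>g\<in>N. (\<Sum>i\<in>I. (h (x i) - g (x i))\<^sup>2) \<le> real (card I) * \<epsilon>\<^sup>2)"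
        using xI by (intro uniform_entropy_cover[OF ent \<alpha>(1) C H(1) ne(2) H(2) I])
      then obtain N where
        N: "finite N" "real (card N) \<le> exp (C * \<epsilon> powr (-\<alpha>))"
           "\<forall>h\<in>H. \<exists>g\<in>N. (\<Sum>i\<in>I. (h (x i) - g (x i))\<^sup>2) \<le> real (card I) * \<epsilon>\<^sup>2"
        by (elim exE conjE) (rule that)
      have "real (card ((\<lambda>h i. h (x i)) ` N)) \<le> real (card N)"
        using N(1) by (simp add: card_image_le)
      then have card: "real (card ((\<lambda>h i. h (x i)) ` N)) \<le> exp (C * \<epsilon> powr (-\<alpha>))"
        using N(2) by linarith
      show "\<exists>N. finite N \<and> real (card N) \<le> exp (C * \<epsilon> powr (-\<alpha>)) \<and>
        (\<forall>t\<in>(\<lambda>h i. h (x i)) ` G. \<exists>u\<in>N. (\<Sum>i\<in>I. (t i - u i)\<^sup>2) \<le> real (card I) * \<epsilon>\<^sup>2)"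
      proof (rule exI[of _ "(\<lambda>h i. h (x i)) ` N"], intro conjI ballI)
        fix t assume "t \<in> (\<lambda>h i. h (x i)) ` G"
        then obtain h where h: "h \<in> H" "t = (\<lambda>i. h (x i))" using G(2) by auto
        from bspec[OF N(3) h(1)] obtain g where
          "g \<in> N" "(\<Sum>i\<in>I. (h (x i) - g (x i))\<^sup>2) \<le> real (card I) * \<epsilon>\<^sup>2"
          by (elim bexE) (rule that)
        then show "\<exists>u\<in>(\<lambda>h i. h (x i)) ` N. (\<Sum>i\<in>I. (t i - u i)\<^sup>2) \<le> real (card I) * \<epsilon>\<^sup>2"
          unfolding h(2) by (intro bexI[of _ "\<lambda>i. g (x i)"]) auto
      qed (use N(1) card in auto)
    next
      fix t assume "t \<in> (\<lambda>h i. h (x i)) ` G"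
      then obtain h where h: "h \<in> G" "t = (\<lambda>i. h (x i))" by auto
      have "(\<Sum>i\<in>I. (h (x i))\<^sup>2) \<le> real (card I)"
        using sum_mono[of I "\<lambda>i. (h (x i))\<^sup>2" "\<lambda>_. 1"] sq1[OF h(1) x] by simp
      moreover have "(\<Sum>i\<in>I. (h (x i))\<^sup>2) \<le> real (card I) * v x"
      proof -
        have "(\<Sum>i\<in>I. (h (x i))\<^sup>2) = (\<Sum>i\<in>I. (h (x i))\<^sup>2 - ?c h) + k * ?c h"
          by (simp add: sum_subtractf k_def)
        also have "\<dots> \<le> D x + k * r\<^sup>2"
        proof (rule add_mono)
          show "(\<Sum>i\<in>I. (h (x i))\<^sup>2 - ?c h) \<le> D x"
            using MAX_ge[OF G(1) h(1), of "\<lambda>h. \<bar>\<Sum>i\<in>I. (h (x i))\<^sup>2 - ?c h\<bar>"] by (simp add: D_def)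
          show "k * ?c h \<le> k * r\<^sup>2" using k rad[OF h(1)] by (intro mult_left_mono) auto
        qed
        also have "\<dots> = k * v x" using k by (simp add: v_def distrib_left)
        finally show ?thesis by (simp add: k_def)
      qed
      moreover have "\<sigma>\<^sup>2 = min 1 (v x)"
        using v0 by (auto simp: \<sigma>_def min_def real_le_lsqrt)
      ultimately show "(\<Sum>i\<in>I. (t i)\<^sup>2) \<le> real (card I) * \<sigma>\<^sup>2"
        by (simp add: h(2) min_def)
    qed (use G ne in auto)
    also have "\<sigma> powr (1 - \<alpha> / 2) \<le> v x powr \<theta>"
    proof -
      have "\<sigma> powr (1 - \<alpha> / 2) \<le> sqrt (v x) powr (1 - \<alpha> / 2)"
        using \<sigma> \<alpha> by (intro powr_mono2) (auto simp: \<sigma>_def)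
      also have "\<dots> = v x powr (1 / 2 * (1 - \<alpha> / 2))"
        using v0 by (simp only: powr_half_sqrt[symmetric] less_imp_le powr_powr)
      also have "1 / 2 * (1 - \<alpha> / 2) = \<theta>" by (simp add: \<theta>_def)
      finally show ?thesis .
    qed
    also have "v x powr \<theta> \<le> b powr \<theta> * (1 + v x / b)"
      using v0 b \<theta> by (intro powr_le_affine) auto
    finally show ?thesis using K k by (simp add: k_def mult_left_mono)
  qed
  have intv: "integrable (iid I M) v"
    unfolding v_def[abs_def] using intD by simp
  have Ev: "(\<integral>x. v x \<partial>iid I M) \<le> b"
  proof -
    have "(\<integral>x. v x \<partial>iid I M) = r\<^sup>2 + (\<integral>x. D x \<partial>iid I M) / k"
      unfolding v_def[abs_def] using intD by (simp add: PI.prob_space)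
    also have "\<dots> \<le> r\<^sup>2 + (8 * \<psi> + 4 * r\<^sup>2 * k) / k"
      using ED k by (intro add_left_mono divide_right_mono) auto
    also have "\<dots> = b" using k by (simp add: b_def add_divide_distrib)
    finally show ?thesis .
  qed
  have "\<psi> \<le> (\<integral>x. K * sqrt k * (b powr \<theta> * (1 + v x / b)) \<partial>iid I M)"
    unfolding \<psi>_def rad_complexity_def
    using rad_complexity_eq(2)[OF G(1) ne(1) GL] intv pointwise by (intro integral_mono) auto
  also have "\<dots> = K * sqrt k * (b powr \<theta> * (1 + (\<integral>x. v x \<partial>iid I M) / b))"
    using intv by (simp add: PI.prob_space)
  also have "\<dots> \<le> K * sqrt k * (b powr \<theta> * (1 + 1))"
    using Ev b K k by (intro mult_left_mono add_left_mono) auto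
  finally show ?thesis
    by (simp add: \<psi>_def b_def k_def \<theta>_def mult_ac)
qed

lemma local_complexity_bound_uniform:
  assumes "uniform_entropy M H \<alpha> C" "0 < \<alpha>" "\<alpha> < 2" "0 \<le> C" "countable H" "H \<subseteq> Linf_unit M"
  shows "\<exists>K\<ge>0. local_complexity_bound M H \<alpha> K"
proof -
  define K where "K = (2 * C + 11) / (1 - 2 powr (- (1 - \<alpha> / 2))) + 1"
  have "2 powr (- (1 - \<alpha> / 2)) < (1::real)" using assms by (simp add: powr_less_one)
  then have K: "1 \<le> 2 * K" using assms by (simp add: K_def)
  have "local_complexity_bound M H \<alpha> ((48 * (2 * K))\<^sup>2)"
    unfolding local_complexity_bound_def
  proof (intro allI impI)
    fix I :: "nat set" and G and r :: real
    assume *: "finite I" "I \<noteq> {}" "finite G" "G \<subseteq> H" "(\<lambda>_. 0) \<in> G" "0 < r" "r \<le> 1"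
      "\<forall>h\<in>G. (\<integral>x. (h x)\<^sup>2 \<partial>M) \<le> r\<^sup>2"
    show "rad_complexity M I G \<le> (48 * (2 * K))\<^sup>2 *
        (sqrt (real (card I)) * r powr (1 - \<alpha> / 2) + real (card I) powr (\<alpha> / (2 + \<alpha>)))"
    proof (rule self_bounding_solve[OF _ *(6) _ K assms(2,3)])
      show "0 \<le> rad_complexity M I G" using * by (intro rad_complexity_nonneg) auto
      show "1 \<le> real (card I)" using * by (simp add: Suc_leI card_gt_0_iff)
      show "rad_complexity M I G \<le> 2 * K * sqrt (real (card I)) *
          (5 * r\<^sup>2 + 8 * rad_complexity M I G / real (card I)) powr ((2 - \<alpha>) / 4)"
        unfolding K_def using * by (intro local_complexity_bound_uniform_aux[OF assms]) auto
    qed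
  qed
  then show ?thesis by (intro exI[of _ "(48 * (2 * K))\<^sup>2"]) auto
qed

end

section \<open>Chaining with brackets\<close>

text \<open>A sequence \<open>c\<close> of brackets, one for each scale, is combined into nested brackets, which are
  moreover confined to the unit interval. Level \<open>j\<close> only depends on the brackets up to \<open>j\<close>.\<close>

primrec nested_lo :: "nat \<Rightarrow> (nat \<Rightarrow> ('x \<Rightarrow> real) \<times> ('x \<Rightarrow> real)) \<Rightarrow> 'x \<Rightarrow> real" where
  "nested_lo 0 c x = max (-1) (fst (c 0) x)"
| "nested_lo (Suc j) c x = max (nested_lo j c x) (fst (c (Suc j)) x)"

primrec nested_up :: "nat \<Rightarrow> (nat \<Rightarrow> ('x \<Rightarrow> real) \<times> ('x \<Rightarrow> real)) \<Rightarrow> 'x \<Rightarrow> real" where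
  "nested_up 0 c x = min 1 (snd (c 0) x)"
| "nested_up (Suc j) c x = min (nested_up j c x) (snd (c (Suc j)) x)"

definition gap :: "nat \<Rightarrow> (nat \<Rightarrow> ('x \<Rightarrow> real) \<times> ('x \<Rightarrow> real)) \<Rightarrow> 'x \<Rightarrow> real" where
  "gap j c x = nested_up j c x - nested_lo j c x"

definition narrow :: "(nat \<Rightarrow> real) \<Rightarrow> nat \<Rightarrow> (nat \<Rightarrow> ('x \<Rightarrow> real) \<times> ('x \<Rightarrow> real)) \<Rightarrow> 'x \<Rightarrow> bool" where
  "narrow \<tau> j c x \<longleftrightarrow> (\<forall>i\<le>j. gap i c x \<le> \<tau> i)"

text \<open>At a point where the brackets have stayed narrow, the chain proceeds by \<open>chain_link\<close>; where the
  bracket of the next level is too wide it stops with the error \<open>chain_stop\<close>; \<open>chain_rest\<close> is the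
  error where it never stops.\<close>

definition chain_link :: "(nat \<Rightarrow> real) \<Rightarrow> nat \<Rightarrow> (nat \<Rightarrow> ('x \<Rightarrow> real) \<times> ('x \<Rightarrow> real)) \<Rightarrow> 'x \<Rightarrow> real" where
  "chain_link \<tau> j c x = (if narrow \<tau> j c x then nested_lo (Suc j) c x - nested_lo j c x else 0)"

definition chain_stop :: "(nat \<Rightarrow> real) \<Rightarrow> nat \<Rightarrow> (nat \<Rightarrow> ('x \<Rightarrow> real) \<times> ('x \<Rightarrow> real)) \<Rightarrow> 'x \<Rightarrow> real" where
  "chain_stop \<tau> j c x = (if narrow \<tau> j c x \<and> \<tau> (Suc j) < gap (Suc j) c x then gap (Suc j) c x else 0)"

definition chain_rest :: "(nat \<Rightarrow> real) \<Rightarrow> nat \<Rightarrow> (nat \<Rightarrow> ('x \<Rightarrow> real) \<times> ('x \<Rightarrow> real)) \<Rightarrow> 'x \<Rightarrow> real" where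
  "chain_rest \<tau> j c x = (if narrow \<tau> j c x then gap j c x else 0)"

lemma nested_cong:
  assumes "\<And>i. i \<le> j \<Longrightarrow> c i = c' i"
  shows "nested_lo j c = nested_lo j c'" "nested_up j c = nested_up j c'"
  using assms by (induction j) (auto simp: fun_eq_iff)

lemma gap_cong: "(\<And>i. i \<le> j \<Longrightarrow> c i = c' i) \<Longrightarrow> gap j c = gap j c'"
  using nested_cong[of j c c'] by (simp add: gap_def fun_eq_iff)

lemma narrow_cong:
  assumes "\<And>i. i \<le> j \<Longrightarrow> c i = c' i" shows "narrow \<tau> j c = narrow \<tau> j c'"
proof -
  have "gap i c = gap i c'" if "i \<le> j" for i using that assms by (intro gap_cong) auto
  then show ?thesis by (auto simp: narrow_def fun_eq_iff)
qed

lemma narrow_Suc: "narrow \<tau> (Suc j) c x \<longleftrightarrow> narrow \<tau> j c x \<and> gap (Suc j) c x \<le> \<tau> (Suc j)"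
  by (auto simp: narrow_def le_Suc_eq)

lemma chain_cong:
  assumes "\<And>i. i \<le> Suc j \<Longrightarrow> c i = c' i"
  shows "chain_link \<tau> j c = chain_link \<tau> j c'" "chain_stop \<tau> j c = chain_stop \<tau> j c'"
proof -
  have eq: "narrow \<tau> j c = narrow \<tau> j c'" "gap (Suc j) c = gap (Suc j) c'"
    "nested_lo (Suc j) c = nested_lo (Suc j) c'" "nested_lo j c = nested_lo j c'"
    using assms by (intro narrow_cong gap_cong nested_cong; simp)+
  show "chain_link \<tau> j c = chain_link \<tau> j c'" "chain_stop \<tau> j c = chain_stop \<tau> j c'"
    by ((rule ext, simp only: chain_link_def chain_stop_def eq)+)
qed

lemma chain_rest_cong:
  assumes "\<And>i. i \<le> j \<Longrightarrow> c i = c' i"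
  shows "chain_rest \<tau> j c = chain_rest \<tau> j c'"
proof -
  have eq: "narrow \<tau> j c = narrow \<tau> j c'" "gap j c = gap j c'"
    using assms by (intro narrow_cong gap_cong; simp)+
  show ?thesis by (rule ext) (simp only: chain_rest_def eq)
qed

text \<open>A quantity that only depends on the brackets up to level \<open>j\<close> takes at most as many values as
  there are choices of these brackets.\<close>

lemma card_image_prefix_le:
  fixes br :: "'h \<Rightarrow> nat \<Rightarrow> 'b" and j :: nat
  assumes "finite G" "\<And>i. finite (B i)" "\<And>i h. h \<in> G \<Longrightarrow> br h i \<in> B i"
    and cong: "\<And>c c'. (\<And>i. i \<le> j \<Longrightarrow> c i = c' i) \<Longrightarrow> f c = f c'"
  shows "card ((\<lambda>h. f (br h)) ` G) \<le> (\<Prod>i\<le>j. card (B i))"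
proof -
  have "f (br h) = f (restrict (br h) {..j})" for h by (rule cong) simp
  then have "(\<lambda>h. f (br h)) ` G = f ` ((\<lambda>h. restrict (br h) {..j}) ` G)"
    by (simp add: image_image)
  also have "card \<dots> \<le> card ((\<lambda>h. restrict (br h) {..j}) ` G)"
    using assms(1) by (intro card_image_le) auto
  also have "\<dots> \<le> card (PiE {..j} B)"
    using assms(2,3) by (intro card_mono finite_PiE finite_atMost)
      (auto simp: restrict_PiE_iff split: if_splits)
  also have "\<dots> = (\<Prod>i\<le>j. card (B i))" by (simp add: card_PiE)
  finally show ?thesis .
qed

text \<open>One function with its brackets of \<open>L\<^sub>2\<close> size \<open>a j\<close>. Confined to the unit interval, a bracket has
  width at most 2, so that \<open>2 \<le> \<tau> 0\<close> keeps every chain running at the coarsest level.\<close>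

locale bracket_chain = prob_space +
  fixes c :: "nat \<Rightarrow> ('a \<Rightarrow> real) \<times> ('a \<Rightarrow> real)" and h :: "'a \<Rightarrow> real"
    and a \<tau> :: "nat \<Rightarrow> real"
  assumes h_unit: "h \<in> Linf_unit M"
    and lo_le: "\<And>j x. x \<in> space M \<Longrightarrow> fst (c j) x \<le> h x"
    and le_up: "\<And>j x. x \<in> space M \<Longrightarrow> h x \<le> snd (c j) x"
    and L2_lo: "\<And>j. fst (c j) \<in> L2_space M" and L2_up: "\<And>j. snd (c j) \<in> L2_space M"
    and size: "\<And>j. L2_norm M (\<lambda>x. snd (c j) x - fst (c j) x) < a j"
    and a_pos: "\<And>j. 0 < a j" and \<tau>_pos: "\<And>j. 0 < \<tau> j" and \<tau>_0: "2 \<le> \<tau> 0"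
begin

lemma nested_bounds:
  assumes "x \<in> space M"
  shows "-1 \<le> nested_lo j c x" "nested_lo j c x \<le> h x" "h x \<le> nested_up j c x" "nested_up j c x \<le> 1"
  using lo_le[OF assms] le_up[OF assms] Linf_unitD(2)[OF h_unit assms]
  by (induction j) (auto simp: abs_le_iff)

lemma lo_mono: "nested_lo j c x \<le> nested_lo (Suc j) c x"
  by simp

lemma gap_bounds:
  assumes "x \<in> space M"
  shows "0 \<le> gap j c x" "gap j c x \<le> 2" "gap (Suc j) c x \<le> gap j c x"
    "gap j c x \<le> snd (c j) x - fst (c j) x"
  using nested_bounds[OF assms, of j] nested_bounds[OF assms, of "Suc j"]
  by (auto simp: gap_def) (cases j; auto)

lemma measurable_nested [measurable]:
  "nested_lo j c \<in> borel_measurable M" "nested_up j c \<in> borel_measurable M"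
proof -
  have [measurable]: "fst (c i) \<in> borel_measurable M" "snd (c i) \<in> borel_measurable M" for i
    using L2_lo[of i] L2_up[of i] by (auto simp: L2_space_def)
  have "nested_lo 0 c = (\<lambda>x. max (-1) (fst (c 0) x))" "nested_up 0 c = (\<lambda>x. min 1 (snd (c 0) x))"
    "nested_lo (Suc i) c = (\<lambda>x. max (nested_lo i c x) (fst (c (Suc i)) x))"
    "nested_up (Suc i) c = (\<lambda>x. min (nested_up i c x) (snd (c (Suc i)) x))" for i
    by (auto simp: fun_eq_iff)
  then show "nested_lo j c \<in> borel_measurable M" "nested_up j c \<in> borel_measurable M"
    by (induction j) auto
qed

lemma measurable_gap [measurable]: "gap j c \<in> borel_measurable M"
  unfolding gap_def[abs_def] by measurable

lemma measurable_narrow [measurable]: "Measurable.pred M (narrow \<tau> j c)"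
  unfolding narrow_def[abs_def] by measurable

lemma measurable_chain [measurable]:
  "chain_link \<tau> j c \<in> borel_measurable M" "chain_stop \<tau> j c \<in> borel_measurable M"
  "chain_rest \<tau> j c \<in> borel_measurable M"
  unfolding chain_link_def[abs_def] chain_stop_def[abs_def] chain_rest_def[abs_def] by measurable

lemma integrable_gap_square: "integrable M (\<lambda>x. (gap j c x)\<^sup>2)"
  using gap_bounds by (intro integrable_bounded[where b=4]) (auto intro: power_mono[of _ 2 2, simplified])

lemma integral_gap_square: "(\<integral>x. (gap j c x)\<^sup>2 \<partial>M) \<le> (a j)\<^sup>2"
proof -
  let ?d = "\<lambda>x. snd (c j) x - fst (c j) x"
  have L2: "fst (c j) \<in> borel_measurable M" "snd (c j) \<in> borel_measurable M"
    "integrable M (\<lambda>x. (fst (c j) x)\<^sup>2)" "integrable M (\<lambda>x. (snd (c j) x)\<^sup>2)"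
    using L2_lo[of j] L2_up[of j] by (auto simp: L2_space_def)
  have int: "integrable M (\<lambda>x. (?d x)\<^sup>2)"
  proof (rule Bochner_Integration.integrable_bound)
    show "integrable M (\<lambda>x. 2 * (snd (c j) x)\<^sup>2 + 2 * (fst (c j) x)\<^sup>2)"
      using L2 by simp
    have "(p - q)\<^sup>2 \<le> 2 * p\<^sup>2 + 2 * q\<^sup>2" for p q :: real
      using zero_le_power2[of "p + q"] by (simp add: power2_eq_square algebra_simps)
    then show "AE x in M. norm ((?d x)\<^sup>2) \<le> norm (2 * (snd (c j) x)\<^sup>2 + 2 * (fst (c j) x)\<^sup>2)"
      by simp
  qed (use L2 in measurable)
  have "sqrt (\<integral>x. (?d x)\<^sup>2 \<partial>M) \<le> a j" using size[of j] by (simp add: L2_norm_def)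
  then have "(\<integral>x. (?d x)\<^sup>2 \<partial>M) \<le> (a j)\<^sup>2" by (rule sqrt_le_D)
  moreover have "(\<integral>x. (gap j c x)\<^sup>2 \<partial>M) \<le> (\<integral>x. (?d x)\<^sup>2 \<partial>M)"
    using gap_bounds by (intro integral_mono integrable_gap_square int power_mono) auto
  ultimately show ?thesis by linarith
qed

lemma start_bounds:
  assumes "(\<integral>x. (h x)\<^sup>2 \<partial>M) \<le> (a 0)\<^sup>2"
  shows "(\<integral>x. (nested_lo 0 c x)\<^sup>2 \<partial>M) \<le> 4 * (a 0)\<^sup>2"
    and "x \<in> space M \<Longrightarrow> \<bar>nested_lo 0 c x\<bar> \<le> 1"
proof -
  show b: "\<bar>nested_lo 0 c x\<bar> \<le> 1" if "x \<in> space M" for x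
    using nested_bounds[OF that, of 0] by (auto simp: abs_le_iff simp del: nested_lo.simps nested_up.simps)
  have pw: "(nested_lo 0 c x)\<^sup>2 \<le> 2 * (h x)\<^sup>2 + 2 * (gap 0 c x)\<^sup>2" if "x \<in> space M" for x
  proof -
    have "(nested_lo 0 c x)\<^sup>2 = (h x - (h x - nested_lo 0 c x))\<^sup>2" by simp
    also have "\<dots> \<le> 2 * (h x)\<^sup>2 + 2 * (h x - nested_lo 0 c x)\<^sup>2"
      using zero_le_power2[of "h x + (h x - nested_lo 0 c x)"]
      by (simp add: power2_eq_square algebra_simps)
    also have "(h x - nested_lo 0 c x)\<^sup>2 \<le> (gap 0 c x)\<^sup>2"
      using nested_bounds[OF that, of 0] unfolding gap_def by (intro power_mono) linarith+
    finally show ?thesis by simp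
  qed
  have "(\<integral>x. (nested_lo 0 c x)\<^sup>2 \<partial>M) \<le> (\<integral>x. 2 * (h x)\<^sup>2 + 2 * (gap 0 c x)\<^sup>2 \<partial>M)"
  proof (rule integral_mono[OF _ _ pw])
    show "integrable M (\<lambda>x. (nested_lo 0 c x)\<^sup>2)"
      using b by (intro integrable_bounded[where b=1]) (auto simp: abs_square_le_1 simp del: nested_lo.simps)
    show "integrable M (\<lambda>x. 2 * (h x)\<^sup>2 + 2 * (gap 0 c x)\<^sup>2)"
      using integrable_gap_square integrable_Linf_unit[OF h_unit] by simp
  qed
  also have "\<dots> = 2 * (\<integral>x. (h x)\<^sup>2 \<partial>M) + 2 * (\<integral>x. (gap 0 c x)\<^sup>2 \<partial>M)"
    using integrable_gap_square integrable_Linf_unit[OF h_unit] by simp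
  also have "\<dots> \<le> 4 * (a 0)\<^sup>2" using assms integral_gap_square[of 0] by simp
  finally show "(\<integral>x. (nested_lo 0 c x)\<^sup>2 \<partial>M) \<le> 4 * (a 0)\<^sup>2" .
qed

lemma link_bounds:
  shows "x \<in> space M \<Longrightarrow> \<bar>chain_link \<tau> j c x\<bar> \<le> \<tau> j" and "(\<integral>x. (chain_link \<tau> j c x)\<^sup>2 \<partial>M) \<le> (a j)\<^sup>2"
proof -
  have le: "\<bar>chain_link \<tau> j c x\<bar> \<le> gap j c x" if "x \<in> space M" for x
    using nested_bounds[OF that, of j] nested_bounds[OF that, of "Suc j"] lo_mono[of j x]
    unfolding chain_link_def gap_def by auto
  show b: "\<bar>chain_link \<tau> j c x\<bar> \<le> \<tau> j" if "x \<in> space M" for x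
    using le[OF that] \<tau>_pos[of j] unfolding chain_link_def narrow_def by (auto split: if_splits)
  have "(\<integral>x. (chain_link \<tau> j c x)\<^sup>2 \<partial>M) \<le> (\<integral>x. (gap j c x)\<^sup>2 \<partial>M)"
  proof (rule integral_mono[OF _ integrable_gap_square])
    show "integrable M (\<lambda>x. (chain_link \<tau> j c x)\<^sup>2)"
      using b \<tau>_pos[of j] by (intro integrable_bounded[where b="(\<tau> j)\<^sup>2"]) (auto simp flip: abs_le_square_iff)
    show "(chain_link \<tau> j c x)\<^sup>2 \<le> (gap j c x)\<^sup>2" if "x \<in> space M" for x
      using le[OF that] gap_bounds(1)[OF that, of j] by (simp flip: abs_le_square_iff)
  qed
  then show "(\<integral>x. (chain_link \<tau> j c x)\<^sup>2 \<partial>M) \<le> (a j)\<^sup>2"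
    using integral_gap_square[of j] by linarith
qed

text \<open>A chain that stops has a bracket wider than \<open>\<tau>\<close>, so its width is at most its square divided by
  \<open>\<tau>\<close>: the mean of the error is controlled by the \<open>L\<^sub>2\<close> size.\<close>

lemma stop_bounds:
  shows "x \<in> space M \<Longrightarrow> 0 \<le> chain_stop \<tau> j c x \<and> chain_stop \<tau> j c x \<le> \<tau> j"
    and "(\<integral>x. chain_stop \<tau> j c x \<partial>M) \<le> (a (Suc j))\<^sup>2 / \<tau> (Suc j)"
proof -
  show b: "0 \<le> chain_stop \<tau> j c x \<and> chain_stop \<tau> j c x \<le> \<tau> j" if "x \<in> space M" for x
    using gap_bounds(1,3)[OF that] \<tau>_pos[of j] unfolding chain_stop_def narrow_def
    by (auto intro: order_trans)
  have "(\<integral>x. chain_stop \<tau> j c x \<partial>M) \<le> (\<integral>x. (gap (Suc j) c x)\<^sup>2 / \<tau> (Suc j) \<partial>M)"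
  proof (rule integral_mono)
    show "integrable M (chain_stop \<tau> j c)"
      using b by (intro integrable_bounded[where b="\<tau> j"]) auto
    show "integrable M (\<lambda>x. (gap (Suc j) c x)\<^sup>2 / \<tau> (Suc j))"
      using integrable_gap_square by simp
    fix x assume x: "x \<in> space M"
    have "gap (Suc j) c x * \<tau> (Suc j) \<le> (gap (Suc j) c x)\<^sup>2" if "\<tau> (Suc j) < gap (Suc j) c x"
      using that gap_bounds(1)[OF x, of "Suc j"] unfolding power2_eq_square by (intro mult_left_mono) auto
    then show "chain_stop \<tau> j c x \<le> (gap (Suc j) c x)\<^sup>2 / \<tau> (Suc j)"
      using \<tau>_pos[of "Suc j"] by (auto simp: chain_stop_def le_divide_eq)
  qed
  also have "\<dots> = (\<integral>x. (gap (Suc j) c x)\<^sup>2 \<partial>M) / \<tau> (Suc j)" by simp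
  also have "\<dots> \<le> (a (Suc j))\<^sup>2 / \<tau> (Suc j)"
    using integral_gap_square \<tau>_pos[of "Suc j"] by (intro divide_right_mono) auto
  finally show "(\<integral>x. chain_stop \<tau> j c x \<partial>M) \<le> (a (Suc j))\<^sup>2 / \<tau> (Suc j)" .
qed

lemma rest_bounds:
  shows "x \<in> space M \<Longrightarrow> 0 \<le> chain_rest \<tau> j c x \<and> chain_rest \<tau> j c x \<le> \<tau> j"
    and "(\<integral>x. chain_rest \<tau> j c x \<partial>M) \<le> a j"
proof -
  show b: "0 \<le> chain_rest \<tau> j c x \<and> chain_rest \<tau> j c x \<le> \<tau> j" if "x \<in> space M" for x
    using gap_bounds(1)[OF that] \<tau>_pos[of j] unfolding chain_rest_def narrow_def by auto
  have "(\<integral>x. chain_rest \<tau> j c x \<partial>M) \<le> (\<integral>x. (gap j c x)\<^sup>2 / (2 * a j) + a j / 2 \<partial>M)"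
  proof (rule integral_mono)
    show "integrable M (chain_rest \<tau> j c)"
      using b by (intro integrable_bounded[where b="\<tau> j"]) auto
    show "integrable M (\<lambda>x. (gap j c x)\<^sup>2 / (2 * a j) + a j / 2)"
      using integrable_gap_square by simp
    fix x assume x: "x \<in> space M"
    have "gap j c x \<le> (gap j c x)\<^sup>2 / (2 * a j) + a j / 2"
      using zero_le_power2[of "gap j c x - a j"] a_pos[of j]
      by (simp add: field_simps power2_eq_square)
    moreover have "chain_rest \<tau> j c x \<le> gap j c x"
      using gap_bounds(1)[OF x, of j] by (simp add: chain_rest_def)
    ultimately show "chain_rest \<tau> j c x \<le> (gap j c x)\<^sup>2 / (2 * a j) + a j / 2" by linarith
  qed
  also have "\<dots> = (\<integral>x. (gap j c x)\<^sup>2 \<partial>M) / (2 * a j) + a j / 2"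
    using integrable_gap_square by (simp add: prob_space)
  also have "\<dots> \<le> (a j)\<^sup>2 / (2 * a j) + a j / 2"
    using integral_gap_square[of j] a_pos[of j] by (intro add_right_mono divide_right_mono) auto
  also have "\<dots> = a j" using a_pos[of j] by (simp add: power2_eq_square)
  finally show "(\<integral>x. chain_rest \<tau> j c x \<partial>M) \<le> a j" .
qed

text \<open>Unrolling the chain up to level \<open>J\<close>. The errors enter without a sign, the links with one.\<close>

lemma chain_decomposition:
  assumes x: "x \<in> space M"
  shows "\<exists>e. \<bar>e\<bar> \<le> (\<Sum>j<J. chain_stop \<tau> j c x) + chain_rest \<tau> J c x \<and>
    h x = nested_lo 0 c x + (\<Sum>j<J. chain_link \<tau> j c x) + e"
proof -
  define R where "R j = (if narrow \<tau> j c x then h x - nested_lo j c x else 0)" for j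
  define E where "E j = (if narrow \<tau> j c x \<and> \<tau> (Suc j) < gap (Suc j) c x then h x - nested_lo (Suc j) c x else 0)" for j
  have unroll: "R j = chain_link \<tau> j c x + E j + R (Suc j)" for j
    by (cases "narrow \<tau> j c x"; cases "gap (Suc j) c x \<le> \<tau> (Suc j)")
      (simp_all add: R_def E_def chain_link_def narrow_Suc del: nested_lo.simps)
  have step: "chain_link \<tau> j c x + E j = R j - R (Suc j)" for j
    using unroll[of j] by linarith
  have "(\<Sum>j<J. chain_link \<tau> j c x + E j) = R 0 - R J"
    unfolding step by (rule sum_lessThan_telescope')
  moreover have "R 0 = h x - nested_lo 0 c x"
    using gap_bounds(2)[OF x, of 0] \<tau>_0 by (simp add: R_def narrow_def)
  ultimately have eq: "h x = nested_lo 0 c x + (\<Sum>j<J. chain_link \<tau> j c x) + ((\<Sum>j<J. E j) + R J)"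
    by (simp add: sum.distrib)
  have "\<bar>E j\<bar> \<le> chain_stop \<tau> j c x" for j
    using nested_bounds[OF x, of "Suc j"] unfolding E_def chain_stop_def gap_def by auto
  then have "\<bar>\<Sum>j<J. E j\<bar> \<le> (\<Sum>j<J. chain_stop \<tau> j c x)"
    by (intro order_trans[OF sum_abs] sum_mono)
  moreover have "\<bar>R J\<bar> \<le> chain_rest \<tau> J c x"
    using nested_bounds[OF x, of J] unfolding R_def chain_rest_def gap_def by auto
  ultimately have "\<bar>(\<Sum>j<J. E j) + R J\<bar> \<le> (\<Sum>j<J. chain_stop \<tau> j c x) + chain_rest \<tau> J c x"
    by linarith
  with eq show ?thesis by blast
qed

lemma signed_sum_chain:
  assumes x: "\<And>i. i \<in> I \<Longrightarrow> x i \<in> space M"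
  shows "\<bar>\<Sum>i\<in>I. signs A i * h (x i)\<bar> \<le> \<bar>\<Sum>i\<in>I. signs A i * nested_lo 0 c (x i)\<bar>
    + (\<Sum>j<J. \<bar>\<Sum>i\<in>I. signs A i * chain_link \<tau> j c (x i)\<bar>)
    + (\<Sum>j<J. \<Sum>i\<in>I. chain_stop \<tau> j c (x i)) + (\<Sum>i\<in>I. chain_rest \<tau> J c (x i))"
proof -
  define e where "e i = h (x i) - nested_lo 0 c (x i) - (\<Sum>j<J. chain_link \<tau> j c (x i))" for i
  have e: "\<bar>e i\<bar> \<le> (\<Sum>j<J. chain_stop \<tau> j c (x i)) + chain_rest \<tau> J c (x i)" if "i \<in> I" for i
    using chain_decomposition[OF x[OF that], of J] by (auto simp: e_def)
  have "h (x i) = nested_lo 0 c (x i) + (\<Sum>j<J. chain_link \<tau> j c (x i)) + e i" for i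
    by (simp add: e_def)
  then have "(\<Sum>i\<in>I. signs A i * h (x i)) = (\<Sum>i\<in>I. signs A i * nested_lo 0 c (x i))
      + (\<Sum>i\<in>I. \<Sum>j<J. signs A i * chain_link \<tau> j c (x i)) + (\<Sum>i\<in>I. signs A i * e i)"
    by (simp only: distrib_left sum.distrib sum_distrib_left)
  also have "(\<Sum>i\<in>I. \<Sum>j<J. signs A i * chain_link \<tau> j c (x i))
      = (\<Sum>j<J. \<Sum>i\<in>I. signs A i * chain_link \<tau> j c (x i))" by (rule sum.swap)
  also have "\<bar>(\<Sum>i\<in>I. signs A i * nested_lo 0 c (x i)) + \<dots> + (\<Sum>i\<in>I. signs A i * e i)\<bar>
      \<le> \<bar>\<Sum>i\<in>I. signs A i * nested_lo 0 c (x i)\<bar>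
        + \<bar>\<Sum>j<J. \<Sum>i\<in>I. signs A i * chain_link \<tau> j c (x i)\<bar> + \<bar>\<Sum>i\<in>I. signs A i * e i\<bar>"
    by (intro order_trans[OF abs_triangle_ineq] add_right_mono abs_triangle_ineq)
  also have "\<dots> \<le> \<bar>\<Sum>i\<in>I. signs A i * nested_lo 0 c (x i)\<bar>
        + (\<Sum>j<J. \<bar>\<Sum>i\<in>I. signs A i * chain_link \<tau> j c (x i)\<bar>)
        + (\<Sum>i\<in>I. (\<Sum>j<J. chain_stop \<tau> j c (x i)) + chain_rest \<tau> J c (x i))"
    using e by (intro add_mono order_refl sum_abs order_trans[OF sum_abs] sum_mono) (simp add: abs_mult)
  also have "(\<Sum>i\<in>I. (\<Sum>j<J. chain_stop \<tau> j c (x i)) + chain_rest \<tau> J c (x i))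
      = (\<Sum>j<J. \<Sum>i\<in>I. chain_stop \<tau> j c (x i)) + (\<Sum>i\<in>I. chain_rest \<tau> J c (x i))"
    by (simp add: sum.distrib sum.swap[of _ "{..<J}"])
  finally show ?thesis by simp
qed

end

lemma bracketing_entropyE:
  assumes "bracketing_entropy P H \<alpha> C" "0 < \<epsilon>"
  shows "\<exists>B. finite B \<and> real (card B) \<le> exp (C * \<epsilon> powr (-\<alpha>)) \<and>
    (\<forall>b\<in>B. fst b \<in> L2_space P \<and> snd b \<in> L2_space P \<and> L2_norm P (\<lambda>x. snd b x - fst b x) < \<epsilon>) \<and>
    (\<forall>h\<in>H. \<exists>b\<in>B. \<forall>x\<in>space P. fst b x \<le> h x \<and> h x \<le> snd b x)"
proof -
  have "ln_enat (bracketing_number P H \<epsilon>) \<le> ereal (C * \<epsilon> powr (-\<alpha>))"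
    using assms by (simp add: bracketing_entropy_def)
  from ln_enat_INF_le[OF this[unfolded bracketing_number_def]] show ?thesis
    by (fastforce simp: case_prod_beta)
qed

text \<open>The next two lemmas evaluate the two terms of the maximal inequality for the uniform bound
  \<open>2 * S * a powr (1 + \<alpha> / 2)\<close>, \<open>S = sqrt k\<close>, and the entropy \<open>E * a powr -\<alpha>\<close>: both have the order
  \<open>S * a powr (1 - \<alpha> / 2)\<close>.\<close>

lemma chain_threshold_le:
  fixes a S E \<alpha> :: real
  assumes "0 < a" "a \<le> 1" "0 \<le> S" "0 \<le> \<alpha>"
  shows "(2 * S * a powr (1 + \<alpha> / 2)) * (E * a powr (-\<alpha>) + 1) \<le> S * a powr (1 - \<alpha> / 2) * (2 * E + 2)"
proof -
  have "a powr (1 + \<alpha> / 2) * a powr (-\<alpha>) = a powr (1 - \<alpha> / 2)"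
    unfolding powr_add[symmetric] by simp
  moreover have "a powr (1 + \<alpha> / 2) \<le> a powr (1 - \<alpha> / 2)"
    using assms by (intro powr_mono') auto
  then have "2 * S * a powr (1 + \<alpha> / 2) \<le> 2 * S * a powr (1 - \<alpha> / 2)"
    using assms by (intro mult_left_mono) auto
  ultimately show ?thesis by (simp add: algebra_simps)
qed

lemma chain_threshold_divide:
  fixes a S \<alpha> :: real
  assumes "0 < a" "0 < S"
  shows "S\<^sup>2 * a\<^sup>2 / (2 * S * a powr (1 + \<alpha> / 2)) = S * a powr (1 - \<alpha> / 2) / 2"
proof -
  have "a\<^sup>2 = a powr 2" using assms by simp
  then have "a\<^sup>2 / a powr (1 + \<alpha> / 2) = a powr (1 - \<alpha> / 2)"
    by (simp only: powr_diff[symmetric]) simp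
  moreover have "S\<^sup>2 * a\<^sup>2 / (2 * S * a powr (1 + \<alpha> / 2)) = S * (a\<^sup>2 / a powr (1 + \<alpha> / 2)) / 2"
    using assms by (simp add: power2_eq_square)
  ultimately show ?thesis by simp
qed

context prob_space
begin

text \<open>Ossiander's chaining argument with brackets. The threshold \<open>\<tau> j\<close> balances the two terms of the
  maximal inequality for bounded summands, and the assumed lower bound on \<open>r\<close> says that no chain
  stops at the coarsest level.\<close>

lemma rad_complexity_bracketing:
  fixes I :: "nat set"
  assumes ent: "bracketing_entropy M H \<alpha> C" and \<alpha>: "0 < \<alpha>" "\<alpha> < 2" and C: "0 \<le> C"
    and H: "H \<subseteq> Linf_unit M" and I: "finite I" and G: "finite G" "G \<noteq> {}" "G \<subseteq> H"
    and r: "0 < r" "r \<le> 1" "1 \<le> sqrt (real (card I)) * r powr (1 + \<alpha> / 2)"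
    and rad: "\<And>h. h \<in> G \<Longrightarrow> (\<integral>x. (h x)\<^sup>2 \<partial>M) \<le> r\<^sup>2"
  defines "D \<equiv> C * (2 powr \<alpha> / (2 powr \<alpha> - 1))"
  shows "rad_complexity M I G \<le> (D + 5 + (16 * D + 6) / (1 - 2 powr (- (1 - \<alpha> / 2))) + (2 * D + 4))
      * (sqrt (real (card I)) * r powr (1 - \<alpha> / 2))"
proof -
  define S where "S = sqrt (real (card I))"
  define a where "a j = r / 2 ^ j" for j :: nat
  define \<beta> where "\<beta> = 1 - \<alpha> / 2"
  define \<tau> where "\<tau> j = 2 * S * a j powr (1 + \<alpha> / 2)" for j
  have \<beta>: "0 < \<beta>" using \<alpha> by (simp add: \<beta>_def)
  have S0: "0 \<le> S" by (simp add: S_def)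
  have S: "0 < S"
    using r(3) S0 by (cases "S = 0") (auto simp flip: S_def)
  have S2: "real (card I) = S\<^sup>2" by (simp add: S_def)
  have a: "0 < a j" "a j \<le> 1" "a j \<le> r" for j
  proof -
    show "0 < a j" using r by (simp add: a_def)
    have "r / 2 ^ j \<le> r / 1" using r by (intro divide_left_mono) auto
    then show "a j \<le> r" by (simp add: a_def)
    then show "a j \<le> 1" using r by simp
  qed
  have a0: "a 0 = r" by (simp add: a_def)
  have aS: "a (Suc j) \<le> a j" for j using r by (simp add: a_def field_simps)
  have \<tau>: "0 < \<tau> j" for j using S a(1)[of j] by (simp add: \<tau>_def)
  have \<tau>0: "2 \<le> \<tau> 0" using r(3) by (simp add: \<tau>_def a0 S_def)
  have Q: "1 < 2 powr \<alpha>" "2 powr \<alpha> \<le> (4::real)"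
    using \<alpha> powr_mono[of \<alpha> 2 "2::real"] by simp_all
  have D: "0 \<le> D" using Q C by (simp add: D_def)
  have GL: "G \<subseteq> Linf_unit M" using G H by auto

  have "\<forall>j. \<exists>B. finite B \<and> real (card B) \<le> exp (C * a j powr (-\<alpha>)) \<and>
    (\<forall>b\<in>B. fst b \<in> L2_space M \<and> snd b \<in> L2_space M \<and> L2_norm M (\<lambda>x. snd b x - fst b x) < a j) \<and>
    (\<forall>h\<in>H. \<exists>b\<in>B. \<forall>x\<in>space M. fst b x \<le> h x \<and> h x \<le> snd b x)"
    by (intro allI bracketing_entropyE[OF ent] a)
  from choice[OF this] obtain B where BB: "\<forall>j. finite (B j) \<and> real (card (B j)) \<le> exp (C * a j powr (-\<alpha>)) \<and>
    (\<forall>b\<in>B j. fst b \<in> L2_space M \<and> snd b \<in> L2_space M \<and> L2_norm M (\<lambda>x. snd b x - fst b x) < a j) \<and>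
    (\<forall>h\<in>H. \<exists>b\<in>B j. \<forall>x\<in>space M. fst b x \<le> h x \<and> h x \<le> snd b x)"
    by (rule exE)
  have B: "finite (B j)" "real (card (B j)) \<le> exp (C * a j powr (-\<alpha>))"
    "\<And>b. b \<in> B j \<Longrightarrow> fst b \<in> L2_space M \<and> snd b \<in> L2_space M \<and> L2_norm M (\<lambda>x. snd b x - fst b x) < a j"
    "\<And>h. h \<in> H \<Longrightarrow> \<exists>b. b \<in> B j \<and> (\<forall>x\<in>space M. fst b x \<le> h x \<and> h x \<le> snd b x)" for j
    using spec[OF BB, of j] by (blast+)
  define br where "br h j = (SOME b. b \<in> B j \<and> (\<forall>x\<in>space M. fst b x \<le> h x \<and> h x \<le> snd b x))" for h j
  have br: "br h j \<in> B j \<and> (\<forall>x\<in>space M. fst (br h j) x \<le> h x \<and> h x \<le> snd (br h j) x)" if "h \<in> G" for h j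
    using someI_ex[OF B(4)[of h j]] that G(3) unfolding br_def by blast
  have chain: "bracket_chain M (br h) h a \<tau>" if h: "h \<in> G" for h
    using br[OF h] B(3)[of "br h _"] h GL a(1) \<tau> \<tau>0
    by unfold_locales blast+

  (* The numbers of brackets of all levels multiply, but as their logarithms grow geometrically
     the last level dominates. *)
  have count: "real (\<Prod>i\<le>j. card (B i)) \<le> exp (D * a j powr (-\<alpha>))" for j
  proof -
    have "real (\<Prod>i\<le>j. card (B i)) \<le> (\<Prod>i\<le>j. exp (C * a i powr (-\<alpha>)))"
      unfolding of_nat_prod using B(2) by (intro prod_mono) auto
    also have "\<dots> = exp (C * (\<Sum>i\<le>j. a i powr (-\<alpha>)))"
      by (simp add: exp_sum sum_distrib_left)
    also have "(\<Sum>i\<le>j. a i powr (-\<alpha>)) = r powr (-\<alpha>) * (\<Sum>i\<le>j. (2 powr \<alpha>) ^ i)"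
      unfolding a_def powr_half_pow[OF r(1)] by (simp add: sum_distrib_left)
    also have "(\<Sum>i\<le>j. (2 powr \<alpha>) ^ i) = ((2 powr \<alpha>) ^ Suc j - 1) / (2 powr \<alpha> - 1)"
      unfolding lessThan_Suc_atMost[symmetric] using Q(1) by (intro geometric_sum) linarith
    also have "C * (r powr (-\<alpha>) * \<dots>) \<le> C * (r powr (-\<alpha>) * ((2 powr \<alpha>) ^ Suc j / (2 powr \<alpha> - 1)))"
      using C Q by (intro mult_left_mono divide_right_mono) auto
    also have "\<dots> = D * a j powr (-\<alpha>)"
      unfolding a_def powr_half_pow[OF r(1)] D_def by simp
    finally show ?thesis by simp
  qed
  have level: "D * a (Suc j) powr (-\<alpha>) \<le> (4 * D) * a j powr (-\<alpha>)" for j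
  proof -
    have "a (Suc j) powr (-\<alpha>) = 2 powr \<alpha> * a j powr (-\<alpha>)"
      unfolding a_def powr_half_pow[OF r(1)] by simp
    then show ?thesis
      using mult_right_mono[OF Q(2), of "D * a j powr (-\<alpha>)"] D by (simp add: mult_ac)
  qed

  let ?N = "(\<lambda>h. nested_lo 0 (br h)) ` G"
  let ?W = "\<lambda>j. (\<lambda>h. chain_link \<tau> j (br h)) ` G"
  let ?V = "\<lambda>j. (\<lambda>h. chain_stop \<tau> j (br h)) ` G"
  let ?R = "\<lambda>j. (\<lambda>h. chain_rest \<tau> j (br h)) ` G"
  have card: "real (card ((\<lambda>h. f (br h)) ` G)) \<le> exp (D * a j powr (-\<alpha>))"
    if "\<And>c c'. (\<And>i. i \<le> j \<Longrightarrow> c i = c' i) \<Longrightarrow> f c = f c'" for f :: "_ \<Rightarrow> 'a \<Rightarrow> real" and j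
  proof -
    have "card ((\<lambda>h. f (br h)) ` G) \<le> (\<Prod>i\<le>j. card (B i))"
      using br by (intro card_image_prefix_le[OF G(1) B(1) _ that]) auto
    then show ?thesis using count[of j] by linarith
  qed
  have cardW0: "real (card ?N) \<le> exp (D * r powr (-\<alpha>))"
    unfolding a0[symmetric] by (rule card) (rule nested_cong(1))
  have cardW: "real (card (?W j)) \<le> exp (4 * D * a j powr (-\<alpha>))" for j
  proof (rule order_trans)
    show "real (card ((\<lambda>h. chain_link \<tau> j (br h)) ` G)) \<le> exp (D * a (Suc j) powr (-\<alpha>))"
      by (rule card) (rule chain_cong(1))
    show "exp (D * a (Suc j) powr (-\<alpha>)) \<le> exp (4 * D * a j powr (-\<alpha>))"
      using level[of j] by simp
  qed
  have cardV: "real (card (?V j)) \<le> exp (4 * D * a j powr (-\<alpha>))" for j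
  proof (rule order_trans)
    show "real (card ((\<lambda>h. chain_stop \<tau> j (br h)) ` G)) \<le> exp (D * a (Suc j) powr (-\<alpha>))"
      by (rule card) (rule chain_cong(2))
    show "exp (D * a (Suc j) powr (-\<alpha>)) \<le> exp (4 * D * a j powr (-\<alpha>))"
      using level[of j] by simp
  qed
  have cardR: "real (card (?R j)) \<le> exp (D * a j powr (-\<alpha>))" for j
    by (rule card) (rule chain_rest_cong)

  let ?X = "\<lambda>W x. rad_sup I W x"
  let ?Y = "\<lambda>W x. MAX w\<in>W. \<Sum>i\<in>I. w (x i)"
  have X0: "integrable (iid I M) (?X ?N)"
    "(\<integral>x. ?X ?N x \<partial>iid I M) \<le> (D + 5) * (S * r powr \<beta>)"
  proof -
    let ?b = "S * r powr (1 + \<alpha> / 2)"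
    have b: "1 \<le> ?b" using r(3) by (simp add: S_def)
    have w: "w \<in> borel_measurable M" "x \<in> space M \<Longrightarrow> \<bar>w x\<bar> \<le> ?b"
      "(\<integral>x. (w x)\<^sup>2 \<partial>M) \<le> 4 * r\<^sup>2" if "w \<in> ?N" for w x
    proof -
      from that obtain h where h: "h \<in> G" "w = nested_lo 0 (br h)" by auto
      interpret bracket_chain M "br h" h a \<tau> by (rule chain[OF h(1)])
      have "(\<integral>x. (h x)\<^sup>2 \<partial>M) \<le> (a 0)\<^sup>2" using rad[OF h(1)] by (simp add: a0)
      note sb = start_bounds[OF this]
      show "w \<in> borel_measurable M" unfolding h(2) by (rule measurable_nested)
      show "\<bar>w x\<bar> \<le> ?b" if "x \<in> space M" using sb(2)[OF that] b unfolding h(2) by linarith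
      show "(\<integral>x. (w x)\<^sup>2 \<partial>M) \<le> 4 * r\<^sup>2" using sb(1) unfolding h(2) a0 .
    qed
    have pos: "0 < ?b" using b by linarith
    note M1 = integral_rad_mean_Max_abs_le[where v="4 * r\<^sup>2" and W="?N", OF I _ _ cardW0 pos]
    show "integrable (iid I M) (?X ?N)" by (rule M1(1)) (use G w in blast)+
    have "(\<integral>x. ?X ?N x \<partial>iid I M) \<le> ?b * (D * r powr (-\<alpha>) + 1) + real (card I) * (4 * r\<^sup>2) / ?b"
      by (rule M1(2)) (use G w in blast)+
    also have "real (card I) * (4 * r\<^sup>2) / ?b = 8 * (S\<^sup>2 * r\<^sup>2 / (2 * S * r powr (1 + \<alpha> / 2)))"
      by (simp add: S2)
    also have "\<dots> = 4 * (S * r powr \<beta>)"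
      unfolding chain_threshold_divide[OF r(1) S] \<beta>_def by simp
    also have "?b * (D * r powr (-\<alpha>) + 1) \<le> (D + 1) * (S * r powr \<beta>)"
      using chain_threshold_le[OF r(1,2) S0, of \<alpha> D] \<alpha> by (simp add: \<beta>_def algebra_simps)
    finally show "(\<integral>x. ?X ?N x \<partial>iid I M) \<le> (D + 5) * (S * r powr \<beta>)"
      by (simp add: algebra_simps del: nested_lo.simps)
  qed
  have X: "integrable (iid I M) (?X (?W j))"
    "(\<integral>x. ?X (?W j) x \<partial>iid I M) \<le> (8 * D + 3) * (S * a j powr \<beta>)" for j
  proof -
    have w: "w \<in> borel_measurable M" "x \<in> space M \<Longrightarrow> \<bar>w x\<bar> \<le> \<tau> j"
      "(\<integral>x. (w x)\<^sup>2 \<partial>M) \<le> (a j)\<^sup>2" if "w \<in> ?W j" for w x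
    proof -
      from that obtain h where h: "h \<in> G" "w = chain_link \<tau> j (br h)" by auto
      interpret bracket_chain M "br h" h a \<tau> by (rule chain[OF h(1)])
      show "w \<in> borel_measurable M" "(\<integral>x. (w x)\<^sup>2 \<partial>M) \<le> (a j)\<^sup>2"
        unfolding h(2) by (rule measurable_chain link_bounds)+
      show "\<bar>w x\<bar> \<le> \<tau> j" if "x \<in> space M" unfolding h(2) by (rule link_bounds(1)[OF that])
    qed
    note M1 = integral_rad_mean_Max_abs_le[where v="(a j)\<^sup>2" and W="?W j", OF I _ _ cardW \<tau>]
    show "integrable (iid I M) (?X (?W j))" by (rule M1(1)) (use G w in blast)+
    have "(\<integral>x. ?X (?W j) x \<partial>iid I M)
        \<le> \<tau> j * (4 * D * a j powr (-\<alpha>) + 1) + real (card I) * (a j)\<^sup>2 / \<tau> j"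
      by (rule M1(2)) (use G w in blast)+
    also have "real (card I) * (a j)\<^sup>2 / \<tau> j = S * a j powr \<beta> / 2"
      unfolding S2 \<tau>_def \<beta>_def by (rule chain_threshold_divide[OF a(1) S])
    also have "\<tau> j * (4 * D * a j powr (-\<alpha>) + 1) \<le> S * a j powr \<beta> * (2 * (4 * D) + 2)"
      unfolding \<tau>_def \<beta>_def using \<alpha> by (intro chain_threshold_le[OF a(1,2) S0]) auto
    finally show "(\<integral>x. ?X (?W j) x \<partial>iid I M) \<le> (8 * D + 3) * (S * a j powr \<beta>)"
      using mult_nonneg_nonneg[OF S0 powr_ge_zero[of "a j" \<beta>]] by (simp add: algebra_simps)
  qed
  have Y: "integrable (iid I M) (?Y (?V j))"
    "(\<integral>x. ?Y (?V j) x \<partial>iid I M) \<le> (8 * D + 3) * (S * a j powr \<beta>)" for j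
  proof -
    have w: "w \<in> borel_measurable M" "x \<in> space M \<Longrightarrow> 0 \<le> w x \<and> w x \<le> \<tau> j"
      "(\<integral>x. w x \<partial>M) \<le> (a (Suc j))\<^sup>2 / \<tau> (Suc j)" if "w \<in> ?V j" for w x
    proof -
      from that obtain h where h: "h \<in> G" "w = chain_stop \<tau> j (br h)" by auto
      interpret bracket_chain M "br h" h a \<tau> by (rule chain[OF h(1)])
      show "w \<in> borel_measurable M" "(\<integral>x. w x \<partial>M) \<le> (a (Suc j))\<^sup>2 / \<tau> (Suc j)"
        unfolding h(2) by (rule measurable_chain stop_bounds)+
      show "0 \<le> w x \<and> w x \<le> \<tau> j" if "x \<in> space M" unfolding h(2) by (rule stop_bounds(1)[OF that])
    qed
    note M2 = integral_Max_sum_le[where v="(a (Suc j))\<^sup>2 / \<tau> (Suc j)" and W="?V j", OF I _ _ cardV \<tau>]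
    show "integrable (iid I M) (?Y (?V j))" by (rule M2(1)) (use G w in blast)+
    have "(\<integral>x. ?Y (?V j) x \<partial>iid I M)
        \<le> \<tau> j * (4 * D * a j powr (-\<alpha>) + 1) + 2 * real (card I) * ((a (Suc j))\<^sup>2 / \<tau> (Suc j))"
      by (rule M2(2)) (use G w in blast)+
    also have "2 * real (card I) * ((a (Suc j))\<^sup>2 / \<tau> (Suc j)) = 2 * (S\<^sup>2 * (a (Suc j))\<^sup>2 / \<tau> (Suc j))"
      by (simp add: S2)
    also have "\<dots> = S * a (Suc j) powr \<beta>"
      unfolding \<tau>_def \<beta>_def chain_threshold_divide[OF a(1) S] by simp
    also have "\<dots> \<le> S * a j powr \<beta>"
      using aS[of j] a(1)[of "Suc j"] \<beta> S0 by (intro mult_left_mono powr_mono2) auto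
    also have "\<tau> j * (4 * D * a j powr (-\<alpha>) + 1) \<le> S * a j powr \<beta> * (2 * (4 * D) + 2)"
      unfolding \<tau>_def \<beta>_def using \<alpha> by (intro chain_threshold_le[OF a(1,2) S0]) auto
    finally show "(\<integral>x. ?Y (?V j) x \<partial>iid I M) \<le> (8 * D + 3) * (S * a j powr \<beta>)"
      by (simp add: algebra_simps)
  qed
  (* So deep in the chain even the trivial bound on the remaining error is small enough. *)
  obtain J where "r / 2 ^ J \<le> r powr \<beta> / S"
    using half_pow_tendsto[of "r powr \<beta> / S" r] r S by auto
  then have "S * a J \<le> r powr \<beta>"
    using S by (simp add: a_def le_divide_eq mult.commute)
  then have "S * (S * a J) \<le> S * r powr \<beta>" using S0 by (rule mult_left_mono)
  then have J: "2 * S\<^sup>2 * a J \<le> 2 * (S * r powr \<beta>)" by (simp add: power2_eq_square)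
  have Z: "integrable (iid I M) (?Y (?R J))"
    "(\<integral>x. ?Y (?R J) x \<partial>iid I M) \<le> (2 * D + 4) * (S * r powr \<beta>)"
  proof -
    have w: "w \<in> borel_measurable M" "x \<in> space M \<Longrightarrow> 0 \<le> w x \<and> w x \<le> \<tau> J"
      "(\<integral>x. w x \<partial>M) \<le> a J" if "w \<in> ?R J" for w x
    proof -
      from that obtain h where h: "h \<in> G" "w = chain_rest \<tau> J (br h)" by auto
      interpret bracket_chain M "br h" h a \<tau> by (rule chain[OF h(1)])
      show "w \<in> borel_measurable M" "(\<integral>x. w x \<partial>M) \<le> a J"
        unfolding h(2) by (rule measurable_chain rest_bounds)+
      show "0 \<le> w x \<and> w x \<le> \<tau> J" if "x \<in> space M" unfolding h(2) by (rule rest_bounds(1)[OF that])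
    qed
    note M2 = integral_Max_sum_le[where v="a J" and W="?R J", OF I _ _ cardR \<tau>]
    show "integrable (iid I M) (?Y (?R J))" by (rule M2(1)) (use G w in blast)+
    have "(\<integral>x. ?Y (?R J) x \<partial>iid I M)
        \<le> \<tau> J * (D * a J powr (-\<alpha>) + 1) + 2 * real (card I) * a J"
      by (rule M2(2)) (use G w in blast)+
    also have "2 * real (card I) * a J \<le> 2 * (S * r powr \<beta>)" using J by (simp add: S2)
    also have "\<tau> J * (D * a J powr (-\<alpha>) + 1) \<le> S * a J powr \<beta> * (2 * D + 2)"
      unfolding \<tau>_def \<beta>_def using \<alpha> by (intro chain_threshold_le[OF a(1,2) S0]) auto
    also have "\<dots> \<le> S * r powr \<beta> * (2 * D + 2)"
      using a[of J] \<beta> S0 D by (intro mult_right_mono mult_left_mono powr_mono2) auto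
    finally show "(\<integral>x. ?Y (?R J) x \<partial>iid I M) \<le> (2 * D + 4) * (S * r powr \<beta>)"
      by (simp add: algebra_simps)
  qed

  have pointwise: "?X G x \<le> ?X ?N x + (\<Sum>j<J. ?X (?W j) x) + (\<Sum>j<J. ?Y (?V j) x) + ?Y (?R J) x"
    if x: "x \<in> space (iid I M)" for x
  proof -
    have xI: "x i \<in> space M" if "i \<in> I" for i using x that by (auto simp: space_PiM)
    let ?m = "\<lambda>A W. MAX w\<in>W. \<bar>\<Sum>i\<in>I. signs A i * w (x i)\<bar>"
    have "?X G x \<le> rad_mean I (\<lambda>s. (MAX w\<in>?N. \<bar>\<Sum>i\<in>I. s i * w (x i)\<bar>)
       + (\<Sum>j<J. MAX w\<in>?W j. \<bar>\<Sum>i\<in>I. s i * w (x i)\<bar>) + ((\<Sum>j<J. ?Y (?V j) x) + ?Y (?R J) x))"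
    proof (intro rad_mean_mono MAX_le[OF G(1,2)])
      fix A h assume h: "h \<in> G"
      interpret bracket_chain M "br h" h a \<tau> by (rule chain[OF h])
      have m: "\<bar>\<Sum>i\<in>I. signs A i * w (x i)\<bar> \<le> ?m A W" if "w \<in> W" "finite W" for w W
        using that by (intro MAX_ge[of W w "\<lambda>w. \<bar>\<Sum>i\<in>I. signs A i * w (x i)\<bar>"])
      have y: "(\<Sum>i\<in>I. w (x i)) \<le> ?Y W x" if "w \<in> W" "finite W" for w W
        using that by (intro MAX_ge[of W w "\<lambda>w. \<Sum>i\<in>I. w (x i)"])
      have "\<bar>\<Sum>i\<in>I. signs A i * h (x i)\<bar> \<le> \<bar>\<Sum>i\<in>I. signs A i * nested_lo 0 (br h) (x i)\<bar>
        + (\<Sum>j<J. \<bar>\<Sum>i\<in>I. signs A i * chain_link \<tau> j (br h) (x i)\<bar>)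
        + (\<Sum>j<J. \<Sum>i\<in>I. chain_stop \<tau> j (br h) (x i)) + (\<Sum>i\<in>I. chain_rest \<tau> J (br h) (x i))"
        by (rule signed_sum_chain) (rule xI)
      also have "\<dots> \<le> ?m A ?N + (\<Sum>j<J. ?m A (?W j)) + (\<Sum>j<J. ?Y (?V j) x) + ?Y (?R J) x"
        by (intro add_mono sum_mono m y imageI finite_imageI h G(1))
      finally show "\<bar>\<Sum>i\<in>I. signs A i * h (x i)\<bar> \<le> ?m A ?N + (\<Sum>j<J. ?m A (?W j))
          + ((\<Sum>j<J. ?Y (?V j) x) + ?Y (?R J) x)" by simp
    qed
    then show ?thesis
      unfolding rad_mean_add rad_mean_sum rad_mean_const[OF I] by simp
  qed
  have "rad_complexity M I G \<le> (\<integral>x. ?X ?N x + (\<Sum>j<J. ?X (?W j) x) + (\<Sum>j<J. ?Y (?V j) x) + ?Y (?R J) x \<partial>iid I M)"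
    unfolding rad_complexity_def
    by (intro integral_mono[OF rad_complexity_eq(2)[OF G(1,2) GL] _ pointwise]
        Bochner_Integration.integrable_add Bochner_Integration.integrable_sum X0 X Y Z)
  also have "\<dots> = (\<integral>x. ?X ?N x \<partial>iid I M) + (\<Sum>j<J. \<integral>x. ?X (?W j) x \<partial>iid I M)
      + (\<Sum>j<J. \<integral>x. ?Y (?V j) x \<partial>iid I M) + (\<integral>x. ?Y (?R J) x \<partial>iid I M)"
    by (simp only: Bochner_Integration.integral_add Bochner_Integration.integral_sum
        Bochner_Integration.integrable_add Bochner_Integration.integrable_sum X0(1) X(1) Y(1) Z(1))
  also have "\<dots> \<le> (D + 5) * (S * r powr \<beta>) + (\<Sum>j<J. (8 * D + 3) * (S * a j powr \<beta>))
      + (\<Sum>j<J. (8 * D + 3) * (S * a j powr \<beta>)) + (2 * D + 4) * (S * r powr \<beta>)"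
    by (intro add_mono sum_mono X0 X Y Z)
  also have "(\<Sum>j<J. (8 * D + 3) * (S * a j powr \<beta>)) \<le> (8 * D + 3) * (S * r powr \<beta>) * (1 / (1 - 2 powr (- \<beta>)))"
  proof -
    have "(\<Sum>j<J. (8 * D + 3) * (S * a j powr \<beta>)) = (8 * D + 3) * (S * r powr \<beta>) * (\<Sum>j<J. (2 powr (- \<beta>)) ^ j)"
      unfolding a_def powr_half_pow[OF r(1)] sum_distrib_left by (simp add: mult.assoc)
    also have "\<dots> \<le> (8 * D + 3) * (S * r powr \<beta>) * (1 / (1 - 2 powr (- \<beta>)))"
      using \<beta> D S0 by (intro mult_left_mono sum_geometric_le) (auto simp: powr_less_one)
    finally show ?thesis .
  qed
  finally have "rad_complexity M I G \<le> (D + 5) * (S * r powr \<beta>)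
      + 2 * ((8 * D + 3) * (S * r powr \<beta>) * (1 / (1 - 2 powr (- \<beta>)))) + (2 * D + 4) * (S * r powr \<beta>)"
    by linarith
  also have "\<dots> = (D + 5 + (16 * D + 6) / (1 - 2 powr (- \<beta>)) + (2 * D + 4)) * (S * r powr \<beta>)"
    by (simp add: algebra_simps add_divide_distrib)
  finally show ?thesis by (simp only: S_def \<beta>_def)
qed

text \<open>Below the critical radius the class only becomes smaller, so that the bound at the critical
  radius applies.\<close>

lemma local_complexity_bound_bracketing:
  assumes ent: "bracketing_entropy M H \<alpha> C" and \<alpha>: "0 < \<alpha>" "\<alpha> < 2" and C: "0 \<le> C"
    and H: "H \<subseteq> Linf_unit M"
  shows "\<exists>K\<ge>0. local_complexity_bound M H \<alpha> K"
proof -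
  define D where "D = C * (2 powr \<alpha> / (2 powr \<alpha> - 1))"
  define K where "K = D + 5 + (16 * D + 6) / (1 - 2 powr (- (1 - \<alpha> / 2))) + (2 * D + 4)"
  have "1 \<le> 2 powr \<alpha>" using \<alpha> by (simp add: ge_one_powr_ge_zero)
  then have "0 \<le> D" unfolding D_def using C by (intro mult_nonneg_nonneg divide_nonneg_nonneg) auto
  moreover have "2 powr (- (1 - \<alpha> / 2)) < (1::real)" using \<alpha> by (simp add: powr_less_one)
  ultimately have K: "0 \<le> K" by (simp add: K_def)
  have "local_complexity_bound M H \<alpha> K"
    unfolding local_complexity_bound_def
  proof (intro allI impI)
    fix I :: "nat set" and G and r :: real
    assume *: "finite I" "I \<noteq> {}" "finite G" "G \<subseteq> H" "(\<lambda>_. 0) \<in> G" "0 < r" "r \<le> 1"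
      "\<forall>h\<in>G. (\<integral>x. (h x)\<^sup>2 \<partial>M) \<le> r\<^sup>2"
    define k where "k = real (card I)"
    have k: "1 \<le> k" using * by (simp add: k_def Suc_leI card_gt_0_iff)
    define \<rho> where "\<rho> = k powr (- 1 / (2 + \<alpha>))"
    have "\<rho> \<le> k powr 0" unfolding \<rho>_def using k \<alpha> by (intro powr_mono) auto
    then have \<rho>: "0 < \<rho>" "\<rho> \<le> 1" using k by (auto simp: \<rho>_def)
    define R where "R = max r \<rho>"
    have R: "0 < R" "R \<le> 1" "r \<le> R" "\<rho> \<le> R" using * \<rho> by (auto simp: R_def)
    have sqrtk: "sqrt k = k powr (1 / 2)" using k by (simp add: powr_half_sqrt)
    have "1 = sqrt k * \<rho> powr (1 + \<alpha> / 2)"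
    proof -
      have "1 / 2 + - 1 / (2 + \<alpha>) * (1 + \<alpha> / 2) = 0" using \<alpha> by (simp add: field_simps)
      then show ?thesis using k by (simp only: sqrtk \<rho>_def powr_powr powr_add[symmetric]) simp
    qed
    also have "\<dots> \<le> sqrt k * R powr (1 + \<alpha> / 2)"
      using R \<rho> \<alpha> k by (intro mult_left_mono powr_mono2) auto
    finally have crit: "1 \<le> sqrt (real (card I)) * R powr (1 + \<alpha> / 2)" by (simp only: k_def)
    have rad: "(\<integral>x. (h x)\<^sup>2 \<partial>M) \<le> R\<^sup>2" if "h \<in> G" for h
    proof -
      have "(\<integral>x. (h x)\<^sup>2 \<partial>M) \<le> r\<^sup>2" using *(8) that by blast
      also have "\<dots> \<le> R\<^sup>2" using R(3) *(6) by (intro power_mono) auto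
      finally show ?thesis .
    qed
    have "rad_complexity M I G \<le> K * (sqrt k * R powr (1 - \<alpha> / 2))"
      unfolding K_def D_def k_def
      using * rad_complexity_bracketing[OF ent \<alpha> C H *(1,3) _ *(4) R(1,2) crit rad] by auto
    also have "R powr (1 - \<alpha> / 2) \<le> r powr (1 - \<alpha> / 2) + \<rho> powr (1 - \<alpha> / 2)"
      by (auto simp: R_def max_def)
    also have "sqrt k * (r powr (1 - \<alpha> / 2) + \<rho> powr (1 - \<alpha> / 2))
        = sqrt k * r powr (1 - \<alpha> / 2) + k powr (\<alpha> / (2 + \<alpha>))"
    proof -
      have "1 / 2 + - 1 / (2 + \<alpha>) * (1 - \<alpha> / 2) = \<alpha> / (2 + \<alpha>)" using \<alpha> by (simp add: field_simps)
      then have "sqrt k * \<rho> powr (1 - \<alpha> / 2) = k powr (\<alpha> / (2 + \<alpha>))"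
        by (simp only: sqrtk \<rho>_def powr_powr powr_add[symmetric])
      then show ?thesis by (simp add: distrib_left)
    qed
    finally show "rad_complexity M I G \<le> K *
        (sqrt (real (card I)) * r powr (1 - \<alpha> / 2) + real (card I) powr (\<alpha> / (2 + \<alpha>)))"
      using K k by (simp add: k_def mult_left_mono)
  qed
  with K show ?thesis by blast
qed

lemma local_complexity_bound_entropy:
  assumes "entropy_condition M H \<alpha>" "0 < \<alpha>" "\<alpha> < 2" "countable H" "H \<subseteq> Linf_unit M"
  shows "\<exists>K\<ge>0. local_complexity_bound M H \<alpha> K"
proof -
  obtain C where "uniform_entropy M H \<alpha> C \<or> bracketing_entropy M H \<alpha> C"
    using assms(1) by (auto simp: entropy_condition_def)
  moreover have "ereal (C * \<epsilon> powr (-\<alpha>)) \<le> ereal (max C 0 * \<epsilon> powr (-\<alpha>))" for \<epsilon>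
    by (simp add: mult_right_mono)
  ultimately have "uniform_entropy M H \<alpha> (max C 0) \<or> bracketing_entropy M H \<alpha> (max C 0)"
    unfolding uniform_entropy_def bracketing_entropy_def by (meson order_trans)
  then show ?thesis
    using local_complexity_bound_uniform[of H \<alpha> "max C 0"]
      local_complexity_bound_bracketing[of H \<alpha> "max C 0"] assms by auto
qed

end

section \<open>Multiplier processes\<close>

lemma (in prob_space) nn_integral_powr_le:
  fixes N :: "'a \<Rightarrow> real"
  assumes N: "N \<in> borel_measurable M" "\<And>x. x \<in> space M \<Longrightarrow> 0 \<le> N x \<and> N x \<le> B"
    and \<theta>: "0 < \<theta>" "\<theta> \<le> 1"
  shows "(\<integral>\<^sup>+x. ennreal (N x powr \<theta>) \<partial>M) \<le> ennreal (2 * (\<integral>x. N x \<partial>M) powr \<theta>)"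
proof -
  define m where "m = (\<integral>x. N x \<partial>M)"
  have int: "integrable M N" using N by (intro integrable_bounded[where b=B]) auto
  have m0: "0 \<le> m" unfolding m_def using N(2) by (intro integral_nonneg_AE) auto
  show ?thesis
  proof (cases "m = 0")
    case True
    then have "AE x in M. N x = 0"
      using integral_nonneg_eq_0_iff_AE[OF int] N(2) by (auto simp: m_def)
    then have "(\<integral>\<^sup>+x. ennreal (N x powr \<theta>) \<partial>M) = (\<integral>\<^sup>+x. 0 \<partial>M)"
      by (intro nn_integral_cong_AE) auto
    then show ?thesis by simp
  next
    case False
    then have m: "0 < m" using m0 by simp
    have "(\<integral>\<^sup>+x. ennreal (N x powr \<theta>) \<partial>M) \<le> (\<integral>\<^sup>+x. ennreal (m powr \<theta> * (1 + N x / m)) \<partial>M)"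
      using N(2) m \<theta> by (intro nn_integral_mono ennreal_leI powr_le_affine) auto
    also have "\<dots> = ennreal (\<integral>x. m powr \<theta> * (1 + N x / m) \<partial>M)"
      using int N(2) m by (intro nn_integral_eq_integral) auto
    also have "(\<integral>x. m powr \<theta> * (1 + N x / m) \<partial>M) = m powr \<theta> * (1 + m / m)"
      using int by (simp add: prob_space m_def)
    also have "\<dots> = 2 * m powr \<theta>" using m by simp
    finally show ?thesis by (simp add: m_def)
  qed
qed

text \<open>The integrand of the layer-cake formula for \<open>\<bar>e\<bar>\<close>. It vanishes at negative levels, so that the
  integral may be taken over the whole line.\<close>

definition layer :: "real \<Rightarrow> real \<Rightarrow> real" where
  "layer e t = indicator {0..<\<bar>e\<bar>} t"

lemma layer_cake: "integrable lborel (layer e)" "(\<integral>t. layer e t \<partial>lborel) = \<bar>e\<bar>"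
  unfolding layer_def[abs_def] by (auto simp: integrable_indicator_iff)

lemma measurable_layer [measurable]: "case_prod layer \<in> borel_measurable (borel \<Otimes>\<^sub>M borel)"
  unfolding layer_def[abs_def] indicator_def atLeastLessThan_iff by measurable

definition layer_count :: "'i set \<Rightarrow> ('i \<Rightarrow> real) \<Rightarrow> real \<Rightarrow> real" where
  "layer_count I e t = (\<Sum>i\<in>I. layer (e i) t)"

lemma layer_count_eq:
  assumes "finite I"
  shows "layer_count I e t = real (card {i\<in>I. 0 \<le> t \<and> t < \<bar>e i\<bar>})"
  using assms by (simp add: layer_count_def layer_def indicator_def sum.If_cases Int_def)

context prob_space
begin

text \<open>Signs and sample points with index outside \<open>J\<close> average out.\<close>

lemma rad_complexity_superset:
  assumes I: "finite I" "J \<subseteq> I" and G: "finite G" "G \<noteq> {}" "G \<subseteq> Linf_unit M"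
  shows "(\<integral>x. rad_mean I (\<lambda>s. MAX h\<in>G. \<bar>\<Sum>i\<in>J. s i * h (x i)\<bar>) \<partial>iid I M) = rad_complexity M J G"
proof -
  interpret prod: product_prob_space "\<lambda>_. M" by (rule product_prob_space_const)
  have J: "finite J" using I finite_subset by blast
  have eq: "(\<Sum>i\<in>J. s i * h (restrict x J i)) = (\<Sum>i\<in>J. s i * h (x i))" for s and h :: "'a \<Rightarrow> real" and x
    by (intro sum.cong) auto
  have "rad_complexity M J G =
     (\<integral>x. rad_mean J (\<lambda>s. MAX h\<in>G. \<bar>\<Sum>i\<in>J. s i * h (x i)\<bar>)
        \<partial>distr (iid I M) (PiM J (\<lambda>_. M)) (\<lambda>x. restrict x J))"
    unfolding rad_complexity_def prod.distr_PiM_restrict_finite[OF J I(2)] ..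
  also have "\<dots> = (\<integral>x. rad_mean J (\<lambda>s. MAX h\<in>G. \<bar>\<Sum>i\<in>J. s i * h (restrict x J i)\<bar>) \<partial>iid I M)"
    using rad_complexity_eq(2)[OF G, of J] I(2)
    by (intro integral_distr measurable_restrict_subset borel_measurable_integrable)
  also have "\<dots> = (\<integral>x. rad_mean I (\<lambda>s. MAX h\<in>G. \<bar>\<Sum>i\<in>J. s i * h (x i)\<bar>) \<partial>iid I M)"
    unfolding eq
  proof (intro Bochner_Integration.integral_cong refl rad_mean_restrict[symmetric] I)
    fix x :: "'b \<Rightarrow> 'a" and s t :: "'b \<Rightarrow> real" assume "\<And>i. i \<in> J \<Longrightarrow> s i = t i"
    then have "(\<Sum>i\<in>J. s i * h (x i)) = (\<Sum>i\<in>J. t i * h (x i))" for h :: "'a \<Rightarrow> real"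
      by (intro sum.cong) auto
    then show "(MAX h\<in>G. \<bar>\<Sum>i\<in>J. s i * h (x i)\<bar>) = (MAX h\<in>G. \<bar>\<Sum>i\<in>J. t i * h (x i)\<bar>)" by simp
  qed
  finally show ?thesis ..
qed

text \<open>For fixed multipliers \<open>e\<close> the layer-cake formula writes the signed multiplier process as an
  integral of unweighted ones, each over the indices with \<open>\<bar>e i\<bar> > t\<close>. No ordering of the
  multipliers is needed.\<close>

lemma signed_multiplier_le:
  fixes I :: "nat set" and e :: "nat \<Rightarrow> real"
  assumes lcb: "local_complexity_bound M H \<alpha> K" and K: "0 \<le> K" and H: "H \<subseteq> Linf_unit M"
    and I: "finite I" and G: "finite G" "G \<subseteq> H" "(\<lambda>_. 0) \<in> G"
    and r: "0 < r" "r \<le> 1" and rad: "\<And>h. h \<in> G \<Longrightarrow> (\<integral>x. (h x)\<^sup>2 \<partial>M) \<le> r\<^sup>2"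
  shows "(\<integral>\<^sup>+x. ennreal (rad_mean I (\<lambda>s. MAX h\<in>G. \<bar>\<Sum>i\<in>I. s i * (e i * h (x i))\<bar>)) \<partial>iid I M)
    \<le> (\<integral>\<^sup>+t. ennreal (K * (sqrt (layer_count I e t) * r powr (1 - \<alpha> / 2)
          + layer_count I e t powr (\<alpha> / (2 + \<alpha>)))) \<partial>lborel)"
proof -
  interpret PI: prob_space "iid I M" by (rule prob_space_power)
  interpret pair_sigma_finite "iid I M" lborel by standard
  have ne: "G \<noteq> {}" and GL: "G \<subseteq> Linf_unit M" using G H by auto
  define R where "R x t = rad_mean I (\<lambda>s. MAX h\<in>G. \<bar>\<Sum>i\<in>I. s i * (layer (e i) t * h (x i))\<bar>)"
    for x :: "nat \<Rightarrow> 'a" and t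
  have [measurable]: "h \<in> borel_measurable M" if "h \<in> G" for h using that GL by (auto simp: Linf_unit_def)
  have meas1: "(\<lambda>(x, t). MAX h\<in>G. \<bar>\<Sum>i\<in>I. signs A i * (layer (e i) t * h (x i))\<bar>)
      \<in> borel_measurable (iid I M \<Otimes>\<^sub>M lborel)" for A
  proof -
    have "(\<lambda>z. layer (e i) (snd z) * h (fst z i)) \<in> borel_measurable (iid I M \<Otimes>\<^sub>M lborel)"
      if [measurable]: "i \<in> I" and h[measurable]: "h \<in> G" for i h
    proof (rule borel_measurable_times)
      show "(\<lambda>z. layer (e i) (snd z)) \<in> borel_measurable (iid I M \<Otimes>\<^sub>M lborel)"
        unfolding layer_def indicator_def by measurable
      have "(\<lambda>z. fst z i) \<in> measurable (iid I M \<Otimes>\<^sub>M lborel) M" by measurable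
      moreover have "h \<in> borel_measurable M" using h by measurable
      ultimately show "(\<lambda>z. h (fst z i)) \<in> borel_measurable (iid I M \<Otimes>\<^sub>M lborel)"
        by (rule measurable_compose)
    qed
    then have "(\<lambda>z. \<bar>\<Sum>i\<in>I. signs A i * (layer (e i) (snd z) * h (fst z i))\<bar>)
        \<in> borel_measurable (iid I M \<Otimes>\<^sub>M lborel)" if "h \<in> G" for h
      using that by (intro borel_measurable_abs borel_measurable_sum borel_measurable_times) auto
    then show ?thesis unfolding case_prod_beta by (rule borel_measurable_Max[OF G(1)])
  qed
  have Rmeas: "(\<lambda>(x, t). ennreal (R x t)) \<in> borel_measurable (iid I M \<Otimes>\<^sub>M lborel)"
    using meas1 unfolding R_def rad_mean_def case_prod_beta
    by (intro measurable_compose[OF _ measurable_ennreal] borel_measurable_divide borel_measurable_sum) auto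
  have Rnn: "0 \<le> R x t" for x t
    unfolding R_def by (intro rad_mean_nonneg MAX_abs_nonneg[OF G(1) ne])
  have layered: "ennreal (rad_mean I (\<lambda>s. MAX h\<in>G. \<bar>\<Sum>i\<in>I. s i * (e i * h (x i))\<bar>))
      \<le> (\<integral>\<^sup>+t. ennreal (R x t) \<partial>lborel)" if x: "x \<in> space (iid I M)" for x
  proof -
    have hx: "\<bar>h (x i)\<bar> \<le> 1" if "h \<in> G" "i \<in> I" for h i
      using that x GL by (auto simp: space_PiM Linf_unit_def)
    let ?f = "\<lambda>s t h. \<bar>\<Sum>i\<in>I. s i * (layer (e i) t * h (x i))\<bar>"
    have int1: "integrable lborel (\<lambda>t. \<Sum>i\<in>I. s i * (layer (e i) t * h (x i)))" for s h
      using layer_cake(1) by (intro Bochner_Integration.integrable_sum integrable_mult_right integrable_mult_left) auto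
    have int: "integrable lborel (\<lambda>t. MAX h\<in>G. ?f (signs A) t h)" for A
    proof (rule Bochner_Integration.integrable_bound)
      show "integrable lborel (\<lambda>t. \<Sum>i\<in>I. layer (e i) t)"
        using layer_cake(1) by (intro Bochner_Integration.integrable_sum)
      show "(\<lambda>t. MAX h\<in>G. ?f (signs A) t h) \<in> borel_measurable lborel"
        using int1 by (intro borel_measurable_Max[OF G(1)] borel_measurable_abs borel_measurable_integrable)
      have "?f (signs A) t h \<le> (\<Sum>i\<in>I. layer (e i) t)" if "h \<in> G" for t h
        using hx[OF that] by (intro order_trans[OF sum_abs] sum_mono)
          (auto simp: abs_mult layer_def indicator_def)
      then show "AE t in lborel. norm (MAX h\<in>G. ?f (signs A) t h) \<le> norm (\<Sum>i\<in>I. layer (e i) t)"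
        using MAX_abs_nonneg[OF G(1) ne] by (auto intro!: MAX_le[OF G(1) ne] order_trans[OF _ abs_ge_self])
    qed
    have "rad_mean I (\<lambda>s. MAX h\<in>G. \<bar>\<Sum>i\<in>I. s i * (e i * h (x i))\<bar>)
        \<le> rad_mean I (\<lambda>s. MAX h\<in>G. \<bar>\<Sum>i\<in>I. s i * (\<bar>e i\<bar> * h (x i))\<bar>)"
      using rad_mean_contraction_abs[OF I G(1) ne, of e "\<lambda>i. \<bar>e i\<bar>" "\<lambda>h i. h (x i)"] by simp
    also have "\<dots> \<le> rad_mean I (\<lambda>s. \<integral>t. (MAX h\<in>G. ?f s t h) \<partial>lborel)"
    proof (intro rad_mean_mono MAX_le[OF G(1) ne])
      fix A h assume h: "h \<in> G"
      have "(\<Sum>i\<in>I. signs A i * (\<bar>e i\<bar> * h (x i))) = (\<integral>t. (\<Sum>i\<in>I. signs A i * (layer (e i) t * h (x i))) \<partial>lborel)"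
        using layer_cake by (simp add: Bochner_Integration.integral_sum)
      then have "\<bar>\<Sum>i\<in>I. signs A i * (\<bar>e i\<bar> * h (x i))\<bar> \<le> (\<integral>t. ?f (signs A) t h \<partial>lborel)"
        by (simp add: integral_abs_bound)
      also have "\<dots> \<le> (\<integral>t. (MAX h\<in>G. ?f (signs A) t h) \<partial>lborel)"
        using int1 int MAX_ge[OF G(1) h] by (intro integral_mono integrable_abs)
      finally show "\<bar>\<Sum>i\<in>I. signs A i * (\<bar>e i\<bar> * h (x i))\<bar> \<le> (\<integral>t. (MAX h\<in>G. ?f (signs A) t h) \<partial>lborel)" .
    qed
    also have "\<dots> = (\<integral>t. R x t \<partial>lborel)"
      unfolding R_def by (rule rad_mean_integral(1)) (rule int)
    finally have "ennreal (rad_mean I (\<lambda>s. MAX h\<in>G. \<bar>\<Sum>i\<in>I. s i * (e i * h (x i))\<bar>)) \<le> ennreal (\<integral>t. R x t \<partial>lborel)"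
      by (rule ennreal_leI)
    also have "\<dots> = (\<integral>\<^sup>+t. ennreal (R x t) \<partial>lborel)"
    proof (rule nn_integral_eq_integral[symmetric])
      show "integrable lborel (R x)"
        unfolding R_def[abs_def] by (rule rad_mean_integral(2)) (rule int)
    qed (simp add: Rnn)
    finally show ?thesis .
  qed
  have "(\<integral>\<^sup>+x. ennreal (rad_mean I (\<lambda>s. MAX h\<in>G. \<bar>\<Sum>i\<in>I. s i * (e i * h (x i))\<bar>)) \<partial>iid I M)
      \<le> (\<integral>\<^sup>+x. \<integral>\<^sup>+t. ennreal (R x t) \<partial>lborel \<partial>iid I M)"
    by (rule nn_integral_mono) (rule layered)
  also have "\<dots> = (\<integral>\<^sup>+t. \<integral>\<^sup>+x. ennreal (R x t) \<partial>iid I M \<partial>lborel)"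
    using Fubini'[of "\<lambda>x t. ennreal (R x t)"] Rmeas by simp
  also have "\<dots> \<le> (\<integral>\<^sup>+t. ennreal (K * (sqrt (layer_count I e t) * r powr (1 - \<alpha> / 2)
          + layer_count I e t powr (\<alpha> / (2 + \<alpha>)))) \<partial>lborel)"
  proof (rule nn_integral_mono)
    fix t
    define J where "J = {i\<in>I. 0 \<le> t \<and> t < \<bar>e i\<bar>}"
    have J: "J \<subseteq> I" "finite J" using I by (auto simp: J_def)
    have "(\<Sum>i\<in>I. s i * (layer (e i) t * h (x i))) = (\<Sum>i\<in>J. s i * h (x i))"
      for s and h :: "'a \<Rightarrow> real" and x
      using I by (intro sum.mono_neutral_cong_right) (auto simp: J_def layer_def indicator_def)
    then have RJ: "R x t = rad_mean I (\<lambda>s. MAX h\<in>G. \<bar>\<Sum>i\<in>J. s i * h (x i)\<bar>)" for x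
      by (simp add: R_def)
    have "integrable (iid I M) (\<lambda>x. R x t)"
    proof (rule PI.integrable_bounded)
      show "(\<lambda>x. R x t) \<in> borel_measurable (iid I M)"
        unfolding RJ rad_mean_def using measurable_sum_Max_abs[OF G(1), of "\<lambda>h. h" "\<lambda>i. _" J]
      proof -
        have "(\<lambda>x. h (x i)) \<in> borel_measurable (iid I M)" if "h \<in> G" "i \<in> J" for h i
          using that J(1) by (intro measurable_compose[OF measurable_component_singleton]) auto
        then show "(\<lambda>x. (\<Sum>A\<in>Pow I. MAX h\<in>G. \<bar>\<Sum>i\<in>J. signs A i * h (x i)\<bar>) / 2 ^ card I)
            \<in> borel_measurable (iid I M)"
          by (intro borel_measurable_divide borel_measurable_sum borel_measurable_Max[OF G(1)]
              borel_measurable_abs borel_measurable_times) auto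
      qed
      fix x assume x: "x \<in> space (iid I M)"
      have "\<bar>\<Sum>i\<in>J. signs A i * h (x i)\<bar> \<le> real (card J)" if "h \<in> G" for A h
        using x that GL J by (intro abs_signed_sum_le) (auto simp: space_PiM Linf_unit_def)
      then have "R x t \<le> rad_mean I (\<lambda>_. real (card J))"
        unfolding RJ by (intro rad_mean_mono MAX_le[OF G(1) ne])
      then show "\<bar>R x t\<bar> \<le> real (card J)" using I Rnn by simp
    qed
    then have "(\<integral>\<^sup>+x. ennreal (R x t) \<partial>iid I M) = ennreal (\<integral>x. R x t \<partial>iid I M)"
      using Rnn by (intro nn_integral_eq_integral) auto
    also have "(\<integral>x. R x t \<partial>iid I M) = rad_complexity M J G"
      unfolding RJ by (rule rad_complexity_superset[OF I J(1) G(1) ne GL])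
    also have "rad_complexity M J G \<le> K * (sqrt (real (card J)) * r powr (1 - \<alpha> / 2) + real (card J) powr (\<alpha> / (2 + \<alpha>)))"
    proof (cases "J = {}")
      case True
      have "rad_complexity M ({} :: nat set) G = 0"
        using ne by (simp add: rad_complexity_def image_constant_conv)
      then show ?thesis using True by simp
    next
      case False
      with lcb J(2) G r rad show ?thesis unfolding local_complexity_bound_def by blast
    qed
    also have "real (card J) = layer_count I e t" by (simp add: J_def layer_count_eq[OF I])
    finally show "(\<integral>\<^sup>+x. ennreal (R x t) \<partial>iid I M)
      \<le> ennreal (K * (sqrt (layer_count I e t) * r powr (1 - \<alpha> / 2) + layer_count I e t powr (\<alpha> / (2 + \<alpha>))))"
      by (simp add: ennreal_leI)
  qed
  finally show ?thesis .
qed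

end

lemma powr_mono_nat:
  assumes "0 < a" "a \<le> b" shows "real k powr a \<le> real k powr b"
  using assms powr_mono[of a b "real k"] by (cases "k = 0") auto

text \<open>The exponents of the layer counts are raised to at least \<open>1 / p\<close>, for then their
  expectations are at most multiples of the tail to the power \<open>1 / p\<close>, which is integrable. For
  \<open>p < 2\<close> the square root of the count is replaced by its power \<open>1 / p\<close>, which is larger because
  counts are integers.\<close>

lemma layer_count_powr_bound:
  assumes I: "finite I" and p: "1 \<le> p" and \<alpha>: "0 < \<alpha>" "\<alpha> < 2" and r: "0 < r" "r \<le> 1" and K: "0 \<le> K"
  defines "s \<equiv> max (1 / p) (\<alpha> / (2 + \<alpha>))"
  shows "\<exists>\<theta>. 1 / p \<le> \<theta> \<and> \<theta> \<le> 1 \<and>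
    (\<forall>e t. K * (sqrt (layer_count I e t) * r powr (1 - \<alpha> / 2) + layer_count I e t powr (\<alpha> / (2 + \<alpha>)))
       \<le> K * (layer_count I e t powr \<theta> * (if 2 \<le> p then r powr (1 - \<alpha> / 2) else 1)
          + layer_count I e t powr s)) \<and>
    real (card I) powr \<theta> * (if 2 \<le> p then r powr (1 - \<alpha> / 2) else 1)
       \<le> sqrt (real (card I)) * r powr (1 - \<alpha> / 2) + real (card I) powr s"
proof -
  have s: "0 < \<alpha> / (2 + \<alpha>)" "\<alpha> / (2 + \<alpha>) \<le> s" "\<alpha> / (2 + \<alpha>) \<le> 1 / 2"
    using \<alpha> by (auto simp: s_def field_simps)
  have N: "\<exists>k. layer_count I e t = real k" for e t using layer_count_eq[OF I] by blast
  have small: "layer_count I e t powr (\<alpha> / (2 + \<alpha>)) \<le> layer_count I e t powr s" for e t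
    using N[of e t] powr_mono_nat[OF s(1,2)] by auto
  have r1: "r powr (1 - \<alpha> / 2) \<le> 1" using r \<alpha> powr_mono2[of "1 - \<alpha> / 2" r 1] by simp
  show ?thesis
  proof (cases "2 \<le> p")
    case True
    show ?thesis
    proof (intro exI[of _ "1 / 2"] conjI allI)
      show "1 / p \<le> 1 / 2" using True by (simp add: field_simps)
      fix e t
      have "0 \<le> layer_count I e t" using N[of e t] by auto
      then have "sqrt (layer_count I e t) = layer_count I e t powr (1 / 2)" by (simp add: powr_half_sqrt)
      then show "K * (sqrt (layer_count I e t) * r powr (1 - \<alpha> / 2) + layer_count I e t powr (\<alpha> / (2 + \<alpha>)))
       \<le> K * (layer_count I e t powr (1 / 2) * (if 2 \<le> p then r powr (1 - \<alpha> / 2) else 1) + layer_count I e t powr s)"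
        using small[of e t] True K by (auto intro!: mult_left_mono)
    qed (use True in \<open>auto simp: powr_half_sqrt\<close>)
  next
    case False
    then have ps1: "1 / 2 \<le> 1 / p" using p by (simp add: field_simps)
    then have "\<alpha> / (2 + \<alpha>) \<le> 1 / p" using s(3) by linarith
    then have ps: "1 / 2 \<le> 1 / p" "s = 1 / p"
      using ps1 by (simp_all add: s_def max_absorb1)
    show ?thesis
    proof (intro exI[of _ "1 / p"] conjI allI)
      show "1 / p \<le> 1" using p by simp
      fix e t
      obtain k where k: "layer_count I e t = real k" using N by blast
      have "sqrt (real k) * r powr (1 - \<alpha> / 2) \<le> sqrt (real k) * 1"
        using r1 by (intro mult_left_mono) auto
      also have "\<dots> \<le> real k powr (1 / p)"
        using powr_mono_nat[OF _ ps(1), of k] by (simp add: powr_half_sqrt)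
      finally show "K * (sqrt (layer_count I e t) * r powr (1 - \<alpha> / 2) + layer_count I e t powr (\<alpha> / (2 + \<alpha>)))
       \<le> K * (layer_count I e t powr (1 / p) * (if 2 \<le> p then r powr (1 - \<alpha> / 2) else 1) + layer_count I e t powr s)"
        using small[of e t] False K unfolding k by (intro mult_left_mono add_mono) auto
    qed (use False ps in \<open>auto\<close>)
  qed
qed

text \<open>The mean count at level \<open>t\<close> is \<open>card I * T t\<close>, and powers below one of the count have means
  comparable to the power of the mean.\<close>

lemma expected_layer_bound:
  fixes \<mu> :: "(nat \<Rightarrow> real) measure"
  assumes \<mu>: "prob_space \<mu>" "sets \<mu> = sets (PiM I (\<lambda>_. borel))" and I: "finite I" "I \<noteq> {}"
    and tail: "\<And>i t. i \<in> I \<Longrightarrow> 0 \<le> t \<Longrightarrow> measure \<mu> {e \<in> space \<mu>. t < \<bar>e i\<bar>} = T t"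
    and p: "1 \<le> p" and \<alpha>: "0 < \<alpha>" "\<alpha> < 2" and r: "0 < r" "r \<le> 1" and K: "0 \<le> K"
  defines "s \<equiv> max (1 / p) (\<alpha> / (2 + \<alpha>))"
  shows "(\<integral>\<^sup>+e. \<integral>\<^sup>+t. ennreal (K * (sqrt (layer_count I e t) * r powr (1 - \<alpha> / 2)
          + layer_count I e t powr (\<alpha> / (2 + \<alpha>)))) \<partial>lborel \<partial>\<mu>)
    \<le> ennreal (4 * K * (sqrt (real (card I)) * r powr (1 - \<alpha> / 2) + real (card I) powr s))
       * (\<integral>\<^sup>+t\<in>{0..}. ennreal (T t powr (1 / p)) \<partial>lborel)"
proof -
  interpret prob_space \<mu> by (rule \<mu>)
  interpret pair_sigma_finite \<mu> lborel by standard
  define n where "n = real (card I)"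
  have n: "1 \<le> n" using I by (simp add: n_def Suc_leI card_gt_0_iff)
  from layer_count_powr_bound[OF I(1) p \<alpha> r K, folded s_def n_def]
  obtain \<theta> where \<theta>: "1 / p \<le> \<theta>" "\<theta> \<le> 1"
    and le0: "\<forall>e t. K * (sqrt (layer_count I e t) * r powr (1 - \<alpha> / 2) + layer_count I e t powr (\<alpha> / (2 + \<alpha>)))
       \<le> K * (layer_count I e t powr \<theta> * (if 2 \<le> p then r powr (1 - \<alpha> / 2) else 1) + layer_count I e t powr s)"
    and le_n: "n powr \<theta> * (if 2 \<le> p then r powr (1 - \<alpha> / 2) else 1) \<le> sqrt n * r powr (1 - \<alpha> / 2) + n powr s"
    by (elim exE conjE) (rule that)
  note le = le0[rule_format]
  define \<rho> where "\<rho> = (if 2 \<le> p then r powr (1 - \<alpha> / 2) else 1)"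
  have \<rho>: "0 \<le> \<rho>" by (simp add: \<rho>_def)
  have s: "1 / p \<le> s" "s \<le> 1" using p \<alpha> by (auto simp: s_def field_simps)
  have p0: "0 < 1 / p" using p by simp
  have coord: "(\<lambda>e. e i) \<in> borel_measurable \<mu>" if "i \<in> I" for i
    using measurable_component_singleton[OF that, of "\<lambda>_. borel"] \<mu>(2)
    by (simp cong: measurable_cong_sets)
  have joint: "(\<lambda>(e, t). layer_count I e t) \<in> borel_measurable (\<mu> \<Otimes>\<^sub>M lborel)"
    unfolding layer_count_def case_prod_beta
  proof (rule borel_measurable_sum)
    fix i assume i: "i \<in> I"
    have "(\<lambda>z. (fst z i, snd z)) \<in> measurable (\<mu> \<Otimes>\<^sub>M lborel) (borel \<Otimes>\<^sub>M borel)"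
      using coord[OF i] by measurable
    from measurable_compose[OF this measurable_layer]
    show "(\<lambda>z. layer (fst z i) (snd z)) \<in> borel_measurable (\<mu> \<Otimes>\<^sub>M lborel)" by simp
  qed
  have layer_meas: "(\<lambda>e. layer (e i) t) \<in> borel_measurable \<mu>" if "i \<in> I" for i t
    using measurable_compose[OF measurable_Pair[OF coord[OF that] measurable_const[of t borel \<mu>]] measurable_layer]
    by simp
  have layer01: "0 \<le> layer y t" "layer y t \<le> 1" for y t by (auto simp: layer_def indicator_def)
  define T' where "T' t = (if 0 \<le> t then T t else 0)" for t
  have layer_int: "(\<integral>e. layer (e i) t \<partial>\<mu>) = T' t" if i: "i \<in> I" for i t
  proof (cases "0 \<le> t")
    case True
    have "{e \<in> space \<mu>. t < \<bar>e i\<bar>} \<in> sets \<mu>" using coord[OF i] by measurable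
    moreover have "(\<integral>e. layer (e i) t \<partial>\<mu>) = (\<integral>e. indicator {e \<in> space \<mu>. t < \<bar>e i\<bar>} e \<partial>\<mu>)"
      using True by (intro Bochner_Integration.integral_cong) (auto simp: layer_def indicator_def)
    ultimately show ?thesis using True tail[OF i True] by (simp add: T'_def)
  next
    case False
    then have "layer y t = 0" for y by (simp add: layer_def)
    with False show ?thesis by (simp add: T'_def)
  qed
  obtain i0 where i0: "i0 \<in> I" using I by auto
  have T'01: "0 \<le> T' t" "T' t \<le> 1" for t
    unfolding layer_int[OF i0, symmetric] using layer01 layer_meas[OF i0]
    by (auto intro!: Bochner_Integration.integral_nonneg expectation_le_const[where b=1])
  have T'meas: "T' \<in> borel_measurable lborel"
  proof -
    have "(\<lambda>z. layer (snd z i0) (fst z)) \<in> borel_measurable (lborel \<Otimes>\<^sub>M \<mu>)"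
    proof -
      have "(\<lambda>z. (snd z i0, fst z)) \<in> measurable (lborel \<Otimes>\<^sub>M \<mu>) (borel \<Otimes>\<^sub>M borel)"
        using coord[OF i0] by measurable
      from measurable_compose[OF this measurable_layer] show ?thesis by simp
    qed
    then have "(\<lambda>(t, e). layer (e i0) t) \<in> borel_measurable (lborel \<Otimes>\<^sub>M \<mu>)"
      by (simp add: case_prod_beta)
    then have "(\<lambda>t. \<integral>e. layer (e i0) t \<partial>\<mu>) \<in> borel_measurable lborel"
      by (rule sigma_finite_measure.borel_measurable_lebesgue_integral[OF prob_space_imp_sigma_finite[OF \<mu>(1)]])
    then show ?thesis by (simp add: layer_int[OF i0])
  qed
  have Nmeas: "(\<lambda>e. layer_count I e t) \<in> borel_measurable \<mu>" for t
    unfolding layer_count_def using layer_meas by (intro borel_measurable_sum)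
  have Nb: "0 \<le> layer_count I e t \<and> layer_count I e t \<le> n" for e t
    unfolding layer_count_def n_def using layer01 by (auto intro: sum_nonneg sum_bounded_above[of I _ 1, simplified])
  have EN: "(\<integral>e. layer_count I e t \<partial>\<mu>) = n * T' t" for t
    unfolding layer_count_def using layer_int integrable_bounded[OF layer_meas, where b=1] layer01
    by (subst Bochner_Integration.integral_sum) (auto simp: n_def)
  have moment: "(\<integral>\<^sup>+e. ennreal (layer_count I e t powr q) \<partial>\<mu>) \<le> ennreal (2 * n powr q * T' t powr (1 / p))"
    if q: "1 / p \<le> q" "q \<le> 1" for q t
  proof -
    have "(\<integral>\<^sup>+e. ennreal (layer_count I e t powr q) \<partial>\<mu>) \<le> ennreal (2 * (n * T' t) powr q)"
      using nn_integral_powr_le[OF Nmeas Nb, of q t] q p0 by (simp add: EN)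
    also have "(n * T' t) powr q = n powr q * T' t powr q"
      using n T'01 by (simp add: powr_mult)
    also have "T' t powr q \<le> T' t powr (1 / p)"
      using q T'01[of t] by (intro powr_mono') auto
    finally show ?thesis by (simp add: mult_left_mono mult.assoc ennreal_leI)
  qed
  have inner: "(\<integral>\<^sup>+e. ennreal (K * (sqrt (layer_count I e t) * r powr (1 - \<alpha> / 2)
          + layer_count I e t powr (\<alpha> / (2 + \<alpha>)))) \<partial>\<mu>)
      \<le> ennreal (4 * K * (sqrt n * r powr (1 - \<alpha> / 2) + n powr s)) * ennreal (T' t powr (1 / p))" for t
  proof -
    have "(\<integral>\<^sup>+e. ennreal (K * (sqrt (layer_count I e t) * r powr (1 - \<alpha> / 2)
          + layer_count I e t powr (\<alpha> / (2 + \<alpha>)))) \<partial>\<mu>)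
        \<le> (\<integral>\<^sup>+e. ennreal (K * \<rho>) * ennreal (layer_count I e t powr \<theta>) + ennreal K * ennreal (layer_count I e t powr s) \<partial>\<mu>)"
      using le K \<rho> by (intro nn_integral_mono) (simp add: \<rho>_def ennreal_mult'[symmetric]
          ennreal_plus[symmetric] algebra_simps del: ennreal_plus)
    also have "\<dots> = ennreal (K * \<rho>) * (\<integral>\<^sup>+e. ennreal (layer_count I e t powr \<theta>) \<partial>\<mu>)
        + ennreal K * (\<integral>\<^sup>+e. ennreal (layer_count I e t powr s) \<partial>\<mu>)"
      using Nmeas by (simp add: nn_integral_add nn_integral_cmult)
    also have "\<dots> \<le> ennreal (K * \<rho>) * ennreal (2 * n powr \<theta> * T' t powr (1 / p))
        + ennreal K * ennreal (2 * n powr s * T' t powr (1 / p))"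
      using \<theta> s by (intro add_mono mult_left_mono moment) auto
    also have "\<dots> = ennreal (2 * K * (n powr \<theta> * \<rho> + n powr s) * T' t powr (1 / p))"
      using K \<rho> by (simp add: ennreal_mult'[symmetric] ennreal_plus[symmetric] algebra_simps del: ennreal_plus)
    also have "\<dots> \<le> ennreal (4 * K * (sqrt n * r powr (1 - \<alpha> / 2) + n powr s) * T' t powr (1 / p))"
    proof (intro ennreal_leI mult_right_mono)
      have "0 \<le> sqrt n * r powr (1 - \<alpha> / 2)" using n by simp
      then have "n powr \<theta> * \<rho> + n powr s \<le> 2 * (sqrt n * r powr (1 - \<alpha> / 2) + n powr s)"
        using le_n[folded \<rho>_def] by (simp add: distrib_left)
      then have "2 * K * (n powr \<theta> * \<rho> + n powr s) \<le> 2 * K * (2 * (sqrt n * r powr (1 - \<alpha> / 2) + n powr s))"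
        using K by (intro mult_left_mono) auto
      also have "\<dots> = 4 * K * (sqrt n * r powr (1 - \<alpha> / 2) + n powr s)"
        by (simp add: algebra_simps)
      finally show "2 * K * (n powr \<theta> * \<rho> + n powr s) \<le> \<dots>" .
    qed simp
    finally show ?thesis using K n by (simp add: ennreal_mult')
  qed
  have "(\<lambda>(e, t). ennreal (K * (sqrt (layer_count I e t) * r powr (1 - \<alpha> / 2)
      + layer_count I e t powr (\<alpha> / (2 + \<alpha>))))) \<in> borel_measurable (\<mu> \<Otimes>\<^sub>M lborel)"
    using joint unfolding case_prod_beta by measurable
  from Fubini'[OF this, symmetric]
  have "(\<integral>\<^sup>+e. \<integral>\<^sup>+t. ennreal (K * (sqrt (layer_count I e t) * r powr (1 - \<alpha> / 2)
          + layer_count I e t powr (\<alpha> / (2 + \<alpha>)))) \<partial>lborel \<partial>\<mu>)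
      = (\<integral>\<^sup>+t. \<integral>\<^sup>+e. ennreal (K * (sqrt (layer_count I e t) * r powr (1 - \<alpha> / 2)
          + layer_count I e t powr (\<alpha> / (2 + \<alpha>)))) \<partial>\<mu> \<partial>lborel)" by simp
  also have "\<dots> \<le> (\<integral>\<^sup>+t. ennreal (4 * K * (sqrt n * r powr (1 - \<alpha> / 2) + n powr s)) * ennreal (T' t powr (1 / p)) \<partial>lborel)"
    by (rule nn_integral_mono) (rule inner)
  also have "\<dots> = ennreal (4 * K * (sqrt n * r powr (1 - \<alpha> / 2) + n powr s)) * (\<integral>\<^sup>+t. ennreal (T' t powr (1 / p)) \<partial>lborel)"
  proof (rule nn_integral_cmult)
    have [measurable]: "T' \<in> borel_measurable borel" using T'meas by simp
    show "(\<lambda>t. ennreal (T' t powr (1 / p))) \<in> borel_measurable lborel" by measurable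
  qed
  also have "(\<integral>\<^sup>+t. ennreal (T' t powr (1 / p)) \<partial>lborel) = (\<integral>\<^sup>+t\<in>{0..}. ennreal (T t powr (1 / p)) \<partial>lborel)"
    using p by (intro nn_integral_cong) (auto simp: T'_def indicator_def)
  finally show ?thesis by (simp add: n_def)
qed

text \<open>The two situations in which the multiplier process is centred given one of its two sources of
  randomness; \<open>\<mu>\<close> is the joint law of the multipliers.\<close>

definition centered_multiplier :: "'x measure \<Rightarrow> nat set \<Rightarrow> ('x \<Rightarrow> real) set \<Rightarrow> (nat \<Rightarrow> real) measure \<Rightarrow> bool" where
  "centered_multiplier P I G \<mu> \<longleftrightarrow> (\<forall>h\<in>G. (\<integral>x. h x \<partial>P) = 0) \<or>
    (\<exists>\<nu>. prob_space \<nu> \<and> sets \<nu> = sets borel \<and> \<mu> = PiM I (\<lambda>_. \<nu>) \<and> integrable \<nu> (\<lambda>y. y) \<and> (\<integral>y. y \<partial>\<nu>) = 0)"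

context prob_space
begin

text \<open>Symmetrization is applied to the sample for fixed multipliers if the functions are centred, and
  to the multipliers for a fixed sample if these are independent and centred. It holds for each
  choice of signs and is then averaged over the signs.\<close>

lemma multiplier_symmetrize:
  fixes I :: "nat set"
  assumes \<mu>: "prob_space \<mu>" "sets \<mu> = sets (PiM I (\<lambda>_. borel))" and I: "finite I"
    and G: "finite G" "G \<noteq> {}" "G \<subseteq> Linf_unit M" and cent: "centered_multiplier M I G \<mu>"
  shows "(\<integral>\<^sup>+e. \<integral>\<^sup>+x. ennreal (MAX h\<in>G. \<bar>\<Sum>i\<in>I. e i * h (x i)\<bar>) \<partial>iid I M \<partial>\<mu>)
    \<le> 2 * (\<integral>\<^sup>+e. \<integral>\<^sup>+x. ennreal (rad_mean I (\<lambda>s. MAX h\<in>G. \<bar>\<Sum>i\<in>I. s i * (e i * h (x i))\<bar>)) \<partial>iid I M \<partial>\<mu>)"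
proof -
  interpret \<mu>: prob_space \<mu> by (rule \<mu>)
  interpret PI: prob_space "iid I M" by (rule prob_space_power)
  interpret pair: pair_sigma_finite \<mu> "iid I M" by standard
  let ?f = "\<lambda>c e x. ennreal (MAX h\<in>G. \<bar>\<Sum>i\<in>I. c i * (e i * h (x i))\<bar>)"
  let ?J = "\<lambda>g. \<integral>\<^sup>+e. \<integral>\<^sup>+x. g e x \<partial>iid I M \<partial>\<mu>"
  have coord: "(\<lambda>e. e i) \<in> borel_measurable \<mu>" if "i \<in> I" for i
    using measurable_component_singleton[OF that, of "\<lambda>_. borel"] \<mu>(2)
    by (simp cong: measurable_cong_sets)
  have meas: "(\<lambda>(e, x). ?f c e x) \<in> borel_measurable (\<mu> \<Otimes>\<^sub>M iid I M)" for c
  proof -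
    have "(\<lambda>z. fst z i * h (snd z i)) \<in> borel_measurable (\<mu> \<Otimes>\<^sub>M iid I M)"
      if [measurable]: "i \<in> I" and h: "h \<in> G" for i h
    proof (rule borel_measurable_times)
      show "(\<lambda>z. fst z i) \<in> borel_measurable (\<mu> \<Otimes>\<^sub>M iid I M)"
        by (rule measurable_compose[OF measurable_fst coord[OF that(1)]])
      have "(\<lambda>z. snd z i) \<in> measurable (\<mu> \<Otimes>\<^sub>M iid I M) M" by measurable
      moreover have "h \<in> borel_measurable M" using h G(3) by (auto simp: Linf_unit_def)
      ultimately show "(\<lambda>z. h (snd z i)) \<in> borel_measurable (\<mu> \<Otimes>\<^sub>M iid I M)"
        by (rule measurable_compose)
    qed
    then have "(\<lambda>z. \<bar>\<Sum>i\<in>I. c i * (fst z i * h (snd z i))\<bar>) \<in> borel_measurable (\<mu> \<Otimes>\<^sub>M iid I M)"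
      if "h \<in> G" for h
      using that by (intro borel_measurable_abs borel_measurable_sum
          borel_measurable_times[OF borel_measurable_const])
    then show ?thesis
      unfolding case_prod_beta by (intro measurable_compose[OF _ measurable_ennreal] borel_measurable_Max[OF G(1)])
  qed
  have meas_inner: "(\<lambda>e. \<integral>\<^sup>+x. ?f c e x \<partial>iid I M) \<in> borel_measurable \<mu>" for c
    using PI.borel_measurable_nn_integral[OF meas] .
  have swap: "?J (?f c) = (\<integral>\<^sup>+x. \<integral>\<^sup>+e. ?f c e x \<partial>\<mu> \<partial>iid I M)" for c
    using pair.Fubini'[OF meas[of c]] by simp
  have one: "?J (\<lambda>e x. ennreal (MAX h\<in>G. \<bar>\<Sum>i\<in>I. e i * h (x i)\<bar>)) \<le> 2 * ?J (?f (signs A))" if A: "A \<subseteq> I" for A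
    using cent unfolding centered_multiplier_def
  proof
    assume zero: "\<forall>h\<in>G. (\<integral>x. h x \<partial>M) = 0"
    have "?J (\<lambda>e x. ennreal (MAX h\<in>G. \<bar>\<Sum>i\<in>I. e i * h (x i)\<bar>))
        \<le> (\<integral>\<^sup>+e. 2 * (\<integral>\<^sup>+x. ?f (signs A) e x \<partial>iid I M) \<partial>\<mu>)"
    proof (rule nn_integral_mono)
      fix e
      show "(\<integral>\<^sup>+x. ennreal (MAX h\<in>G. \<bar>\<Sum>i\<in>I. e i * h (x i)\<bar>) \<partial>iid I M)
          \<le> 2 * (\<integral>\<^sup>+x. ?f (signs A) e x \<partial>iid I M)"
        using integrable_Linf_unit(1) G(3) zero
        by (intro nn_integral_symmetrize[OF I G(1,2) _ _ A, of "\<lambda>i h x. e i * h x"]) auto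
    qed
    also have "\<dots> = 2 * ?J (?f (signs A))" by (intro nn_integral_cmult meas_inner)
    finally show ?thesis .
  next
    assume "\<exists>\<nu>. prob_space \<nu> \<and> sets \<nu> = sets borel \<and> \<mu> = PiM I (\<lambda>_. \<nu>) \<and> integrable \<nu> (\<lambda>y. y) \<and> (\<integral>y. y \<partial>\<nu>) = 0"
    then obtain \<nu> where \<nu>: "prob_space \<nu>" "\<mu> = PiM I (\<lambda>_. \<nu>)" "integrable \<nu> (\<lambda>y. y)" "(\<integral>y. y \<partial>\<nu>) = (0::real)"
      by blast
    have "?J (\<lambda>e x. ennreal (MAX h\<in>G. \<bar>\<Sum>i\<in>I. e i * h (x i)\<bar>))
        = (\<integral>\<^sup>+x. \<integral>\<^sup>+e. ennreal (MAX h\<in>G. \<bar>\<Sum>i\<in>I. e i * h (x i)\<bar>) \<partial>\<mu> \<partial>iid I M)"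
      using swap[of "\<lambda>_. 1"] by simp
    also have "\<dots> \<le> (\<integral>\<^sup>+x. 2 * (\<integral>\<^sup>+e. ?f (signs A) e x \<partial>\<mu>) \<partial>iid I M)"
    proof (rule nn_integral_mono)
      fix x
      show "(\<integral>\<^sup>+e. ennreal (MAX h\<in>G. \<bar>\<Sum>i\<in>I. e i * h (x i)\<bar>) \<partial>\<mu>) \<le> 2 * (\<integral>\<^sup>+e. ?f (signs A) e x \<partial>\<mu>)"
        unfolding \<nu>(2) using \<nu>(3,4)
        by (intro prob_space.nn_integral_symmetrize[OF \<nu>(1) I G(1,2) _ _ A, of "\<lambda>i h y. y * h (x i)"]) auto
    qed
    also have "\<dots> = 2 * ?J (?f (signs A))"
    proof -
      have "(\<lambda>x. \<integral>\<^sup>+e. ?f (signs A) e x \<partial>\<mu>) \<in> borel_measurable (iid I M)"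
        using \<mu>.borel_measurable_nn_integral[OF measurable_pair_swap[OF meas[of "signs A"]]]
        by (simp add: case_prod_beta)
      then show ?thesis unfolding swap by (rule nn_integral_cmult)
    qed
    finally show ?thesis .
  qed
  define L where "L = ?J (\<lambda>e x. ennreal (MAX h\<in>G. \<bar>\<Sum>i\<in>I. e i * h (x i)\<bar>))"
  let ?R = "\<lambda>e x. ennreal (rad_mean I (\<lambda>s. MAX h\<in>G. \<bar>\<Sum>i\<in>I. s i * (e i * h (x i))\<bar>))"
  have avg: "(\<Sum>A\<in>Pow I. ?f (signs A) e x) = 2 ^ card I * ?R e x" for e x
  proof -
    have "(\<Sum>A\<in>Pow I. ?f (signs A) e x) = ennreal (\<Sum>A\<in>Pow I. MAX h\<in>G. \<bar>\<Sum>i\<in>I. signs A i * (e i * h (x i))\<bar>)"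
      using MAX_abs_nonneg[OF G(1,2)] by (intro sum_ennreal) auto
    also have "\<dots> = ennreal (2 ^ card I * rad_mean I (\<lambda>s. MAX h\<in>G. \<bar>\<Sum>i\<in>I. s i * (e i * h (x i))\<bar>))"
      by (simp add: rad_mean_def)
    finally show ?thesis by (simp add: ennreal_mult' ennreal_power[symmetric])
  qed
  have Rmeas: "(\<lambda>(e, x). ?R e x) \<in> borel_measurable (\<mu> \<Otimes>\<^sub>M iid I M)"
  proof -
    have "?R e x = (\<Sum>A\<in>Pow I. ?f (signs A) e x) / 2 ^ card I" for e x
      unfolding avg by (simp add: ennreal_mult_divide_eq mult.commute[of "2 ^ card I"] power_eq_top_ennreal)
    then show ?thesis using meas unfolding case_prod_beta by simp
  qed
  have "2 ^ card I * L = (\<Sum>A\<in>Pow I. L)"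
    using I by (simp add: card_Pow)
  also have "\<dots> \<le> (\<Sum>A\<in>Pow I. 2 * ?J (?f (signs A)))"
    unfolding L_def using one by (intro sum_mono) auto
  also have "\<dots> = 2 * (\<Sum>A\<in>Pow I. ?J (?f (signs A)))" by (simp add: sum_distrib_left)
  also have "(\<Sum>A\<in>Pow I. ?J (?f (signs A))) = (\<integral>\<^sup>+e. (\<Sum>A\<in>Pow I. \<integral>\<^sup>+x. ?f (signs A) e x \<partial>iid I M) \<partial>\<mu>)"
    using meas_inner by (intro nn_integral_sum[symmetric])
  also have "\<dots> = (\<integral>\<^sup>+e. \<integral>\<^sup>+x. 2 ^ card I * ?R e x \<partial>iid I M \<partial>\<mu>)"
  proof (rule nn_integral_cong)
    fix e assume e: "e \<in> space \<mu>"
    have "(\<lambda>x. ?f (signs A) e x) \<in> borel_measurable (iid I M)" for A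
      using measurable_compose_Pair1[OF e meas[of "signs A"]] by simp
    then show "(\<Sum>A\<in>Pow I. \<integral>\<^sup>+x. ?f (signs A) e x \<partial>iid I M) = (\<integral>\<^sup>+x. 2 ^ card I * ?R e x \<partial>iid I M)"
      unfolding avg[symmetric] by (intro nn_integral_sum[symmetric])
  qed
  also have "\<dots> = (\<integral>\<^sup>+e. 2 ^ card I * (\<integral>\<^sup>+x. ?R e x \<partial>iid I M) \<partial>\<mu>)"
    using measurable_compose_Pair1[OF _ Rmeas] by (intro nn_integral_cong nn_integral_cmult) simp
  also have "\<dots> = 2 ^ card I * ?J ?R"
    using PI.borel_measurable_nn_integral[OF Rmeas] by (intro nn_integral_cmult)
  finally have "2 ^ card I * L \<le> 2 ^ card I * (2 * ?J ?R)" by (simp add: mult_ac)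
  then have "L \<le> 2 * ?J ?R"
    by (subst (asm) ennreal_mult_le_mult_iff) (auto simp: power_eq_top_ennreal)
  then show ?thesis unfolding L_def .
qed

text \<open>The multiplier inequality. The summand \<open>sqrt n * r powr (1 - \<alpha> / 2)\<close> is the complexity of the
  class, and the other one combines the critical complexity with the tails of the multipliers.\<close>

lemma multiplier_bound:
  fixes I :: "nat set"
  assumes lcb: "local_complexity_bound M H \<alpha> K" and K: "0 \<le> K" and H: "H \<subseteq> Linf_unit M"
    and \<mu>: "prob_space \<mu>" "sets \<mu> = sets (PiM I (\<lambda>_. borel))" and I: "finite I" "I \<noteq> {}"
    and tail: "\<And>i t. i \<in> I \<Longrightarrow> 0 \<le> t \<Longrightarrow> measure \<mu> {e \<in> space \<mu>. t < \<bar>e i\<bar>} = T t"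
    and p: "1 \<le> p" and \<alpha>: "0 < \<alpha>" "\<alpha> < 2" and r: "0 < r" "r \<le> 1"
    and G: "finite G" "G \<subseteq> H" "(\<lambda>_. 0) \<in> G" and rad: "\<And>h. h \<in> G \<Longrightarrow> (\<integral>x. (h x)\<^sup>2 \<partial>M) \<le> r\<^sup>2"
    and cent: "centered_multiplier M I G \<mu>"
  shows "(\<integral>\<^sup>+e. \<integral>\<^sup>+x. ennreal (MAX h\<in>G. \<bar>\<Sum>i\<in>I. e i * h (x i)\<bar>) \<partial>iid I M \<partial>\<mu>)
    \<le> 2 * (ennreal (4 * K * (sqrt (real (card I)) * r powr (1 - \<alpha> / 2)
            + real (card I) powr (max (1 / p) (\<alpha> / (2 + \<alpha>)))))
       * (\<integral>\<^sup>+t\<in>{0..}. ennreal (T t powr (1 / p)) \<partial>lborel))"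
proof -
  have "G \<noteq> {}" "G \<subseteq> Linf_unit M" using G H by auto
  note multiplier_symmetrize[OF \<mu> I(1) G(1) this cent]
  also have "2 * (\<integral>\<^sup>+e. \<integral>\<^sup>+x. ennreal (rad_mean I (\<lambda>s. MAX h\<in>G. \<bar>\<Sum>i\<in>I. s i * (e i * h (x i))\<bar>)) \<partial>iid I M \<partial>\<mu>)
    \<le> 2 * (\<integral>\<^sup>+e. \<integral>\<^sup>+t. ennreal (K * (sqrt (layer_count I e t) * r powr (1 - \<alpha> / 2)
          + layer_count I e t powr (\<alpha> / (2 + \<alpha>)))) \<partial>lborel \<partial>\<mu>)"
    by (intro mult_left_mono nn_integral_mono signed_multiplier_le[OF lcb K H I(1) G r rad]) auto
  also have "\<dots> \<le> 2 * (ennreal (4 * K * (sqrt (real (card I)) * r powr (1 - \<alpha> / 2)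
            + real (card I) powr (max (1 / p) (\<alpha> / (2 + \<alpha>)))))
       * (\<integral>\<^sup>+t\<in>{0..}. ennreal (T t powr (1 / p)) \<partial>lborel))"
    by (intro mult_left_mono expected_layer_bound[OF \<mu> I tail p \<alpha> r K]) auto
  finally show ?thesis .
qed

end

section \<open>Localization of the least squares process\<close>

text \<open>Twice the noise part of the risk plus the deviation of the empirical from the true squared
  norm: together they bound \<open>n\<close> times the squared error of a least squares estimate.\<close>

definition lse_process :: "'x measure \<Rightarrow> nat set \<Rightarrow> ('x \<Rightarrow> real) \<Rightarrow> (nat \<Rightarrow> real) \<Rightarrow> (nat \<Rightarrow> 'x) \<Rightarrow> real" where
  "lse_process P I h e x =
     2 * \<bar>\<Sum>i\<in>I. e i * h (x i)\<bar> + \<bar>\<Sum>i\<in>I. (h (x i))\<^sup>2 - (\<integral>y. (h y)\<^sup>2 \<partial>P)\<bar>"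

definition local_class :: "'x measure \<Rightarrow> ('x \<Rightarrow> real) set \<Rightarrow> real \<Rightarrow> ('x \<Rightarrow> real) set" where
  "local_class P H r = {h \<in> H. (\<integral>x. (h x)\<^sup>2 \<partial>P) \<le> r\<^sup>2}"

text \<open>The basic inequality: comparing the risks of \<open>f\<close> and \<open>f0\<close>, the squares of the errors cancel.\<close>

lemma lse_basic_inequality:
  assumes n: "1 \<le> n" and lse: "least_squares_estimate n F x y f" and f0: "f0 \<in> F"
    and model: "\<And>i. i \<in> {1..n} \<Longrightarrow> y i = f0 (x i) + e i"
  shows "real n * (\<integral>z. (f z - f0 z)\<^sup>2 \<partial>P) \<le> lse_process P {1..n} (\<lambda>z. f z - f0 z) e x"
proof -
  define h where "h = (\<lambda>z. f z - f0 z)"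
  have "empirical_risk n x y f \<le> empirical_risk n x y f0"
    using lse f0 by (auto simp: least_squares_estimate_def is_arg_min_def not_less)
  then have "(\<Sum>i=1..n. (y i - f (x i))\<^sup>2) \<le> (\<Sum>i=1..n. (y i - f0 (x i))\<^sup>2)"
    using n by (simp add: empirical_risk_def divide_right_mono_neg field_simps)
  also have "\<dots> = (\<Sum>i=1..n. (e i)\<^sup>2)"
    using model by (intro sum.cong) auto
  also have "(\<Sum>i=1..n. (y i - f (x i))\<^sup>2) = (\<Sum>i=1..n. (e i)\<^sup>2 - 2 * (e i * h (x i)) + (h (x i))\<^sup>2)"
    using model by (intro sum.cong refl) (simp add: h_def power2_eq_square algebra_simps)
  also have "\<dots> = (\<Sum>i=1..n. (e i)\<^sup>2) - 2 * (\<Sum>i=1..n. e i * h (x i)) + (\<Sum>i=1..n. (h (x i))\<^sup>2)"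
    by (simp add: sum.distrib sum_subtractf sum_distrib_left)
  finally have "(\<Sum>i=1..n. (h (x i))\<^sup>2) \<le> 2 * (\<Sum>i=1..n. e i * h (x i))" by simp
  moreover have "(\<Sum>i=1..n. (h (x i))\<^sup>2 - (\<integral>z. (h z)\<^sup>2 \<partial>P))
      = (\<Sum>i=1..n. (h (x i))\<^sup>2) - real n * (\<integral>z. (h z)\<^sup>2 \<partial>P)"
    by (simp add: sum_subtractf)
  moreover have "2 * (\<Sum>i=1..n. e i * h (x i)) \<le> 2 * \<bar>\<Sum>i=1..n. e i * h (x i)\<bar>" by simp
  ultimately have "real n * (\<integral>z. (h z)\<^sup>2 \<partial>P) \<le> lse_process P {1..n} h e x"
    unfolding lse_process_def by linarith
  then show ?thesis by (simp add: h_def)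
qed

text \<open>The rate \<open>\<delta>\<close> is the radius at which all parts of the local bound are at most \<open>n * \<delta>\<^sup>2\<close>.\<close>

lemma lse_rate_facts:
  assumes n: "1 \<le> n" and p: "1 \<le> p" and \<alpha>: "0 < \<alpha>"
  defines "\<delta> \<equiv> lse_rate \<alpha> p n"
  shows "0 < \<delta>" "\<delta> \<le> 1" "real n powr (max (1 / p) (\<alpha> / (2 + \<alpha>))) \<le> real n * \<delta>\<^sup>2"
    "sqrt (real n) * \<delta> powr (1 - \<alpha> / 2) \<le> real n * \<delta>\<^sup>2"
proof -
  define k where "k = real n"
  have k: "1 \<le> k" "0 < k" using n by (simp_all add: k_def)
  have \<delta>: "\<delta> = max (k powr (- 1 / (2 + \<alpha>))) (k powr (- 1 / 2 + 1 / (2 * p)))"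
    by (simp add: \<delta>_def lse_rate_def k_def)
  show pos: "0 < \<delta>" using k by (simp add: \<delta> less_max_iff_disj)
  have "- 1 / 2 + 1 / (2 * p) \<le> 0" "- 1 / (2 + \<alpha>) \<le> 0" using p \<alpha> by (simp_all add: field_simps)
  then have "k powr (- 1 / 2 + 1 / (2 * p)) \<le> k powr 0" "k powr (- 1 / (2 + \<alpha>)) \<le> k powr 0"
    using k by (intro powr_mono; simp)+
  then show "\<delta> \<le> 1" using k by (simp add: \<delta>)
  have sq: "k * (k powr c)\<^sup>2 = k powr (1 + 2 * c)" for c
  proof -
    have "(k powr c)\<^sup>2 = k powr (2 * c)" by (simp add: power2_eq_square powr_add[symmetric])
    moreover have "k = k powr 1" using k by simp
    ultimately show ?thesis by (metis powr_add)
  qed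
  have sq_le: "k * c\<^sup>2 \<le> k * \<delta>\<^sup>2" if "0 \<le> c" "c \<le> \<delta>" for c
    using that k by (intro mult_left_mono power_mono) auto
  have "1 + 2 * (- 1 / (2 + \<alpha>)) = \<alpha> / (2 + \<alpha>)" using \<alpha> by (simp add: field_simps)
  then have 1: "k powr (\<alpha> / (2 + \<alpha>)) \<le> k * \<delta>\<^sup>2"
    using sq[of "- 1 / (2 + \<alpha>)"] sq_le[of "k powr (- 1 / (2 + \<alpha>))"] by (simp add: \<delta>)
  have "1 + 2 * (- 1 / 2 + 1 / (2 * p)) = 1 / p" using p by (simp add: field_simps)
  then have 2: "k powr (1 / p) \<le> k * \<delta>\<^sup>2"
    using sq[of "- 1 / 2 + 1 / (2 * p)"] sq_le[of "k powr (- 1 / 2 + 1 / (2 * p))"] by (simp add: \<delta>)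
  from 1 2 have "k powr (max (1 / p) (\<alpha> / (2 + \<alpha>))) \<le> k * \<delta>\<^sup>2" by (simp add: max_def)
  then show "real n powr (max (1 / p) (\<alpha> / (2 + \<alpha>))) \<le> real n * \<delta>\<^sup>2" by (simp add: k_def)
  have "1 \<le> sqrt k * \<delta> powr (1 + \<alpha> / 2)"
  proof -
    have e: "1 / 2 + - 1 / (2 + \<alpha>) * (1 + \<alpha> / 2) = 0" using \<alpha> by (simp add: field_simps)
    have "1 = k powr (1 / 2 + - 1 / (2 + \<alpha>) * (1 + \<alpha> / 2))" unfolding e using k by simp
    also have "\<dots> = sqrt k * (k powr (- 1 / (2 + \<alpha>))) powr (1 + \<alpha> / 2)"
      using k by (subst powr_add) (simp only: powr_powr powr_half_sqrt less_imp_le)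
    also have "\<dots> \<le> sqrt k * \<delta> powr (1 + \<alpha> / 2)"
      using \<alpha> k by (intro mult_left_mono powr_mono2) (auto simp: \<delta>)
    finally show ?thesis .
  qed
  then have "sqrt k * \<delta> powr (1 - \<alpha> / 2) * 1 \<le> sqrt k * \<delta> powr (1 - \<alpha> / 2) * (sqrt k * \<delta> powr (1 + \<alpha> / 2))"
    using k by (intro mult_left_mono) auto
  also have "\<dots> = (sqrt k * sqrt k) * (\<delta> powr (1 - \<alpha> / 2) * \<delta> powr (1 + \<alpha> / 2))" by simp
  also have "\<delta> powr (1 - \<alpha> / 2) * \<delta> powr (1 + \<alpha> / 2) = \<delta>\<^sup>2"
    using pos by (simp add: powr_add[symmetric])
  finally show "sqrt (real n) * \<delta> powr (1 - \<alpha> / 2) \<le> real n * \<delta>\<^sup>2" using k by (simp add: k_def)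
qed

context prob_space
begin

lemma expected_local_Max:
  fixes I :: "nat set"
  assumes lcb: "local_complexity_bound M H \<alpha> K" and K: "0 \<le> K" and H: "H \<subseteq> Linf_unit M"
    and \<mu>: "prob_space \<mu>" "sets \<mu> = sets (PiM I (\<lambda>_. borel))" and I: "finite I" "I \<noteq> {}"
    and tail: "\<And>i t. i \<in> I \<Longrightarrow> 0 \<le> t \<Longrightarrow> measure \<mu> {e \<in> space \<mu>. t < \<bar>e i\<bar>} = T t"
    and \<Lambda>: "(\<integral>\<^sup>+t\<in>{0..}. ennreal (T t powr (1 / p)) \<partial>lborel) = ennreal \<Lambda>" "0 \<le> \<Lambda>"
    and p: "1 \<le> p" and \<alpha>: "0 < \<alpha>" "\<alpha> < 2" and r: "0 < r" "r \<le> 1"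
    and G: "finite G" "G \<subseteq> local_class M H r" "(\<lambda>_. 0) \<in> G" and cent: "centered_multiplier M I G \<mu>"
  defines "s \<equiv> max (1 / p) (\<alpha> / (2 + \<alpha>))"
  shows "(\<integral>\<^sup>+z. ennreal (MAX h\<in>G. lse_process M I h (fst z) (snd z)) \<partial>(\<mu> \<Otimes>\<^sub>M iid I M))
    \<le> ennreal ((16 * K * \<Lambda> + 8 * K + 4) * (sqrt (real (card I)) * r powr (1 - \<alpha> / 2) + real (card I) powr s))"
    and "h \<in> H \<Longrightarrow> (\<lambda>z. lse_process M I h (fst z) (snd z)) \<in> borel_measurable (\<mu> \<Otimes>\<^sub>M iid I M)"
proof -
  interpret \<mu>: prob_space \<mu> by (rule \<mu>)
  interpret PI: prob_space "iid I M" by (rule prob_space_power)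
  interpret pair: pair_sigma_finite \<mu> "iid I M" by standard
  let ?Q = "\<mu> \<Otimes>\<^sub>M iid I M"
  define k where "k = real (card I)"
  have k: "1 \<le> k" using I by (simp add: k_def Suc_leI card_gt_0_iff)
  have GH: "G \<subseteq> H" and rad: "\<And>h. h \<in> G \<Longrightarrow> (\<integral>x. (h x)\<^sup>2 \<partial>M) \<le> r\<^sup>2"
    using G(2) by (auto simp: local_class_def)
  have ne: "G \<noteq> {}" and GL: "G \<subseteq> Linf_unit M" using G(3) GH H by auto
  let ?a = "\<lambda>h z. \<Sum>i\<in>I. fst z i * h (snd z i)" and ?b = "\<lambda>h z. \<Sum>i\<in>I. (h (snd z i))\<^sup>2 - (\<integral>y. (h y)\<^sup>2 \<partial>M)"
  have coord: "(\<lambda>e. e i) \<in> borel_measurable \<mu>" if "i \<in> I" for i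
    using measurable_component_singleton[OF that, of "\<lambda>_. borel"] \<mu>(2)
    by (simp cong: measurable_cong_sets)
  have hm: "(\<lambda>z. h (snd z i)) \<in> borel_measurable ?Q" if "h \<in> H" "i \<in> I" for h i
  proof -
    have "(\<lambda>z. snd z i) \<in> measurable ?Q M"
      by (rule measurable_compose[OF measurable_snd measurable_component_singleton[OF that(2)]])
    moreover have "h \<in> borel_measurable M" using that(1) H by (auto simp: Linf_unit_def)
    ultimately show ?thesis by (rule measurable_compose)
  qed
  have am: "?a h \<in> borel_measurable ?Q" and bm: "?b h \<in> borel_measurable ?Q" if "h \<in> H" for h
    using hm[OF that] measurable_compose[OF measurable_fst coord]
    by (auto intro!: borel_measurable_sum borel_measurable_times)
  show meas: "(\<lambda>z. lse_process M I h (fst z) (snd z)) \<in> borel_measurable ?Q" if "h \<in> H" for h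
    unfolding lse_process_def using am[OF that] bm[OF that] by measurable
  have amax: "(\<lambda>z. MAX h\<in>G. \<bar>?a h z\<bar>) \<in> borel_measurable ?Q"
    using am GH by (intro borel_measurable_Max[OF G(1)] borel_measurable_abs) auto
  have bmax: "(\<lambda>z. MAX h\<in>G. \<bar>?b h z\<bar>) \<in> borel_measurable ?Q"
    using bm GH by (intro borel_measurable_Max[OF G(1)] borel_measurable_abs) auto
  have "(\<integral>\<^sup>+z. ennreal (MAX h\<in>G. lse_process M I h (fst z) (snd z)) \<partial>?Q)
      \<le> (\<integral>\<^sup>+z. 2 * ennreal (MAX h\<in>G. \<bar>?a h z\<bar>) + ennreal (MAX h\<in>G. \<bar>?b h z\<bar>) \<partial>?Q)"
  proof (rule nn_integral_mono)
    fix z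
    have "(MAX h\<in>G. lse_process M I h (fst z) (snd z)) \<le> 2 * (MAX h\<in>G. \<bar>?a h z\<bar>) + (MAX h\<in>G. \<bar>?b h z\<bar>)"
      unfolding lse_process_def
      by (intro MAX_le[OF G(1) ne] add_mono mult_left_mono MAX_ge[OF G(1), of _ "\<lambda>h. \<bar>?a h z\<bar>"]
          MAX_ge[OF G(1), of _ "\<lambda>h. \<bar>?b h z\<bar>"]) auto
    then have "ennreal (MAX h\<in>G. lse_process M I h (fst z) (snd z))
        \<le> ennreal (2 * (MAX h\<in>G. \<bar>?a h z\<bar>) + (MAX h\<in>G. \<bar>?b h z\<bar>))" by (rule ennreal_leI)
    also have "\<dots> = 2 * ennreal (MAX h\<in>G. \<bar>?a h z\<bar>) + ennreal (MAX h\<in>G. \<bar>?b h z\<bar>)"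
      using MAX_abs_nonneg[OF G(1) ne, of "\<lambda>h. ?a h z"] MAX_abs_nonneg[OF G(1) ne, of "\<lambda>h. ?b h z"]
      by (simp add: ennreal_mult')
    finally show "ennreal (MAX h\<in>G. lse_process M I h (fst z) (snd z))
        \<le> 2 * ennreal (MAX h\<in>G. \<bar>?a h z\<bar>) + ennreal (MAX h\<in>G. \<bar>?b h z\<bar>)" .
  qed
  also have "\<dots> = 2 * (\<integral>\<^sup>+z. ennreal (MAX h\<in>G. \<bar>?a h z\<bar>) \<partial>?Q) + (\<integral>\<^sup>+z. ennreal (MAX h\<in>G. \<bar>?b h z\<bar>) \<partial>?Q)"
    using amax bmax by (simp add: nn_integral_add nn_integral_cmult)
  also have "(\<integral>\<^sup>+z. ennreal (MAX h\<in>G. \<bar>?a h z\<bar>) \<partial>?Q)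
      = (\<integral>\<^sup>+e. \<integral>\<^sup>+x. ennreal (MAX h\<in>G. \<bar>\<Sum>i\<in>I. e i * h (x i)\<bar>) \<partial>iid I M \<partial>\<mu>)"
    using PI.nn_integral_fst[of "\<lambda>z. ennreal (MAX h\<in>G. \<bar>?a h z\<bar>)" \<mu>] amax by simp
  also have "\<dots> \<le> 2 * (ennreal (4 * K * (sqrt k * r powr (1 - \<alpha> / 2) + k powr s)) * ennreal \<Lambda>)"
    unfolding k_def s_def \<Lambda>(1)[symmetric]
    by (rule multiplier_bound[OF lcb K H \<mu> I tail p \<alpha> r G(1) GH G(3) rad cent])
  also have "\<dots> = ennreal (8 * K * \<Lambda> * (sqrt k * r powr (1 - \<alpha> / 2) + k powr s))"
    using K \<Lambda>(2) k by (simp add: ennreal_mult'[symmetric] ennreal_mult''[symmetric] mult_ac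
        ennreal_numeral[symmetric] del: ennreal_numeral)
  also have "(\<integral>\<^sup>+z. ennreal (MAX h\<in>G. \<bar>?b h z\<bar>) \<partial>?Q)
      = (\<integral>\<^sup>+e. \<integral>\<^sup>+x. ennreal (MAX h\<in>G. \<bar>\<Sum>i\<in>I. (h (x i))\<^sup>2 - (\<integral>y. (h y)\<^sup>2 \<partial>M)\<bar>) \<partial>iid I M \<partial>\<mu>)"
    using PI.nn_integral_fst[of "\<lambda>z. ennreal (MAX h\<in>G. \<bar>?b h z\<bar>)" \<mu>] bmax by simp
  also have "\<dots> \<le> ennreal (8 * rad_complexity M I G + 4 * r\<^sup>2 * sqrt k)"
    using expected_Max_square_deviation[OF I(1) G(1) GL G(3) rad]
    by (simp add: \<mu>.emeasure_space_1 k_def)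
  also have "\<dots> \<le> ennreal ((8 * K + 4) * (sqrt k * r powr (1 - \<alpha> / 2) + k powr s))"
  proof (rule ennreal_leI)
    have "rad_complexity M I G \<le> K * (sqrt k * r powr (1 - \<alpha> / 2) + k powr (\<alpha> / (2 + \<alpha>)))"
      using lcb I G GH r rad unfolding local_complexity_bound_def k_def by blast
    also have "\<dots> \<le> K * (sqrt k * r powr (1 - \<alpha> / 2) + k powr s)"
      using K k by (intro mult_left_mono add_left_mono powr_mono) (auto simp: s_def)
    finally have 1: "8 * rad_complexity M I G \<le> 8 * (K * (sqrt k * r powr (1 - \<alpha> / 2) + k powr s))" by simp
    have "r\<^sup>2 = r powr 2" using r by simp
    also have "\<dots> \<le> r powr (1 - \<alpha> / 2)" using r \<alpha> by (intro powr_mono') auto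
    finally have "sqrt k * r\<^sup>2 \<le> sqrt k * r powr (1 - \<alpha> / 2)" using k by (intro mult_left_mono) auto
    moreover have "0 \<le> k powr s" by simp
    ultimately have "sqrt k * r\<^sup>2 \<le> sqrt k * r powr (1 - \<alpha> / 2) + k powr s" by linarith
    with 1 show "8 * rad_complexity M I G + 4 * r\<^sup>2 * sqrt k
        \<le> (8 * K + 4) * (sqrt k * r powr (1 - \<alpha> / 2) + k powr s)"
      by (simp add: distrib_right mult_ac)
  qed
  also have "2 * ennreal (8 * K * \<Lambda> * (sqrt k * r powr (1 - \<alpha> / 2) + k powr s))
      + ennreal ((8 * K + 4) * (sqrt k * r powr (1 - \<alpha> / 2) + k powr s))
      = ennreal ((16 * K * \<Lambda> + 8 * K + 4) * (sqrt k * r powr (1 - \<alpha> / 2) + k powr s))"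
  proof -
    let ?y = "sqrt k * r powr (1 - \<alpha> / 2) + k powr s"
    have y: "0 \<le> ?y" using k by simp
    have "2 * ennreal (8 * K * \<Lambda> * ?y) = ennreal (2 * (8 * K * \<Lambda> * ?y))"
      using ennreal_mult'[of 2 "8 * K * \<Lambda> * ?y"] by (simp only: ennreal_numeral)
    moreover have "ennreal (2 * (8 * K * \<Lambda> * ?y)) + ennreal ((8 * K + 4) * ?y)
        = ennreal (2 * (8 * K * \<Lambda> * ?y) + (8 * K + 4) * ?y)"
      using K \<Lambda>(2) y by (intro ennreal_plus[symmetric]) auto
    moreover have "2 * (8 * K * \<Lambda> * ?y) + (8 * K + 4) * ?y = (16 * K * \<Lambda> + 8 * K + 4) * ?y"
      by (simp only: distrib_right)
    ultimately show ?thesis by simp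
  qed
  finally show "(\<integral>\<^sup>+z. ennreal (MAX h\<in>G. lse_process M I h (fst z) (snd z)) \<partial>?Q)
    \<le> ennreal ((16 * K * \<Lambda> + 8 * K + 4) * (sqrt (real (card I)) * r powr (1 - \<alpha> / 2) + real (card I) powr s))"
    by (simp add: k_def add_mono mult_left_mono)
qed

text \<open>A countable class is exhausted by an increasing sequence of finite ones containing zero, to
  which the bound passes by monotone convergence.\<close>

lemma expected_local_sup:
  fixes I :: "nat set"
  assumes lcb: "local_complexity_bound M H \<alpha> K" and K: "0 \<le> K" and H: "H \<subseteq> Linf_unit M" "countable H" "(\<lambda>_. 0) \<in> H"
    and \<mu>: "prob_space \<mu>" "sets \<mu> = sets (PiM I (\<lambda>_. borel))" and I: "finite I" "I \<noteq> {}"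
    and tail: "\<And>i t. i \<in> I \<Longrightarrow> 0 \<le> t \<Longrightarrow> measure \<mu> {e \<in> space \<mu>. t < \<bar>e i\<bar>} = T t"
    and \<Lambda>: "(\<integral>\<^sup>+t\<in>{0..}. ennreal (T t powr (1 / p)) \<partial>lborel) = ennreal \<Lambda>" "0 \<le> \<Lambda>"
    and p: "1 \<le> p" and \<alpha>: "0 < \<alpha>" "\<alpha> < 2" and r: "0 < r" "r \<le> 1" and cent: "centered_multiplier M I H \<mu>"
  defines "s \<equiv> max (1 / p) (\<alpha> / (2 + \<alpha>))"
  shows "(\<integral>\<^sup>+z. (SUP h\<in>local_class M H r. ennreal (lse_process M I h (fst z) (snd z))) \<partial>(\<mu> \<Otimes>\<^sub>M iid I M))
    \<le> ennreal ((16 * K * \<Lambda> + 8 * K + 4) * (sqrt (real (card I)) * r powr (1 - \<alpha> / 2) + real (card I) powr s))"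
    and "(\<lambda>z. SUP h\<in>local_class M H r. ennreal (lse_process M I h (fst z) (snd z)))
      \<in> borel_measurable (\<mu> \<Otimes>\<^sub>M iid I M)"
proof -
  let ?Q = "\<mu> \<Otimes>\<^sub>M iid I M" and ?L = "local_class M H r"
  let ?p = "\<lambda>h z. lse_process M I h (fst z) (snd z)"
  have L: "countable ?L" "(\<lambda>_. 0) \<in> ?L" "?L \<subseteq> H"
    using H by (auto simp: local_class_def)
  have Lne: "?L \<noteq> {}" using L(2) by auto
  define g where "g = from_nat_into ?L"
  have g: "range g = ?L" unfolding g_def by (rule range_from_nat_into[OF Lne L(1)])
  define G where "G m = insert (\<lambda>_. 0) (g ` {..m})" for m :: nat
  have G: "finite (G m)" "G m \<subseteq> ?L" "(\<lambda>_. 0) \<in> G m" "G m \<noteq> {}" for m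
    using L g by (auto simp: G_def)
  have UG: "(\<Union>m. G m) = ?L"
  proof (intro antisym UN_least G(2) subsetI)
    fix h assume "h \<in> ?L"
    then obtain j where "h = g j" using g by auto
    then show "h \<in> (\<Union>m. G m)" by (auto simp: G_def)
  qed
  have Gmono: "G m \<subseteq> G m'" if "m \<le> m'" for m m' using that by (auto simp: G_def)
  have cent': "centered_multiplier M I (G m) \<mu>" for m
    using cent G(2)[of m] L(3) by (auto simp: centered_multiplier_def)
  note MB = expected_local_Max[OF lcb K H(1) \<mu> I tail \<Lambda> p \<alpha> r G(1-3) cent', folded s_def]
  have pm: "(\<lambda>z. ?p h z) \<in> borel_measurable ?Q" if "h \<in> H" for h by (rule MB(2)) (use that in simp_all)
  show "(\<lambda>z. SUP h\<in>?L. ennreal (?p h z)) \<in> borel_measurable ?Q"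
    using L pm by (intro borel_measurable_SUP measurable_compose[OF _ measurable_ennreal]) auto
  have SUP_eq: "(SUP h\<in>?L. ennreal (?p h z)) = (SUP m. ennreal (MAX h\<in>G m. ?p h z))" for z
  proof (rule antisym)
    show "(SUP h\<in>?L. ennreal (?p h z)) \<le> (SUP m. ennreal (MAX h\<in>G m. ?p h z))"
    proof (rule SUP_least)
      fix h assume "h \<in> ?L"
      then obtain m where "h \<in> G m" using UG by auto
      then have "ennreal (?p h z) \<le> ennreal (MAX h\<in>G m. ?p h z)"
        using MAX_ge[OF G(1), of h m "\<lambda>h. ?p h z"] by (intro ennreal_leI)
      also have "\<dots> \<le> (SUP m. ennreal (MAX h\<in>G m. ?p h z))" by (rule SUP_upper) simp
      finally show "ennreal (?p h z) \<le> (SUP m. ennreal (MAX h\<in>G m. ?p h z))" .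
    qed
    show "(SUP m. ennreal (MAX h\<in>G m. ?p h z)) \<le> (SUP h\<in>?L. ennreal (?p h z))"
    proof (rule SUP_least)
      fix m
      obtain h where "h \<in> G m" "(MAX h\<in>G m. ?p h z) = ?p h z" using MAX_attained[OF G(1,4)] .
      then show "ennreal (MAX h\<in>G m. ?p h z) \<le> (SUP h\<in>?L. ennreal (?p h z))"
        using G(2) by (auto intro!: SUP_upper)
    qed
  qed
  have "(\<integral>\<^sup>+z. (SUP h\<in>?L. ennreal (?p h z)) \<partial>?Q) = (SUP m. \<integral>\<^sup>+z. ennreal (MAX h\<in>G m. ?p h z) \<partial>?Q)"
    unfolding SUP_eq
  proof (rule nn_integral_monotone_convergence_SUP)
    show "incseq (\<lambda>m z. ennreal (MAX h\<in>G m. ?p h z))"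
    proof (intro incseq_SucI le_funI ennreal_leI)
      fix m z
      show "(MAX h\<in>G m. ?p h z) \<le> (MAX h\<in>G (Suc m). ?p h z)"
        using G Gmono[of m "Suc m"] by (intro Max_mono image_mono) auto
    qed
    show "(\<lambda>z. ennreal (MAX h\<in>G m. ?p h z)) \<in> borel_measurable ?Q" for m
      using pm G(2)[of m] L(3) by (intro measurable_compose[OF _ measurable_ennreal] borel_measurable_Max[OF G(1)]) auto
  qed
  also have "\<dots> \<le> ennreal ((16 * K * \<Lambda> + 8 * K + 4)
      * (sqrt (real (card I)) * r powr (1 - \<alpha> / 2) + real (card I) powr s))"
    by (rule SUP_least) (rule MB(1))
  finally show "(\<integral>\<^sup>+z. (SUP h\<in>?L. ennreal (?p h z)) \<partial>?Q) \<le> \<dots>" .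
qed

end

section \<open>Peeling\<close>

text \<open>The contribution of the shell of radius \<open>2 ^ j * \<delta>\<close>. At the rate \<open>\<delta>\<close> both parts of the local
  bound are at most \<open>n * \<delta>\<^sup>2\<close>, and they grow by at most \<open>2 powr (1 - \<alpha> / 2)\<close> from shell to shell,
  which is less than the factor 2 gained in the denominator.\<close>

lemma peeling_term:
  fixes n \<delta> C N \<alpha> :: real
  assumes n: "0 < n" and \<delta>: "0 < \<delta>" and \<alpha>: "0 < \<alpha>" "\<alpha> < 2" and C: "0 \<le> C"
    and N: "N \<le> n * \<delta>\<^sup>2" and crit: "sqrt n * \<delta> powr (1 - \<alpha> / 2) \<le> n * \<delta>\<^sup>2"
  shows "C * (sqrt n * min 1 (2 ^ Suc j * \<delta>) powr (1 - \<alpha> / 2) + N) / (n * (2 ^ j * \<delta>))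
    \<le> 3 * C * \<delta> * (2 powr (- \<alpha> / 2)) ^ j"
proof -
  define q where "q = (2::real) powr (- \<alpha> / 2)"
  have q: "1 / 2 \<le> q" "q \<le> 1"
  proof -
    have "(2::real) powr (-1) \<le> q" unfolding q_def using \<alpha> by (intro powr_mono) auto
    then show "1 / 2 \<le> q" by (simp add: powr_minus_divide)
    have "q \<le> 2 powr 0" unfolding q_def using \<alpha> by (intro powr_mono) auto
    then show "q \<le> 1" by simp
  qed
  have pw: "(2 ^ Suc j :: real) powr (1 - \<alpha> / 2) \<le> 2 * 2 ^ j * q ^ j"
  proof -
    have "((2::real) ^ Suc j) powr (1 - \<alpha> / 2) = (2 ^ Suc j) powr 1 * (2 ^ Suc j) powr (- \<alpha> / 2)"
      unfolding powr_add[symmetric] by simp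
    also have "((2::real) ^ Suc j) powr (- \<alpha> / 2) = q ^ Suc j"
    proof -
      have "((2::real) ^ Suc j) powr (- \<alpha> / 2) = 2 powr (real (Suc j) * (- \<alpha> / 2))"
        by (simp only: powr_realpow[symmetric, of 2, simplified] powr_powr)
      also have "\<dots> = q ^ Suc j" unfolding q_def by (subst powr_power) auto
      finally show ?thesis .
    qed
    also have "q ^ Suc j \<le> q ^ j" using q by (intro power_decreasing) auto
    finally show ?thesis by simp
  qed
  have "min 1 (2 ^ Suc j * \<delta>) powr (1 - \<alpha> / 2) \<le> (2 ^ Suc j * \<delta>) powr (1 - \<alpha> / 2)"
    using \<delta> \<alpha> by (intro powr_mono2) auto
  also have "\<dots> = (2 ^ Suc j) powr (1 - \<alpha> / 2) * \<delta> powr (1 - \<alpha> / 2)"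
    using \<delta> by (intro powr_mult)
  also have "\<dots> \<le> 2 * 2 ^ j * q ^ j * \<delta> powr (1 - \<alpha> / 2)"
    by (intro mult_right_mono pw) simp
  finally have "sqrt n * min 1 (2 ^ Suc j * \<delta>) powr (1 - \<alpha> / 2)
      \<le> sqrt n * (2 * 2 ^ j * q ^ j * \<delta> powr (1 - \<alpha> / 2))"
    using n by (intro mult_left_mono) auto
  also have "\<dots> = 2 * 2 ^ j * q ^ j * (sqrt n * \<delta> powr (1 - \<alpha> / 2))" by simp
  also have "\<dots> \<le> 2 * 2 ^ j * q ^ j * (n * \<delta>\<^sup>2)"
    using q crit by (intro mult_left_mono) auto
  finally have 1: "sqrt n * min 1 (2 ^ Suc j * \<delta>) powr (1 - \<alpha> / 2) \<le> 2 * 2 ^ j * q ^ j * (n * \<delta>\<^sup>2)" .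
  have "1 \<le> (2 * q) ^ j" using q by (intro one_le_power) auto
  then have "1 * (n * \<delta>\<^sup>2) \<le> (2 * q) ^ j * (n * \<delta>\<^sup>2)" using n by (intro mult_right_mono) auto
  then have 2: "N \<le> 2 ^ j * q ^ j * (n * \<delta>\<^sup>2)" using N by (simp add: power_mult_distrib)
  have "sqrt n * min 1 (2 ^ Suc j * \<delta>) powr (1 - \<alpha> / 2) + N
      \<le> 2 * 2 ^ j * q ^ j * (n * \<delta>\<^sup>2) + 2 ^ j * q ^ j * (n * \<delta>\<^sup>2)"
    by (rule add_mono[OF 1 2])
  also have "\<dots> = 3 * \<delta> * q ^ j * (n * (2 ^ j * \<delta>))"
    by (simp add: power2_eq_square)
  finally have "C * (sqrt n * min 1 (2 ^ Suc j * \<delta>) powr (1 - \<alpha> / 2) + N)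
      \<le> C * (3 * \<delta> * q ^ j * (n * (2 ^ j * \<delta>)))"
    using C by (rule mult_left_mono)
  then show ?thesis using n \<delta> by (simp add: divide_le_eq q_def mult_ac)
qed

context prob_space
begin

text \<open>If the error \<open>Z\<close> exceeds \<open>\<delta>\<close>, it lies in some shell \<open>2 ^ j * \<delta> < Z \<le> 2 ^ Suc j * \<delta>\<close>, and dividing the
  basic inequality by \<open>n * Z\<close> bounds \<open>Z\<close> itself by the local supremum of that shell over
  \<open>n * 2 ^ j * \<delta>\<close>. Adding up all shells gives a bound that can be integrated.\<close>

lemma peeling:
  fixes S :: "real \<Rightarrow> ennreal"
  assumes H: "H \<subseteq> Linf_unit M" and h: "h \<in> H" and n: "0 < n" and \<delta>: "0 < \<delta>" and J: "1 \<le> 2 ^ J * \<delta>"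
    and Z: "Z = sqrt (\<integral>x. (h x)\<^sup>2 \<partial>M)" and basic: "n * Z\<^sup>2 \<le> D"
    and S: "\<And>r. h \<in> local_class M H r \<Longrightarrow> ennreal D \<le> S r"
  shows "ennreal Z \<le> ennreal \<delta> + (\<Sum>j<J. S (min 1 (2 ^ Suc j * \<delta>)) * ennreal (1 / (n * (2 ^ j * \<delta>))))"
proof (cases "Z \<le> \<delta>")
  case True
  then show ?thesis by (intro order_trans[OF ennreal_leI[OF True]]) simp
next
  case False
  have sq0: "0 \<le> (\<integral>x. (h x)\<^sup>2 \<partial>M)" by simp
  have sq1: "(\<integral>x. (h x)\<^sup>2 \<partial>M) \<le> 1"
    using h H Linf_unitD[of h M]
    by (intro expectation_le_const[where b=1]) (auto simp: abs_square_le_1)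
  have Z2: "Z\<^sup>2 = (\<integral>x. (h x)\<^sup>2 \<partial>M)" using Z sq0 by simp
  have Z1: "0 < Z" "Z \<le> 1" using False \<delta> by linarith (use sq1 Z in simp)
  define i where "i = (LEAST j. Z \<le> 2 ^ j * \<delta>)"
  have ex: "Z \<le> 2 ^ J * \<delta>" using Z1 J by linarith
  have i: "Z \<le> 2 ^ i * \<delta>" "i \<le> J"
    unfolding i_def using LeastI[of "\<lambda>j. Z \<le> 2 ^ j * \<delta>" J] Least_le[of "\<lambda>j. Z \<le> 2 ^ j * \<delta>" J] ex by auto
  have "i \<noteq> 0" using i(1) False by (cases i) auto
  then obtain j where j: "i = Suc j" by (cases i) auto
  have "\<not> Z \<le> 2 ^ j * \<delta>"
    using not_less_Least[of j "\<lambda>j. Z \<le> 2 ^ j * \<delta>"] j unfolding i_def by auto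
  then have lower: "2 ^ j * \<delta> \<le> Z" by simp
  have "Z \<le> min 1 (2 ^ Suc j * \<delta>)" using Z1 i(1) j by simp
  then have "Z\<^sup>2 \<le> (min 1 (2 ^ Suc j * \<delta>))\<^sup>2" using Z1 by (intro power_mono) auto
  then have local: "h \<in> local_class M H (min 1 (2 ^ Suc j * \<delta>))"
    using h Z2 by (simp add: local_class_def)
  have pos: "0 < n * (2 ^ j * \<delta>)" using n \<delta> by simp
  have "n * (2 ^ j * \<delta>) * Z \<le> n * Z * Z"
    using lower n Z1 by (intro mult_right_mono mult_left_mono) auto
  also have "\<dots> \<le> D" using basic by (simp add: power2_eq_square mult.assoc)
  finally have "Z \<le> D * (1 / (n * (2 ^ j * \<delta>)))" using pos by (simp add: le_divide_eq mult.commute)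
  then have "ennreal Z \<le> ennreal (D * (1 / (n * (2 ^ j * \<delta>))))" by (rule ennreal_leI)
  also have "\<dots> = ennreal D * ennreal (1 / (n * (2 ^ j * \<delta>)))"
    using pos by (intro ennreal_mult'') simp
  also have "\<dots> \<le> S (min 1 (2 ^ Suc j * \<delta>)) * ennreal (1 / (n * (2 ^ j * \<delta>)))"
    by (intro mult_right_mono S local) simp
  also have "\<dots> \<le> (\<Sum>j<J. S (min 1 (2 ^ Suc j * \<delta>)) * ennreal (1 / (n * (2 ^ j * \<delta>))))"
    using i(2) j by (intro member_le_sum) auto
  finally show ?thesis by (rule order_trans) simp
qed

text \<open>The risk bound in expectation for one sample size, with an explicit constant that does not
  depend on it.\<close>

lemma lse_expected_rate:
  fixes N :: "'w measure" and n :: nat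
  defines "I \<equiv> {1..n}"
  assumes lcb: "local_complexity_bound M H \<alpha> K" and K: "0 \<le> K" and H: "H \<subseteq> Linf_unit M" "countable H" "(\<lambda>_. 0) \<in> H"
    and n: "1 \<le> n" and \<mu>: "prob_space \<mu>" "sets \<mu> = sets (PiM I (\<lambda>_. borel))"
    and tail: "\<And>i t. i \<in> I \<Longrightarrow> 0 \<le> t \<Longrightarrow> measure \<mu> {e \<in> space \<mu>. t < \<bar>e i\<bar>} = T t"
    and \<Lambda>: "(\<integral>\<^sup>+t\<in>{0..}. ennreal (T t powr (1 / p)) \<partial>lborel) = ennreal \<Lambda>" "0 \<le> \<Lambda>"
    and p: "1 \<le> p" and \<alpha>: "0 < \<alpha>" "\<alpha> < 2" and cent: "centered_multiplier M I H \<mu>"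
    and E: "E \<in> measurable N (PiM I (\<lambda>_. borel))" and V: "V \<in> measurable N (iid I M)"
    and law: "distr N (PiM I (\<lambda>_. borel) \<Otimes>\<^sub>M iid I M) (\<lambda>\<omega>. (E \<omega>, V \<omega>)) = \<mu> \<Otimes>\<^sub>M iid I M"
    and N: "prob_space N"
    and Z: "AE \<omega> in N. \<exists>h\<in>H. Z \<omega> = sqrt (\<integral>x. (h x)\<^sup>2 \<partial>M) \<and> real n * (Z \<omega>)\<^sup>2 \<le> lse_process M I h (E \<omega>) (V \<omega>)"
  shows "(\<integral>\<^sup>+\<omega>. ennreal (Z \<omega>) \<partial>N)
    \<le> ennreal ((1 + 3 * (16 * K * \<Lambda> + 8 * K + 4) / (1 - 2 powr (- \<alpha> / 2))) * lse_rate \<alpha> p n)"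
proof -
  interpret N: prob_space N by (rule N)
  define C where "C = 16 * K * \<Lambda> + 8 * K + 4"
  have C: "0 \<le> C" using K \<Lambda>(2) by (simp add: C_def)
  define \<delta> where "\<delta> = lse_rate \<alpha> p n"
  define s where "s = max (1 / p) (\<alpha> / (2 + \<alpha>))"
  note rate = lse_rate_facts[OF n p \<alpha>(1), folded \<delta>_def s_def]
  have n0: "0 < real n" using n by simp
  have I: "finite I" "I \<noteq> {}" "card I = n" using n by (auto simp: I_def)
  obtain J where "1 / 2 ^ J \<le> \<delta>" using half_pow_tendsto[OF rate(1), of 1] by auto
  then have J: "1 \<le> 2 ^ J * \<delta>" by (simp add: divide_le_eq mult.commute)
  define S where "S r z = (SUP h\<in>local_class M H r. ennreal (lse_process M I h (fst z) (snd z)))" for r z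
  define R where "R j = min 1 (2 ^ Suc j * \<delta>)" for j :: nat
  have R: "0 < R j" "R j \<le> 1" for j using rate(1) by (auto simp: R_def)
  note sup = expected_local_sup[OF lcb K H \<mu> I(1,2) tail \<Lambda> p \<alpha> R cent, folded C_def s_def S_def]
  have Smeas0: "S (R j) \<in> borel_measurable (\<mu> \<Otimes>\<^sub>M iid I M)" for j
    by (rule sup(2))
  have sets_eq: "sets (\<mu> \<Otimes>\<^sub>M iid I M) = sets (PiM I (\<lambda>_. borel) \<Otimes>\<^sub>M iid I M)"
    by (intro sets_pair_measure_cong \<mu>(2) refl)
  have Smeas: "S (R j) \<in> borel_measurable (PiM I (\<lambda>_. borel) \<Otimes>\<^sub>M iid I M)" for j
    using Smeas0[of j] unfolding measurable_cong_sets[OF sets_eq refl] .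
  have EV: "(\<lambda>\<omega>. (E \<omega>, V \<omega>)) \<in> measurable N (PiM I (\<lambda>_. borel) \<Otimes>\<^sub>M iid I M)"
    by (rule measurable_Pair[OF E V])
  have SN: "(\<lambda>\<omega>. S (R j) (E \<omega>, V \<omega>)) \<in> borel_measurable N" for j
    by (rule measurable_compose[OF EV Smeas])
  have SE: "(\<integral>\<^sup>+\<omega>. S (R j) (E \<omega>, V \<omega>) \<partial>N) \<le> ennreal (C * (sqrt (real n) * R j powr (1 - \<alpha> / 2) + real n powr s))" for j
  proof -
    have "(\<integral>\<^sup>+\<omega>. S (R j) (E \<omega>, V \<omega>) \<partial>N) = (\<integral>\<^sup>+z. S (R j) z \<partial>(\<mu> \<Otimes>\<^sub>M iid I M))"
      unfolding law[symmetric] using Smeas by (intro nn_integral_distr[OF EV, symmetric]) simp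
    also have "\<dots> \<le> ennreal (C * (sqrt (real n) * R j powr (1 - \<alpha> / 2) + real n powr s))"
      using sup(1) I(3) by simp
    finally show ?thesis .
  qed
  have "AE \<omega> in N. ennreal (Z \<omega>) \<le> ennreal \<delta> + (\<Sum>j<J. S (R j) (E \<omega>, V \<omega>) * ennreal (1 / (real n * (2 ^ j * \<delta>))))"
    using Z
  proof (rule AE_mp, intro AE_I2 impI)
    fix \<omega> assume "\<exists>h\<in>H. Z \<omega> = sqrt (\<integral>x. (h x)\<^sup>2 \<partial>M) \<and> real n * (Z \<omega>)\<^sup>2 \<le> lse_process M I h (E \<omega>) (V \<omega>)"
    then obtain h where h: "h \<in> H" "Z \<omega> = sqrt (\<integral>x. (h x)\<^sup>2 \<partial>M)"
      "real n * (Z \<omega>)\<^sup>2 \<le> lse_process M I h (E \<omega>) (V \<omega>)" by blast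
    show "ennreal (Z \<omega>) \<le> ennreal \<delta> + (\<Sum>j<J. S (R j) (E \<omega>, V \<omega>) * ennreal (1 / (real n * (2 ^ j * \<delta>))))"
      unfolding R_def
    proof (rule peeling[OF H(1) h(1) n0 rate(1) J h(2,3)])
      fix r assume "h \<in> local_class M H r"
      then show "ennreal (lse_process M I h (E \<omega>) (V \<omega>)) \<le> S r (E \<omega>, V \<omega>)"
        unfolding S_def by (intro SUP_upper2[of h]) auto
    qed
  qed
  then have "(\<integral>\<^sup>+\<omega>. ennreal (Z \<omega>) \<partial>N)
      \<le> (\<integral>\<^sup>+\<omega>. ennreal \<delta> + (\<Sum>j<J. S (R j) (E \<omega>, V \<omega>) * ennreal (1 / (real n * (2 ^ j * \<delta>)))) \<partial>N)"
    by (rule nn_integral_mono_AE)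
  also have "\<dots> = ennreal \<delta> + (\<Sum>j<J. (\<integral>\<^sup>+\<omega>. S (R j) (E \<omega>, V \<omega>) \<partial>N) * ennreal (1 / (real n * (2 ^ j * \<delta>))))"
    using SN by (simp add: nn_integral_add nn_integral_sum nn_integral_multc N.emeasure_space_1)
  also have "\<dots> \<le> ennreal \<delta> + (\<Sum>j<J. ennreal (3 * C * \<delta> * (2 powr (- \<alpha> / 2)) ^ j))"
  proof (intro add_left_mono sum_mono)
    fix j
    have pos: "0 < real n * (2 ^ j * \<delta>)" using n0 rate(1) by simp
    have "(\<integral>\<^sup>+\<omega>. S (R j) (E \<omega>, V \<omega>) \<partial>N) * ennreal (1 / (real n * (2 ^ j * \<delta>)))
        \<le> ennreal (C * (sqrt (real n) * R j powr (1 - \<alpha> / 2) + real n powr s)) * ennreal (1 / (real n * (2 ^ j * \<delta>)))"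
      by (intro mult_right_mono SE) simp
    also have "\<dots> = ennreal (C * (sqrt (real n) * R j powr (1 - \<alpha> / 2) + real n powr s) / (real n * (2 ^ j * \<delta>)))"
      using pos by (subst ennreal_mult''[symmetric]) auto
    also have "\<dots> \<le> ennreal (3 * C * \<delta> * (2 powr (- \<alpha> / 2)) ^ j)"
      unfolding R_def by (intro ennreal_leI peeling_term n0 rate \<alpha> C)
    finally show "(\<integral>\<^sup>+\<omega>. S (R j) (E \<omega>, V \<omega>) \<partial>N) * ennreal (1 / (real n * (2 ^ j * \<delta>)))
        \<le> ennreal (3 * C * \<delta> * (2 powr (- \<alpha> / 2)) ^ j)" .
  qed
  also have "(\<Sum>j<J. ennreal (3 * C * \<delta> * (2 powr (- \<alpha> / 2)) ^ j)) = ennreal (3 * C * \<delta> * (\<Sum>j<J. (2 powr (- \<alpha> / 2)) ^ j))"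
    using C rate(1) by (simp add: sum_distrib_left sum_ennreal)
  also have "ennreal \<delta> + ennreal (3 * C * \<delta> * (\<Sum>j<J. (2 powr (- \<alpha> / 2)) ^ j))
      \<le> ennreal \<delta> + ennreal (3 * C * \<delta> * (1 / (1 - 2 powr (- \<alpha> / 2))))"
    using C rate(1) \<alpha> by (intro add_left_mono ennreal_leI mult_left_mono sum_geometric_le) (auto simp: powr_less_one)
  also have "\<dots> = ennreal (\<delta> + 3 * C * \<delta> * (1 / (1 - 2 powr (- \<alpha> / 2))))"
    using C rate(1) \<alpha> by (intro ennreal_plus[symmetric]) (auto simp: powr_less_one less_imp_le)
  also have "\<delta> + 3 * C * \<delta> * (1 / (1 - 2 powr (- \<alpha> / 2))) = (1 + 3 * C / (1 - 2 powr (- \<alpha> / 2))) * \<delta>"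
    by (simp add: distrib_right)
  finally show ?thesis by (simp only: C_def \<delta>_def)
qed

end

section \<open>The rate of convergence\<close>

lemma distr_indep_rv:
  assumes M: "prob_space M" and ind: "indep_rv M A U B V"
  shows "distr M (A \<Otimes>\<^sub>M B) (\<lambda>\<omega>. (U \<omega>, V \<omega>)) = distr M A U \<Otimes>\<^sub>M distr M B V"
proof -
  interpret prob_space M by (rule M)
  have U: "U \<in> measurable M A" and V: "V \<in> measurable M B"
    and sets: "indep_set {U -` S \<inter> space M |S. S \<in> sets A} {V -` S \<inter> space M |S. S \<in> sets B}"
    using ind by (auto simp: indep_rv_def)
  interpret DU: prob_space "distr M A U" by (rule prob_space_distr[OF U])
  interpret DV: prob_space "distr M B V" by (rule prob_space_distr[OF V])
  show ?thesis
  proof (rule pair_measure_eqI[symmetric])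
    show "sigma_finite_measure (distr M A U)" "sigma_finite_measure (distr M B V)" by standard
    show "sets (distr M A U \<Otimes>\<^sub>M distr M B V) = sets (distr M (A \<Otimes>\<^sub>M B) (\<lambda>\<omega>. (U \<omega>, V \<omega>)))"
      by (simp cong: sets_pair_measure_cong)
    fix S T assume ST: "S \<in> sets (distr M A U)" "T \<in> sets (distr M B V)"
    have "prob ((U -` S \<inter> space M) \<inter> (V -` T \<inter> space M)) = prob (U -` S \<inter> space M) * prob (V -` T \<inter> space M)"
      using ST by (intro indep_setD[OF sets]) auto
    moreover have "(\<lambda>\<omega>. (U \<omega>, V \<omega>)) -` (S \<times> T) \<inter> space M = (U -` S \<inter> space M) \<inter> (V -` T \<inter> space M)" by auto
    ultimately show "emeasure (distr M A U) S * emeasure (distr M B V) T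
        = emeasure (distr M (A \<Otimes>\<^sub>M B) (\<lambda>\<omega>. (U \<omega>, V \<omega>))) (S \<times> T)"
      using ST U V
      by (simp add: emeasure_distr measurable_Pair emeasure_eq_measure ennreal_mult'[symmetric])
  qed
qed

theorem theorem3:
  fixes P :: "'x measure" and F :: "('x \<Rightarrow> real) set" and f0 :: "'x \<Rightarrow> real"
    and M :: "nat \<Rightarrow> 'w measure"
    and X :: "nat \<Rightarrow> nat \<Rightarrow> 'w \<Rightarrow> 'x"
    and \<xi> Y :: "nat \<Rightarrow> nat \<Rightarrow> 'w \<Rightarrow> real"
    and fhat :: "nat \<Rightarrow> 'w \<Rightarrow> 'x \<Rightarrow> real"
    and p \<alpha> :: real
  assumes "prob_space P"
    and "\<And>n. prob_space (M n)"
    and "countable F"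
    and "F \<subseteq> borel_measurable P"
    and "f0 \<in> F"
    and X_indep: "\<And>n. prob_space.indep_vars (M n) (\<lambda>_. P) (X n) {1..n}"
    and X_law: "\<And>n i. i \<in> {1..n} \<Longrightarrow> distr (M n) P (X n i) = P"
    and model: "\<And>n i \<omega>. i \<in> {1..n} \<Longrightarrow> \<omega> \<in> space (M n) \<Longrightarrow>
                  Y n i \<omega> = f0 (X n i \<omega>) + \<xi> n i \<omega>"
    and errors_indep_X: "\<And>n. indep_rv (M n)
          (PiM {1..n} (\<lambda>_. borel)) (\<lambda>\<omega>. \<lambda>i\<in>{1..n}. \<xi> n i \<omega>)
          (PiM {1..n} (\<lambda>_. P)) (\<lambda>\<omega>. \<lambda>i\<in>{1..n}. X n i \<omega>)"
    and errors_same_law: "\<And>n i. i \<in> {1..n} \<Longrightarrow>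
          distr (M n) borel (\<xi> n i) = distr (M 1) borel (\<xi> 1 1)"
    and errors_mean_zero: "\<And>n i. i \<in> {1..n} \<Longrightarrow> has_bochner_integral (M n) (\<xi> n i) 0"
    and "p \<ge> 1"
    and errors_moment: "Lp1_norm (M 1) (\<xi> 1 1) p < \<infinity>"
    and centered_or_iid: "centered_class P F \<or>
          (\<forall>n. prob_space.indep_vars (M n) (\<lambda>_. borel) (\<xi> n) {1..n})"
    and "0 < \<alpha>" and "\<alpha> < 2"
    and "(\<lambda>f x. f x - f0 x) ` F \<subseteq> Linf_unit P"
    and "entropy_condition P ((\<lambda>f x. f x - f0 x) ` F) \<alpha>"
    and fhat_lse: "\<And>n. AE \<omega> in M n.
          least_squares_estimate n F (\<lambda>i. X n i \<omega>) (\<lambda>i. Y n i \<omega>) (fhat n \<omega>)"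
    and fhat_measurable:
          "\<And>n. (\<lambda>\<omega>. L2_norm P (\<lambda>x. fhat n \<omega> x - f0 x)) \<in> borel_measurable (M n)"
  shows "bigo_in_prob M (\<lambda>n \<omega>. L2_norm P (\<lambda>x. fhat n \<omega> x - f0 x)) (lse_rate \<alpha> p) \<and>
    ((\<forall>n. prob_space.indep_vars (M n) (\<lambda>_. borel) (\<xi> n) {1..n}) \<and> p \<ge> 2 \<longrightarrow>
      (\<lambda>n. \<integral>\<omega>. L2_norm P (\<lambda>x. fhat n \<omega> x - f0 x) \<partial>M n) \<in> O(lse_rate \<alpha> p))"
proof -
  interpret P: prob_space P by fact
  (* The class of differences contains the error of the estimator and, as f0 belongs to F, zero. *)
  define H where "H = (\<lambda>f x. f x - f0 x) ` F"
  have H: "H \<subseteq> Linf_unit P" "countable H" "(\<lambda>_. 0) \<in> H"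
    using assms(3,5,17) by (auto simp: H_def image_iff intro!: bexI[of _ f0])
  obtain K where K: "0 \<le> K" "local_complexity_bound P H \<alpha> K"
    using P.local_complexity_bound_entropy[of H \<alpha>] assms(15,16,18) H by (auto simp: H_def)
  define T where "T t = measure (M 1) {\<omega> \<in> space (M 1). \<bar>\<xi> 1 1 \<omega>\<bar> > t}" for t
  define \<Lambda> where "\<Lambda> = enn2real (Lp1_norm (M 1) (\<xi> 1 1) p)"
  have \<Lambda>: "(\<integral>\<^sup>+t\<in>{0..}. ennreal (T t powr (1 / p)) \<partial>lborel) = ennreal \<Lambda>" "0 \<le> \<Lambda>"
    using errors_moment by (simp_all add: \<Lambda>_def Lp1_norm_def T_def less_top)
  define C where "C = 1 + 3 * (16 * K * \<Lambda> + 8 * K + 4) / (1 - 2 powr (- \<alpha> / 2))"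
  have "2 powr (- \<alpha> / 2) < (1::real)" using assms(15) by (simp add: powr_less_one)
  then have C: "0 < C" unfolding C_def using K \<Lambda>(2)
    by (intro add_pos_nonneg divide_nonneg_nonneg mult_nonneg_nonneg) auto
  let ?Z = "\<lambda>n \<omega>. L2_norm P (\<lambda>x. fhat n \<omega> x - f0 x)"
  have Z0: "0 \<le> ?Z n \<omega>" for n \<omega> by (simp add: L2_norm_def)
  have rate: "(\<integral>\<^sup>+\<omega>. ennreal (?Z n \<omega>) \<partial>M n) \<le> ennreal (C * lse_rate \<alpha> p n)" if n: "1 \<le> n" for n
  proof -
    interpret Mn: prob_space "M n" by fact
    let ?I = "{1..n}"
    let ?E = "\<lambda>\<omega>. \<lambda>i\<in>?I. \<xi> n i \<omega>" and ?V = "\<lambda>\<omega>. \<lambda>i\<in>?I. X n i \<omega>"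
    define \<mu> where "\<mu> = distr (M n) (PiM ?I (\<lambda>_. borel)) ?E"
    have E: "?E \<in> measurable (M n) (PiM ?I (\<lambda>_. borel))" and V: "?V \<in> measurable (M n) (PiM ?I (\<lambda>_. P))"
      using errors_indep_X[of n] by (auto simp: indep_rv_def)
    have I: "?I \<noteq> {}" using n by auto
    have \<xi>m: "\<xi> n i \<in> borel_measurable (M n)" if "i \<in> ?I" for i
      using errors_mean_zero[OF that] by (auto dest: borel_measurable_has_bochner_integral)
    have \<xi>1: "\<xi> 1 1 \<in> borel_measurable (M 1)"
      using errors_mean_zero[of 1 1] by (auto dest: borel_measurable_has_bochner_integral)
    have V_law: "distr (M n) (PiM ?I (\<lambda>_. P)) ?V = PiM ?I (\<lambda>_. P)"
    proof -
      have "distr (M n) (PiM ?I (\<lambda>_. P)) ?V = PiM ?I (\<lambda>i. distr (M n) P (X n i))"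
        using X_indep[of n] Mn.indep_vars_iff_distr_eq_PiM'[OF I, where X="X n" and M'="\<lambda>_. P"]
        by (auto simp: Mn.indep_vars_def)
      also have "\<dots> = PiM ?I (\<lambda>_. P)" using X_law by (intro PiM_cong) auto
      finally show ?thesis .
    qed
    show ?thesis
      unfolding C_def
    proof (rule P.lse_expected_rate[OF K(2,1) H n, where E="?E" and V="?V" and \<mu>=\<mu> and T=T])
      show "prob_space \<mu>" unfolding \<mu>_def by (rule Mn.prob_space_distr[OF E])
      show "sets \<mu> = sets (PiM ?I (\<lambda>_. borel))" by (simp add: \<mu>_def)
      show "measure \<mu> {e \<in> space \<mu>. t < \<bar>e i\<bar>} = T t" if i: "i \<in> ?I" and t: "0 \<le> t" for i t
      proof -
        have m: "{y :: real. t < \<bar>y\<bar>} \<in> sets borel" by measurable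
        have c: "(\<lambda>e. e i) \<in> borel_measurable (PiM ?I (\<lambda>_. borel :: real measure))"
          by (rule measurable_component_singleton[OF i])
        have "{e \<in> space \<mu>. t < \<bar>e i\<bar>} = (\<lambda>e. e i) -` {y. t < \<bar>y\<bar>} \<inter> space (PiM ?I (\<lambda>_. borel))"
          by (auto simp: \<mu>_def)
        then have "measure \<mu> {e \<in> space \<mu>. t < \<bar>e i\<bar>}
            = measure (distr \<mu> borel (\<lambda>e. e i)) {y. t < \<bar>y\<bar>}"
          using c m by (subst measure_distr) (auto simp: \<mu>_def)
        also have "distr \<mu> borel (\<lambda>e. e i) = distr (M n) borel (\<xi> n i)"
          unfolding \<mu>_def using i by (subst distr_distr[OF c E]) (auto intro!: distr_cong)
        also have "\<dots> = distr (M 1) borel (\<xi> 1 1)" by (rule errors_same_law[OF i])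
        also have "measure \<dots> {y. t < \<bar>y\<bar>} = T t"
          unfolding T_def using \<xi>1 m
          by (subst measure_distr) (auto intro!: arg_cong2[where f=measure])
        finally show ?thesis .
      qed
      show "centered_multiplier P ?I H \<mu>"
        using centered_or_iid
      proof
        assume "centered_class P F"
        then have "(\<integral>x. f x - f0 x \<partial>P) = 0" if "f \<in> F" for f
          using that assms(5) has_bochner_integral_diff[of P f 0 f0 0]
          by (auto simp: centered_class_def has_bochner_integral_integral_eq)
        then show ?thesis by (auto simp: centered_multiplier_def H_def)
      next
        assume indep: "\<forall>n. prob_space.indep_vars (M n) (\<lambda>_. borel) (\<xi> n) {1..n}"
        define \<nu> where "\<nu> = distr (M 1) borel (\<xi> 1 1)"
        have "\<mu> = PiM ?I (\<lambda>i. distr (M n) borel (\<xi> n i))"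
          unfolding \<mu>_def
        proof (rule iffD1[OF Mn.indep_vars_iff_distr_eq_PiM'[OF I]])
          show "\<xi> n i \<in> borel_measurable (M n)" if "i \<in> ?I" for i by (rule \<xi>m[OF that])
          show "Mn.indep_vars (\<lambda>_. borel) (\<xi> n) ?I" using indep by blast
        qed
        also have "\<dots> = PiM ?I (\<lambda>_. \<nu>)"
          unfolding \<nu>_def by (intro PiM_cong refl errors_same_law)
        finally have "\<mu> = PiM ?I (\<lambda>_. \<nu>)" .
        moreover have "prob_space \<nu>"
          unfolding \<nu>_def using assms(2) \<xi>1 by (intro prob_space.prob_space_distr)
        moreover have "integrable \<nu> (\<lambda>y. y)" "(\<integral>y. y \<partial>\<nu>) = 0"
          unfolding \<nu>_def using \<xi>1 errors_mean_zero[of 1 1]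
          by (auto simp: integrable_distr_eq integral_distr has_bochner_integral_iff)
        moreover have "sets \<nu> = sets borel" by (simp add: \<nu>_def)
        ultimately show ?thesis unfolding centered_multiplier_def by blast
      qed
      show "distr (M n) (PiM ?I (\<lambda>_. borel) \<Otimes>\<^sub>M PiM ?I (\<lambda>_. P)) (\<lambda>\<omega>. (?E \<omega>, ?V \<omega>)) = \<mu> \<Otimes>\<^sub>M PiM ?I (\<lambda>_. P)"
        unfolding distr_indep_rv[OF assms(2) errors_indep_X] V_law \<mu>_def ..
      show "AE \<omega> in M n. \<exists>h\<in>H. ?Z n \<omega> = sqrt (\<integral>x. (h x)\<^sup>2 \<partial>P) \<and>
          real n * (?Z n \<omega>)\<^sup>2 \<le> lse_process P ?I h (?E \<omega>) (?V \<omega>)"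
        using fhat_lse[of n]
      proof (rule AE_mp, intro AE_I2 impI)
        fix \<omega> assume \<omega>: "\<omega> \<in> space (M n)"
          and lse: "least_squares_estimate n F (\<lambda>i. X n i \<omega>) (\<lambda>i. Y n i \<omega>) (fhat n \<omega>)"
        let ?h = "\<lambda>z. fhat n \<omega> z - f0 z"
        have "?h \<in> H" using lse by (auto simp: H_def least_squares_estimate_def is_arg_min_def)
        moreover have "real n * (\<integral>z. (?h z)\<^sup>2 \<partial>P) \<le> lse_process P ?I ?h (\<lambda>i. \<xi> n i \<omega>) (\<lambda>i. X n i \<omega>)"
          using \<omega> by (intro lse_basic_inequality[OF n lse assms(5)] model)
        moreover have "lse_process P ?I ?h (\<lambda>i. \<xi> n i \<omega>) (\<lambda>i. X n i \<omega>) = lse_process P ?I ?h (?E \<omega>) (?V \<omega>)"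
          by (simp add: lse_process_def)
        ultimately show "\<exists>h\<in>H. ?Z n \<omega> = sqrt (\<integral>x. (h x)\<^sup>2 \<partial>P) \<and>
            real n * (?Z n \<omega>)\<^sup>2 \<le> lse_process P ?I h (?E \<omega>) (?V \<omega>)"
          by (intro bexI[of _ ?h]) (auto simp: L2_norm_def)
      qed
    qed (use E V assms \<Lambda> in auto)
  qed
  have pos: "0 < lse_rate \<alpha> p n" if "1 \<le> n" for n
    using lse_rate_facts(1)[OF that assms(12,15)] .
  have Zint: "integrable (M n) (?Z n)" and EZ: "(\<integral>\<omega>. ?Z n \<omega> \<partial>M n) \<le> C * lse_rate \<alpha> p n" if n: "1 \<le> n" for n
  proof -
    show int: "integrable (M n) (?Z n)"
      using rate[OF n] fhat_measurable Z0
      by (intro integrableI_bounded) (auto simp: le_less_trans[OF _ ennreal_less_top])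
    have "ennreal (\<integral>\<omega>. ?Z n \<omega> \<partial>M n) \<le> ennreal (C * lse_rate \<alpha> p n)"
      using rate[OF n] nn_integral_eq_integral[OF int] Z0 by simp
    then show "(\<integral>\<omega>. ?Z n \<omega> \<partial>M n) \<le> C * lse_rate \<alpha> p n"
      using C pos[OF n] by (subst (asm) ennreal_le_iff) auto
  qed
  have "bigo_in_prob M ?Z (lse_rate \<alpha> p)"
    unfolding bigo_in_prob_def
  proof (intro allI impI)
    fix \<epsilon> :: real assume \<epsilon>: "0 < \<epsilon>"
    have "measure (M n) {\<omega> \<in> space (M n). \<bar>?Z n \<omega>\<bar> > C / \<epsilon> * lse_rate \<alpha> p n} \<le> \<epsilon>" if n: "1 \<le> n" for n
    proof -
      interpret Mn: prob_space "M n" by fact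
      let ?c = "C / \<epsilon> * lse_rate \<alpha> p n"
      have c: "0 < ?c" using C \<epsilon> pos[OF n] by simp
      have "measure (M n) {\<omega> \<in> space (M n). \<bar>?Z n \<omega>\<bar> > ?c} \<le> measure (M n) {\<omega> \<in> space (M n). ?c \<le> ?Z n \<omega>}"
        using Z0 fhat_measurable[of n] by (intro Mn.finite_measure_mono) auto
      also have "\<dots> \<le> (\<integral>\<omega>. ?Z n \<omega> \<partial>M n) / ?c"
        using Zint[OF n] Z0 c by (intro integral_Markov_inequality_measure[where A="space (M n)"]) auto
      also have "\<dots> \<le> C * lse_rate \<alpha> p n / ?c"
        using EZ[OF n] c by (intro divide_right_mono) auto
      also have "\<dots> = \<epsilon>" using C \<epsilon> pos[OF n] by simp
      finally show ?thesis .
    qed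
    then show "\<exists>K>0. \<forall>\<^sub>F n in sequentially.
        measure (M n) {\<omega> \<in> space (M n). \<bar>?Z n \<omega>\<bar> > K * lse_rate \<alpha> p n} \<le> \<epsilon>"
      using C \<epsilon> by (intro exI[of _ "C / \<epsilon>"] conjI eventually_sequentiallyI[of 1]) auto
  qed
  moreover have "(\<lambda>n. \<integral>\<omega>. ?Z n \<omega> \<partial>M n) \<in> O(lse_rate \<alpha> p)"
  proof (rule bigoI[of _ C], rule eventually_sequentiallyI[of 1])
    fix n :: nat assume n: "1 \<le> n"
    have "0 \<le> (\<integral>\<omega>. ?Z n \<omega> \<partial>M n)" using Z0 by (intro Bochner_Integration.integral_nonneg)
    then show "norm (\<integral>\<omega>. ?Z n \<omega> \<partial>M n) \<le> C * norm (lse_rate \<alpha> p n)"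
      using EZ[OF n] pos[OF n] by simp
  qed
  ultimately show ?thesis by blast
qed

end
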